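(* Let $n(N)\in\mathbb{N}$ (positive integers) and $\kappa(N),\lambda(N)\in[0,\infty)$, $N\in\mathbb{N}$, be sequences such that $n(N)/N\to\rho$, $\kappa(N)/N\to\kappa$, $\lambda(N)/N\to\lambda$ as $N\to\infty$, for some $\rho\in(0,\infty)$ and $\kappa,\lambda\in[0,\infty)$. Let $\mathbb{P}_N$ be the Jacobi ensemble on $[0,1]^{n(N)}$ with parameters $(n(N),\kappa(N),\lambda(N))$, and let $V_{\mathrm{eff}}:[0,1]\to(-\infty,\infty]$ be the effective potential associated with $(\rho,\kappa,\lambda)$ (both as defined in the context). For every Borel subset $X$ of $[0,1]$ define $$\widehat{\mathbb{P}}_N(X):=\mathbb{P}_N\big(\{(x_1,\ldots,x_{n(N)})\in[0,1]^{n(N)} : \{x_1,\ldots,x_{n(N)}\}\cap X\neq\emptyset\}\big).$$ Then the sequence $\widehat{\mathbb{P}}_N$ satisfies the large deviation principle in scale $1/N$ with good rate function $2\rho V_{\mathrm{eff}}$. That is, $2\rho V_{\mathrm{eff}}$ is a good rate function on $[0,1]$, and for every open set $O$ of $[0,1]$ (in the relative topology) and every closed set $F$ of $[0,1]$, $$\liminf_{N\to\infty}\frac1N\log\widehat{\mathbb{P}}_N(O)\ \ge\ -\inf_{x\in O}2\rho V_{\mathrm{eff}}(x),$$ $$\limsup_{N\to\infty}\frac1N\log\widehat{\mathbb{P}}_N(F)\ \le\ -\inf_{x\in F}2\rho V_{\mathrm{eff}}(x).$$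
   Context: Conventions: $\log 0=-\infty$, $0\cdot\log 0=0$, $\inf\emptyset=+\infty$. A good rate function on $[0,1]$ is a lower semicontinuous function with values in $[0,\infty]$ whose sublevel sets $\{x: f(x)\le K\}$, $K\in\mathbb{R}$, are compact. Jacobi ensemble: $\mathbb{P}_N$ is the probability measure on $[0,1]^{n(N)}$ given by $$\frac{1}{Z(N)}\exp\Big(-2n(N)\sum_{i=1}^{n(N)}V_N(x_i)+2\sum_{1\le i<j\le n(N)}\log|x_i-x_j|\Big)\prod_{i=1}^{n(N)}1_{[0,1]}(x_i)\,dx_i,$$ where $V_N(x):=-\frac{\kappa(N)}{2n(N)}\log x-\frac{\lambda(N)}{2n(N)}\log(1-x)$ and $Z(N)$ is the normalization constant. Known facts (Hiai–Petz) used to define the objects below: under the assumptions $n(N)/N\to\rho$, $\kappa(N)/N\to\kappa$, $\lambda(N)/N\to\lambda$, the limit $\lim_{N\to\infty}N^{-2}\log Z(N)$ exists, is finite, and depends only on $(\rho,\kappa,\lambda)$; it is written $\rho^2 B(\kappa/\rho,\lambda/\rho)$, which determines the number $B(\kappa/\rho,\lambda/\rho)$. Let $\mathcal{P}([0,1])$ be the set of Borel probability measures on $[0,1]$. The functional $$I(\mu):=-\rho^2\iint\log|x-y|\,d\mu(x)\,d\mu(y)-\rho\int_0^1\big(\kappa\log x+\lambda\log(1-x)\big)\,d\mu(x)+\rho^2B(\kappa/\rho,\lambda/\rho)$$ on $\mathcal{P}([0,1])$ has a unique minimizer $\mu_0\in\mathcal{P}([0,1])$, and $I(\mu_0)=0$.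 Moreover, when $(x_1,\dots,x_{n(N)})$ is distributed under $\mathbb{P}_N$, the empirical measure $\frac{1}{n(N)}\sum_{i=1}^{n(N)}\delta_{x_i}$ satisfies the large deviation principle on $\mathcal{P}([0,1])$ (weak topology) in scale $1/N^2$ with good rate function $I$. Effective potential: for $x\in[0,1]$, $$V_{\mathrm{eff}}(x):=V(x)-\int_0^1\log|x-y|\,d\mu_0(y)-D_{\rho,\kappa,\lambda},$$ where $$V(x):=-\frac{\kappa}{2\rho}\log x-\frac{\lambda}{2\rho}\log(1-x),\qquad D_{\rho,\kappa,\lambda}:=-B(\kappa/\rho,\lambda/\rho)-\int_0^1V(x)\,d\mu_0(x).$$ *)

theory Defs
  imports "HOL-Probability.Probability"
begin

text \<open>
  The library logarithm has \<open>ln 0 = 0\<close>; here \<open>log 0 = -\<infinity>\<close>.  The convention \<open>0 \<cdot> log 0 = 0\<close> is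
  built into the multiplication of \<^typ>\<open>ereal\<close>.  Negative arguments do not occur.
\<close>

definition elog :: "real \<Rightarrow> ereal" where
  "elog x = (if x \<le> 0 then -\<infinity> else ereal (ln x))"

definition eexp :: "ereal \<Rightarrow> ennreal" where
  "eexp x = (if x = \<infinity> then \<infinity> else if x = -\<infinity> then 0 else ennreal (exp (real_of_ereal x)))"

text \<open>
  Lebesgue integral of an extended-real function, positive part minus negative part.  A Bochner
  integral would be \<open>0\<close> for a non-integrable function.  All integrands below have constant sign
  on \<open>[0,1]\<close>, so \<open>\<infinity> - \<infinity>\<close> does not occur.
\<close>

definition eintegral :: "'a measure \<Rightarrow> ('a \<Rightarrow> ereal) \<Rightarrow> ereal" where
  "eintegral M f =
     enn2ereal (\<integral>\<^sup>+ x. e2ennreal (f x) \<partial>M) - enn2ereal (\<integral>\<^sup>+ x. e2ennreal (- f x) \<partial>M)"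

definition lower_semicontinuous_on :: "'a::topological_space set \<Rightarrow> ('a \<Rightarrow> ereal) \<Rightarrow> bool" where
  "lower_semicontinuous_on S f \<longleftrightarrow>
     (\<forall>x\<in>S. \<forall>c. c < f x \<longrightarrow> eventually (\<lambda>y. c < f y) (at x within S))"

definition good_rate_function :: "'a::topological_space set \<Rightarrow> ('a \<Rightarrow> ereal) \<Rightarrow> bool" where
  "good_rate_function S f \<longleftrightarrow>
     (\<forall>x\<in>S. 0 \<le> f x) \<and> lower_semicontinuous_on S f \<and>
     (\<forall>K::real. compact {x\<in>S. f x \<le> ereal K})"

text \<open>
  \<open>P N\<close> is an arbitrary set function, since the one of interest is not additive; \<open>s\<close> is the scale.
  An infimum over the empty set is \<open>\<infinity>\<close> in \<^typ>\<open>ereal\<close>.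
\<close>

definition satisfies_LDP ::
    "'a::topological_space set \<Rightarrow> (nat \<Rightarrow> 'a set \<Rightarrow> real) \<Rightarrow> (nat \<Rightarrow> real) \<Rightarrow> ('a \<Rightarrow> ereal) \<Rightarrow> bool" where
  "satisfies_LDP S P s f \<longleftrightarrow>
     good_rate_function S f \<and>
     (\<forall>U. openin (top_of_set S) U \<longrightarrow>
        liminf (\<lambda>N. ereal (s N) * elog (P N U)) \<ge> - (INF x\<in>U. f x)) \<and>
     (\<forall>F. closedin (top_of_set S) F \<longrightarrow>
        limsup (\<lambda>N. ereal (s N) * elog (P N F)) \<le> - (INF x\<in>F. f x))"

text \<open>Configurations \<open>(x\<^sub>1, \<dots>, x\<^sub>n)\<close> are extensional functions on \<open>{1..n}\<close>.\<close>

abbreviation cube_measure :: "nat \<Rightarrow> (nat \<Rightarrow> real) measure" where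
  "cube_measure n \<equiv> (\<Pi>\<^sub>M i\<in>{1..n}. restrict_space lborel {0..1})"

definition jacobi_potential :: "nat \<Rightarrow> real \<Rightarrow> real \<Rightarrow> real \<Rightarrow> ereal" where
  "jacobi_potential n k l x =
     ereal (- (k / (2 * real n))) * elog x - ereal (l / (2 * real n)) * elog (1 - x)"

definition jacobi_weight :: "nat \<Rightarrow> real \<Rightarrow> real \<Rightarrow> (nat \<Rightarrow> real) \<Rightarrow> ennreal" where
  "jacobi_weight n k l x =
     eexp (ereal (- (2 * real n)) * (\<Sum>i\<in>{1..n}. jacobi_potential n k l (x i))
           + 2 * (\<Sum>j\<in>{1..n}. \<Sum>i\<in>{1..<j}. elog \<bar>x i - x j\<bar>))"

definition jacobi_Z :: "nat \<Rightarrow> real \<Rightarrow> real \<Rightarrow> ennreal" where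
  "jacobi_Z n k l = (\<integral>\<^sup>+ x. jacobi_weight n k l x \<partial>cube_measure n)"

definition jacobi_ensemble :: "nat \<Rightarrow> real \<Rightarrow> real \<Rightarrow> (nat \<Rightarrow> real) measure" where
  "jacobi_ensemble n k l =
     density (cube_measure n) (\<lambda>x. jacobi_weight n k l x / jacobi_Z n k l)"

definition jacobi_hit :: "nat \<Rightarrow> real \<Rightarrow> real \<Rightarrow> real set \<Rightarrow> real" where
  "jacobi_hit n k l X =
     measure (jacobi_ensemble n k l)
       {x \<in> space (jacobi_ensemble n k l). x ` {1..n} \<inter> X \<noteq> {}}"

definition jacobi_scaling ::
    "(nat \<Rightarrow> nat) \<Rightarrow> (nat \<Rightarrow> real) \<Rightarrow> (nat \<Rightarrow> real) \<Rightarrow> real \<Rightarrow> real \<Rightarrow> real \<Rightarrow> bool" where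
  "jacobi_scaling n k l \<rho> \<kappa> lam \<longleftrightarrow>
     0 < \<rho> \<and> 0 \<le> \<kappa> \<and> 0 \<le> lam \<and>
     (\<forall>N\<ge>1. 1 \<le> n N \<and> 0 \<le> k N \<and> 0 \<le> l N) \<and>
     (\<lambda>N. real (n N) / real N) \<longlonglongrightarrow> \<rho> \<and>
     (\<lambda>N. k N / real N) \<longlonglongrightarrow> \<kappa> \<and>
     (\<lambda>N. l N / real N) \<longlonglongrightarrow> lam"

text \<open>
  The number \<open>B(a,b)\<close> such that \<open>N\<^sup>-\<^sup>2 log Z(N)\<close> tends to \<open>\<rho>\<^sup>2 B(\<kappa>/\<rho>, \<lambda>/\<rho>)\<close> along every admissible
  sequence of parameters; it exists, for \<open>a, b \<ge> 0\<close>, by a theorem of Hiai and Petz.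
\<close>

definition jacobi_B :: "real \<Rightarrow> real \<Rightarrow> real" where
  "jacobi_B a b = (THE B. \<forall>n k l \<rho> \<kappa> lam.
     jacobi_scaling n k l \<rho> \<kappa> lam \<and> \<kappa> / \<rho> = a \<and> lam / \<rho> = b \<longrightarrow>
     (\<lambda>N. ln (enn2real (jacobi_Z (n N) (k N) (l N))) / (real N)\<^sup>2) \<longlonglongrightarrow> \<rho>\<^sup>2 * B)"

definition prob_measures_01 :: "real measure set" where
  "prob_measures_01 = {\<mu>. prob_space \<mu> \<and> sets \<mu> = sets (restrict_space borel {0..1})}"

definition jacobi_rate :: "real \<Rightarrow> real \<Rightarrow> real \<Rightarrow> real measure \<Rightarrow> ereal" where
  "jacobi_rate \<rho> \<kappa> lam \<mu> =
     - (ereal (\<rho>\<^sup>2) * eintegral (\<mu> \<Otimes>\<^sub>M \<mu>) (\<lambda>(x, y). elog \<bar>x - y\<bar>))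
     - ereal \<rho> * eintegral \<mu> (\<lambda>x. ereal \<kappa> * elog x + ereal lam * elog (1 - x))
     + ereal (\<rho>\<^sup>2 * jacobi_B (\<kappa> / \<rho>) (lam / \<rho>))"

text \<open>Existence and uniqueness of the minimizer are due to Hiai and Petz.\<close>

definition jacobi_mu0 :: "real \<Rightarrow> real \<Rightarrow> real \<Rightarrow> real measure" where
  "jacobi_mu0 \<rho> \<kappa> lam =
     (THE \<mu>. \<mu> \<in> prob_measures_01 \<and>
        (\<forall>\<nu>\<in>prob_measures_01. jacobi_rate \<rho> \<kappa> lam \<mu> \<le> jacobi_rate \<rho> \<kappa> lam \<nu>))"

definition limit_potential :: "real \<Rightarrow> real \<Rightarrow> real \<Rightarrow> real \<Rightarrow> ereal" where
  "limit_potential \<rho> \<kappa> lam x =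
     ereal (- (\<kappa> / (2 * \<rho>))) * elog x - ereal (lam / (2 * \<rho>)) * elog (1 - x)"

definition jacobi_D :: "real \<Rightarrow> real \<Rightarrow> real \<Rightarrow> ereal" where
  "jacobi_D \<rho> \<kappa> lam =
     - ereal (jacobi_B (\<kappa> / \<rho>) (lam / \<rho>))
     - eintegral (jacobi_mu0 \<rho> \<kappa> lam) (limit_potential \<rho> \<kappa> lam)"

definition V_eff :: "real \<Rightarrow> real \<Rightarrow> real \<Rightarrow> real \<Rightarrow> ereal" where
  "V_eff \<rho> \<kappa> lam x =
     limit_potential \<rho> \<kappa> lam x
     - eintegral (jacobi_mu0 \<rho> \<kappa> lam) (\<lambda>y. elog \<bar>x - y\<bar>)
     - jacobi_D \<rho> \<kappa> lam"

end

theory Submission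
  imports Defs
begin

text \<open>
  Write \<open>L x = - ln \<bar>x\<bar>\<close>, \<open>a = \<kappa> / \<rho>\<close>, \<open>b = lam / \<rho>\<close>, and let \<open>J \<mu>\<close> be the weighted energy
  \<open>\<integral>\<integral> L (x - y) d\<mu> d\<mu> + \<integral> (a L x + b L (1 - x)) d\<mu>\<close>.  Weak compactness gives a minimizer \<open>\<mu>\<^sub>0\<close>, and
  varying it towards uniform measures on short intervals gives the Euler--Lagrange inequality at every
  point.  Truncations of \<open>L\<close> from below are positive definite up to a constant, because they are
  mixtures of Poisson kernels; hence the truncated energy of any \<open>\<nu>\<close> exceeds \<open>J \<mu>\<^sub>0\<close>, up to a small
  error, by the squared distance of \<open>\<nu>\<close> and \<open>\<mu>\<^sub>0\<close> in the corresponding Hilbert norm.  This yields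
  uniqueness, and, since \<open>log Z = - n\<^sup>2 J \<mu>\<^sub>0 + o(n\<^sup>2)\<close> by Jensen's inequality, concentration of the
  empirical measure faster than any exponential in \<open>n\<close>.

  The intensity of a particle at \<open>x\<close> is the expectation of
  \<open>x\<^sup>k (1 - x)\<^sup>l \<Prod>\<^sub>j (x - x\<^sub>j)\<^sup>2\<close> under the ensemble with one particle less, divided by its
  integral over \<open>[0,1]\<close>.  By the concentration estimate this expectation is \<open>exp (- n U x)\<close> up to
  subexponential factors, with \<open>U\<close> twice the total potential of \<open>\<mu>\<^sub>0\<close>; the normalization contributes
  \<open>exp (- n min U)\<close>.  No asymptotics for ratios of partition functions are needed.
\<close>

section \<open>The logarithmic kernel and its truncations\<close>

text \<open>Energy estimates determine log Z only up to o(n^2), whereas the principle is at scale n.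
  They are therefore used only to discard configurations whose empirical measure is far from the
  equilibrium measure: these cost exp(- \<eta> n^2), which beats every exp(- C n). On the remaining
  ones the factor contributed by one more particle is controlled with precision o(n). The singular
  kernel is not weakly continuous. Its truncation is, and lies below it on [-1,1], so truncating
  yields upper bounds on weights. Lower bounds must face the full kernel: Jensen's inequality is
  applied there under laws of bounded density, for which the truncation error of the potential is
  uniformly small. The spectral formula represents \<open>cut_ker d x - ln d\<close>. The constant
  cancels on differences of probability measures, whose truncated energy is thus exactly an integral
  of squares. \<open>jacobi_B\<close> and \<open>jacobi_mu0\<close> are definite descriptions, so
  the limit of log Z, its independence of the sequence and the uniqueness of the minimizer must be
  established before \<open>V_eff\<close> can be evaluated at all.\<close>

definition log_ker :: "real \<Rightarrow> ennreal" where
  "log_ker x = (if x = 0 then \<infinity> else ennreal (- ln \<bar>x\<bar>))"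

text \<open>
  \<open>cut_ker d x = ln d + \<integral> s / (s\<^sup>2 + x\<^sup>2) ds\<close> over \<open>d \<le> s \<le> 1 / d\<close>: a mixture of Poisson kernels up to a
  constant.  On \<open>[-1,1]\<close> it is nonnegative and increases to \<open>log_ker\<close> as \<open>d\<close> decreases to \<open>0\<close>.
\<close>

definition cut_ker :: "real \<Rightarrow> real \<Rightarrow> real" where
  "cut_ker d x = ln ((1 + d\<^sup>2 * x\<^sup>2) / (x\<^sup>2 + d\<^sup>2)) / 2"

lemma log_ker_measurable [measurable]: "log_ker \<in> borel_measurable borel"
  unfolding log_ker_def[abs_def] by measurable

lemma log_ker_minus [simp]: "log_ker (- x) = log_ker x"
  by (simp add: log_ker_def)

lemma log_ker_antimono: "\<bar>x\<bar> \<le> \<bar>y\<bar> \<Longrightarrow> log_ker y \<le> log_ker x"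
  by (auto simp: log_ker_def intro!: ennreal_leI)

lemma ennreal_add_le: "ennreal (x + y) \<le> ennreal x + ennreal y"
proof -
  have "ennreal (x + y) \<le> ennreal (max 0 x + max 0 y)" by (intro ennreal_leI) auto
  also have "\<dots> = ennreal x + ennreal y"
    by (subst ennreal_plus) (auto simp: max_def ennreal_neg)
  finally show ?thesis .
qed

text \<open>\<open>log_ker\<close> is the positive part of \<open>- ln \<bar>x\<bar>\<close>, and
  the positive part of a sum is at most the sum of the positive parts. This is what makes scaling
  arguments possible below.\<close>

lemma log_ker_mult: "log_ker (x * y) \<le> log_ker x + log_ker y"
proof (cases "x = 0 \<or> y = 0")
  case False
  have "ennreal (- ln \<bar>x * y\<bar>) = ennreal (- ln \<bar>x\<bar> + - ln \<bar>y\<bar>)"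
    using False by (simp add: abs_mult ln_mult)
  also have "\<dots> \<le> ennreal (- ln \<bar>x\<bar>) + ennreal (- ln \<bar>y\<bar>)"
    by (rule ennreal_add_le)
  finally show ?thesis using False by (simp add: log_ker_def)
qed (auto simp: log_ker_def)

lemma log_ker_continuous:
  assumes "x \<noteq> 0" shows "isCont log_ker x"
proof -
  have "((\<lambda>y. ennreal (- ln \<bar>y\<bar>)) \<longlongrightarrow> ennreal (- ln \<bar>x\<bar>)) (at x)"
    using assms by (intro tendsto_intros tendsto_ennrealI) auto
  moreover have "eventually (\<lambda>y. ennreal (- ln \<bar>y\<bar>) = log_ker y) (at x)"
    using assms t1_space_nhds[of x 0] unfolding eventually_at_filter
    by (auto simp: log_ker_def elim!: eventually_mono)
  ultimately show ?thesis
    unfolding isCont_def using assms by (auto simp: log_ker_def intro: Lim_transform_eventually)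
qed

context
  fixes d :: real assumes d: "0 < d" "d < 1"
begin

lemma cut_ker_args: "1 + d\<^sup>2 * x\<^sup>2 > 0" "x\<^sup>2 + d\<^sup>2 > 0"
  using d by (intro add_pos_nonneg add_nonneg_pos mult_nonneg_nonneg; simp)+

lemma d2: "0 < d\<^sup>2" "d\<^sup>2 < 1"
  using d by (auto simp: power_less_one_iff)

lemma cut_ker_nonneg: assumes "\<bar>x\<bar> \<le> 1" shows "0 \<le> cut_ker d x"
proof -
  have "x\<^sup>2 \<le> 1" using assms by (simp add: abs_square_le_1)
  \<comment> \<open>This product is the numerator minus the denominator of the fraction inside
    \<open>cut_ker\<close>.\<close>
  then have "0 \<le> (1 - d\<^sup>2) * (1 - x\<^sup>2)" using d2 by (intro mult_nonneg_nonneg) auto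
  then show ?thesis unfolding cut_ker_def using cut_ker_args[of x] by (simp add: field_simps)
qed

lemma cut_ker_le: "cut_ker d x \<le> - ln d"
proof -
  have "d\<^sup>2 * d\<^sup>2 * x\<^sup>2 \<le> 1 * 1 * x\<^sup>2" using d2 by (intro mult_mono) auto
  then have "(1 + d\<^sup>2 * x\<^sup>2) / (x\<^sup>2 + d\<^sup>2) \<le> 1 / d\<^sup>2"
    using cut_ker_args[of x] d2 by (simp add: field_simps)
  then have "ln ((1 + d\<^sup>2 * x\<^sup>2) / (x\<^sup>2 + d\<^sup>2)) \<le> ln (1 / d\<^sup>2)"
    using cut_ker_args[of x] d2 by (intro ln_mono) (auto intro!: divide_pos_pos)
  then show ?thesis using d by (simp add: cut_ker_def ln_div ln_realpow)
qed

lemma cut_ker_ge: "ln d \<le> cut_ker d x"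
proof -
  have "d\<^sup>2 * d\<^sup>2 \<le> 1 * 1" using d2 by (intro mult_mono) auto
  then have "d\<^sup>2 \<le> (1 + d\<^sup>2 * x\<^sup>2) / (x\<^sup>2 + d\<^sup>2)"
    using cut_ker_args[of x] by (simp add: field_simps)
  then have "ln (d\<^sup>2) \<le> ln ((1 + d\<^sup>2 * x\<^sup>2) / (x\<^sup>2 + d\<^sup>2))"
    using d2 by (intro ln_mono) auto
  then show ?thesis using d by (simp add: cut_ker_def ln_realpow)
qed

lemma cut_ker_abs_le: "\<bar>cut_ker d x\<bar> \<le> - ln d"
  using cut_ker_le[of x] cut_ker_ge[of x] by linarith

lemma cut_ker_0: "cut_ker d 0 = - ln d"
  using d by (simp add: cut_ker_def ln_div ln_realpow)

lemma cut_ker_le_ln: assumes "\<bar>x\<bar> \<le> 1" "x \<noteq> 0" shows "cut_ker d x \<le> - ln \<bar>x\<bar>"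
proof -
  have x2: "x\<^sup>2 \<le> 1" "x\<^sup>2 > 0" using assms by (auto simp: abs_square_le_1)
  have "x\<^sup>2 * x\<^sup>2 * d\<^sup>2 \<le> 1 * 1 * d\<^sup>2" using x2 by (intro mult_mono) auto
  then have "(1 + d\<^sup>2 * x\<^sup>2) / (x\<^sup>2 + d\<^sup>2) \<le> 1 / \<bar>x\<bar>\<^sup>2"
    using cut_ker_args[of x] x2 by (simp add: field_simps)
  then have "ln ((1 + d\<^sup>2 * x\<^sup>2) / (x\<^sup>2 + d\<^sup>2)) \<le> ln (1 / \<bar>x\<bar>\<^sup>2)"
    using cut_ker_args[of x] x2 assms by (intro ln_mono) (auto intro!: divide_pos_pos)
  also have "\<dots> = - 2 * ln \<bar>x\<bar>"
    using assms ln_realpow[of "\<bar>x\<bar>" 2] by (subst ln_div) (simp_all del: ln_realpow)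
  finally show ?thesis by (simp add: cut_ker_def)
qed

lemma cut_ker_le_log_ker: assumes "\<bar>x\<bar> \<le> 1" shows "ennreal (cut_ker d x) \<le> log_ker x"
  using cut_ker_le_ln[OF assms] by (auto simp: log_ker_def intro!: ennreal_leI)

lemma cut_ker_mono: assumes "\<bar>x\<bar> \<le> 1" "0 < e" "e \<le> d" shows "cut_ker d x \<le> cut_ker e x"
proof -
  have x2: "x\<^sup>2 * x\<^sup>2 \<le> 1" using assms mult_le_one[of "x\<^sup>2" "x\<^sup>2"] by (auto simp: abs_square_le_1)
  have ed: "e\<^sup>2 \<le> d\<^sup>2" "0 < e\<^sup>2" using assms by (auto intro!: power_mono)
  have p: "1 + e\<^sup>2 * x\<^sup>2 > 0" "x\<^sup>2 + e\<^sup>2 > 0" using ed by (intro add_pos_nonneg add_nonneg_pos mult_nonneg_nonneg; simp)+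
  \<comment> \<open>After cross-multiplication the two fractions to be compared differ by exactly
    this product.\<close>
  have "0 \<le> (d\<^sup>2 - e\<^sup>2) * (1 - x\<^sup>2 * x\<^sup>2)" using x2 ed by (intro mult_nonneg_nonneg) auto
  then have "(1 + d\<^sup>2 * x\<^sup>2) * (x\<^sup>2 + e\<^sup>2) \<le> (1 + e\<^sup>2 * x\<^sup>2) * (x\<^sup>2 + d\<^sup>2)"
    by (simp add: algebra_simps)
  then have "(1 + d\<^sup>2 * x\<^sup>2) / (x\<^sup>2 + d\<^sup>2) \<le> (1 + e\<^sup>2 * x\<^sup>2) / (x\<^sup>2 + e\<^sup>2)"
    using p cut_ker_args[of x] by (simp add: frac_le_eq field_simps)
  then show ?thesis unfolding cut_ker_def
    using p cut_ker_args[of x] by (auto intro!: ln_mono divide_pos_pos)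
qed

lemma cut_ker_continuous_on: "continuous_on A (cut_ker d)"
  unfolding cut_ker_def[abs_def] using cut_ker_args by (intro continuous_intros) (auto simp: less_imp_neq[THEN not_sym] intro: divide_pos_pos)

end

lemma cut_ker_measurable [measurable]: "cut_ker d \<in> borel_measurable borel"
  unfolding cut_ker_def[abs_def] by measurable

lemma cut_ker_minus [simp]: "cut_ker d (- x) = cut_ker d x"
  by (simp add: cut_ker_def)

lemma cut_ker_commute: "cut_ker d (x - y) = cut_ker d (y - x)"
  by (metis cut_ker_minus minus_diff_eq)

lemma log_ker_commute: "log_ker (x - y) = log_ker (y - x)"
  by (metis log_ker_minus minus_diff_eq)

text \<open>The sequence starts at 1/2: as a truncation level it must stay below 1, and as a
  smearing scale or segment length it must not exceed 1/2.\<close>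

definition cut_seq :: "nat \<Rightarrow> real" where "cut_seq j = 1 / (real j + 2)"

lemma cut_seq: "0 < cut_seq j" "cut_seq j < 1" by (auto simp: cut_seq_def)

lemma cut_seq_antimono: "i \<le> j \<Longrightarrow> cut_seq j \<le> cut_seq i" by (auto simp: cut_seq_def field_simps)

lemma cut_seq_lim: "cut_seq \<longlonglongrightarrow> 0"
  unfolding cut_seq_def[abs_def] by real_asymp

lemma incseq_cut_ker: "\<bar>x\<bar> \<le> 1 \<Longrightarrow> incseq (\<lambda>j. cut_ker (cut_seq j) x)"
  unfolding incseq_def by (intro allI impI cut_ker_mono cut_seq cut_seq_antimono) auto

lemma SUP_cut_ker: assumes "\<bar>x\<bar> \<le> 1" shows "(SUP j. ennreal (cut_ker (cut_seq j) x)) = log_ker x"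
proof (rule LIMSEQ_unique)
  show "(\<lambda>j. ennreal (cut_ker (cut_seq j) x)) \<longlonglongrightarrow> (SUP j. ennreal (cut_ker (cut_seq j) x))"
    using incseq_cut_ker[OF assms] by (intro LIMSEQ_SUP) (auto simp: incseq_def intro!: ennreal_leI)
  show "(\<lambda>j. ennreal (cut_ker (cut_seq j) x)) \<longlonglongrightarrow> log_ker x"
  proof (cases "x = 0")
    case False
    have "(\<lambda>j. cut_ker (cut_seq j) x) \<longlonglongrightarrow> ln ((1 + 0\<^sup>2 * x\<^sup>2) / (x\<^sup>2 + 0\<^sup>2)) / 2"
      unfolding cut_ker_def using False by (intro tendsto_intros cut_seq_lim) auto
    also have "ln ((1 + 0\<^sup>2 * x\<^sup>2) / (x\<^sup>2 + 0\<^sup>2)) / 2 = - ln \<bar>x\<bar>"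
    proof -
      have "ln (x\<^sup>2) = 2 * ln \<bar>x\<bar>" using False by (metis ln_realpow of_nat_numeral power2_abs zero_less_abs_iff)
      then show ?thesis using False by (simp add: ln_div)
    qed
    finally show ?thesis using False by (simp add: log_ker_def tendsto_ennrealI)
  next
    case True
    have "filterlim (\<lambda>j. cut_ker (cut_seq j) x) at_top sequentially"
    proof -
      have "filterlim (\<lambda>j. ln (real j + 2)) at_top sequentially" by real_asymp
      moreover have "cut_ker (cut_seq j) x = ln (real j + 2)" for j
        using True cut_ker_0[OF cut_seq] by (simp add: cut_seq_def ln_div)
      ultimately show ?thesis by simp
    qed
    then show ?thesis using True by (simp add: log_ker_def ennreal_tendsto_top_eq_at_top)
  qed
qed

section \<open>Measures on the unit interval and their potentials\<close>

lemma nn_integral_log_ker_Icc: "(\<integral>\<^sup>+x. log_ker x * indicator {0..1} x \<partial>lborel) = 1"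
proof -
  let ?f = "\<lambda>x::real. - ln x"
  let ?F = "\<lambda>x::real. x - x * ln x"
  \<comment> \<open>Only the left end needs care: the value \<open>0 * ln 0 = 0\<close> is the limit
    of \<open>x * ln x\<close>, so that a derivative in the open interval suffices.\<close>
  have "continuous_on {0..1} ?F"
  proof (rule continuous_on_diff[OF continuous_on_id], subst continuous_on_eq_continuous_within, intro ballI)
    fix x :: real assume x: "x \<in> {0..1}"
    show "continuous (at x within {0..1}) (\<lambda>x. x * ln x)"
    proof (cases "x = 0")
      case True
      have "((\<lambda>x::real. x * ln x) \<longlongrightarrow> 0) (at_right 0)" by real_asymp
      moreover have "at (0::real) within {0..1} \<le> at_right 0"
        unfolding at_within_def by (intro inf_mono) auto
      ultimately show ?thesis using True by (auto simp: continuous_within intro: tendsto_mono)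
    next
      case False
      then show ?thesis using x by (intro continuous_intros) auto
    qed
  qed
  moreover have "(?F has_vector_derivative ?f x) (at x)" if "x \<in> {0<..<1}" for x
    using that unfolding has_real_derivative_iff_has_vector_derivative[symmetric]
    by (auto intro!: derivative_eq_intros)
  ultimately have "(?f has_integral (?F 1 - ?F 0)) {0..1}"
    by (intro fundamental_theorem_of_calculus_interior) auto
  then have "((\<lambda>x. if x \<in> {0..1} then ?f x else 0) has_integral 1) UNIV"
    by (subst has_integral_restrict_UNIV) simp
  then have "(\<integral>\<^sup>+x. ennreal (if x \<in> {0..1} then ?f x else 0) \<partial>lborel) = ennreal 1"
  proof (intro nn_integral_has_integral_lborel)
    fix x :: real show "0 \<le> (if x \<in> {0..1} then ?f x else 0)"
      using ln_le_zero_iff[of x] by (cases "x = 0") auto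
  qed auto
  moreover have "(\<integral>\<^sup>+x. log_ker x * indicator {0..1} x \<partial>lborel)
      = (\<integral>\<^sup>+x. ennreal (if x \<in> {0..1} then ?f x else 0) \<partial>lborel)"
    by (rule nn_integral_cong_AE, rule AE_mp[OF AE_lborel_singleton[of 0]], rule AE_I2)
       (auto simp: log_ker_def indicator_def)
  ultimately show ?thesis by simp
qed

text \<open>\<open>log_ker\<close> vanishes outside [-1,1] because \<open>ennreal\<close> truncates
  negative values, so the integral over the line is twice the one over the unit interval. This 2
  enters the constants 4 and \<open>2 / \<bar>r\<bar>\<close> below.\<close>

lemma nn_integral_log_ker: "(\<integral>\<^sup>+x. log_ker x \<partial>lborel) = 2"
proof -
  let ?a = "\<lambda>x. log_ker x * indicator {0..1} x" and ?b = "\<lambda>x. log_ker x * indicator {0..1} (- x)"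
  have "(\<integral>\<^sup>+x. log_ker x \<partial>lborel) = (\<integral>\<^sup>+x. ?a x + ?b x \<partial>lborel)"
  proof (rule nn_integral_cong_AE, rule AE_mp[OF AE_lborel_singleton[of 0]], rule AE_I2, rule impI)
    fix x :: real assume "x \<noteq> 0"
    moreover have "log_ker x = 0" if "\<bar>x\<bar> > 1" using that by (auto simp: log_ker_def intro!: ennreal_neg)
    ultimately show "log_ker x = ?a x + ?b x"
      by (cases "\<bar>x\<bar> > 1") (auto simp: indicator_def)
  qed
  also have "\<dots> = (\<integral>\<^sup>+x. ?a x \<partial>lborel) + (\<integral>\<^sup>+x. ?b x \<partial>lborel)"
    by (intro nn_integral_add) auto
  also have "(\<integral>\<^sup>+x. ?b x \<partial>lborel) = (\<integral>\<^sup>+x. ?a x \<partial>lborel)"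
    by (subst nn_integral_real_affine[where c="-1" and t=0]) auto
  finally show ?thesis by (simp add: nn_integral_log_ker_Icc)
qed

section \<open>The uniform law on the unit interval and smearing of the logarithmic kernel\<close>

abbreviation unif01 :: "real measure" where "unif01 \<equiv> restrict_space lborel {0..1}"

lemma nn_integral_unif01:
  "(\<integral>\<^sup>+x. f x \<partial>unif01) = (\<integral>\<^sup>+x. f x * indicator {0..1} x \<partial>lborel)"
  by (subst nn_integral_restrict_space) auto

text \<open>The affine image of the uniform law has density at most \<open>1 / \<bar>r\<bar>\<close>
  with respect to Lebesgue measure; the inequality comes from extending the integration from [0,1]
  to the line.\<close>

lemma nn_integral_unif01_affine_le:
  assumes [measurable]: "f \<in> borel_measurable borel" and r: "r \<noteq> 0"
  shows "(\<integral>\<^sup>+u. f (z + r * u) \<partial>unif01) \<le> ennreal (1 / \<bar>r\<bar>) * (\<integral>\<^sup>+x. f x \<partial>lborel)"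
proof -
  have "(\<integral>\<^sup>+u. f (z + r * u) \<partial>unif01) \<le> (\<integral>\<^sup>+u. f (z + r * u) \<partial>lborel)"
    unfolding nn_integral_unif01 by (intro nn_integral_mono) (auto simp: indicator_def)
  also have "\<dots> = ennreal (1 / \<bar>r\<bar>) * (\<bar>r\<bar> * (\<integral>\<^sup>+u. f (z + r * u) \<partial>lborel))"
    using r by (simp add: mult.assoc[symmetric] ennreal_mult[symmetric])
  also have "ennreal \<bar>r\<bar> * (\<integral>\<^sup>+u. f (z + r * u) \<partial>lborel) = (\<integral>\<^sup>+x. f x \<partial>lborel)"
    by (subst nn_integral_real_affine[of f r z]) (use r in auto)
  finally show ?thesis .
qed

lemma emeasure_unif01_UNIV: "(\<integral>\<^sup>+u. c \<partial>unif01) = c"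
  unfolding nn_integral_unif01 by (simp add: nn_integral_cmult_indicator)

text \<open>If t \<ge> -1/2, the argument stays above 1/2 and the kernel below ln 2 < 1. Otherwise
  the smearing density is at most 2, and the kernel has total integral 2, whence 4.\<close>

lemma log_ker_smear_one: "(\<integral>\<^sup>+u. log_ker (1 + t * u) \<partial>unif01) \<le> 4"
proof (cases "t \<ge> - 1 / 2")
  case True
  have "(\<integral>\<^sup>+u. log_ker (1 + t * u) \<partial>unif01) \<le> (\<integral>\<^sup>+u. 1 \<partial>unif01)"
  proof (intro nn_integral_mono)
    fix u assume "u \<in> space unif01"
    then have u: "0 \<le> u" "u \<le> 1" by (auto simp: space_restrict_space)
    have "- 1 / 2 \<le> t * u"
    proof (cases "t \<ge> 0")
      case False
      then have "t * 1 \<le> t * u" using u by (intro mult_left_mono_neg) auto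
      then show ?thesis using True by simp
    next
      case True
      then have "0 \<le> t * u" using u by auto
      then show ?thesis by simp
    qed
    then have "log_ker (1 + t * u) \<le> log_ker (1/2)" by (intro log_ker_antimono) auto
    also have "\<dots> \<le> 1" using ln_2_less_1 by (auto simp: log_ker_def ln_div)
    finally show "log_ker (1 + t * u) \<le> 1" .
  qed
  also have "\<dots> = 1" by (rule emeasure_unif01_UNIV)
  also have "(1::ennreal) \<le> 4" by simp
  finally show ?thesis .
next
  case False
  then have "(\<integral>\<^sup>+u. log_ker (1 + t * u) \<partial>unif01) \<le> ennreal (1 / \<bar>t\<bar>) * (\<integral>\<^sup>+x. log_ker x \<partial>lborel)"
    by (intro nn_integral_unif01_affine_le) auto
  also have "\<dots> \<le> ennreal 2 * 2" unfolding nn_integral_log_ker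
  proof (intro mult_right_mono ennreal_leI)
    have "1 / \<bar>t\<bar> \<le> 1 / (1 / 2)" using False by (intro divide_left_mono) auto
    then show "1 / \<bar>t\<bar> \<le> 2" by simp
  qed simp
  also have "ennreal 2 * 2 = 4" by simp
  finally show ?thesis .
qed

text \<open>By scaling it suffices to treat \<open>z = 1\<close>, and there the smeared kernel is bounded.\<close>

lemma log_ker_smear: "(\<integral>\<^sup>+u. log_ker (z + r * u) \<partial>unif01) \<le> log_ker z + 4"
proof (cases "z = 0")
  case True then show ?thesis by (simp add: log_ker_def)
next
  case False
  have "(\<integral>\<^sup>+u. log_ker (z + r * u) \<partial>unif01) \<le> (\<integral>\<^sup>+u. log_ker z + log_ker (1 + r / z * u) \<partial>unif01)"
  proof (intro nn_integral_mono)
    fix u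
    have "z + r * u = z * (1 + r / z * u)" using False by (simp add: field_simps)
    then show "log_ker (z + r * u) \<le> log_ker z + log_ker (1 + r / z * u)" using log_ker_mult by metis
  qed
  also have "\<dots> = log_ker z + (\<integral>\<^sup>+u. log_ker (1 + r / z * u) \<partial>unif01)"
    by (subst nn_integral_add) (auto simp only: emeasure_unif01_UNIV intro!: measurable_restrict_space1, measurable)
  also have "\<dots> \<le> log_ker z + 4" by (intro add_mono log_ker_smear_one) auto
  finally show ?thesis .
qed

text \<open>Once \<bar>r j\<bar> < \<bar>z\<bar> / 2 the argument keeps the distance \<bar>z\<bar> /
  2 from the singularity, so a constant dominates. The index shift by k makes this hold along the
  whole sequence.\<close>

lemma log_ker_smear_lim:
  assumes "z \<noteq> 0" and r: "r \<longlonglongrightarrow> 0"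
  shows "(\<lambda>j. \<integral>\<^sup>+u. log_ker (z + r j * u) \<partial>unif01) \<longlonglongrightarrow> log_ker z"
proof -
  from r have "eventually (\<lambda>j. \<bar>r j\<bar> < \<bar>z\<bar> / 2) sequentially"
    using assms(1) by (intro order_tendstoD(2)[OF tendsto_rabs_zero]) auto
  then obtain k where k: "\<And>j. j \<ge> k \<Longrightarrow> \<bar>r j\<bar> < \<bar>z\<bar> / 2" by (auto simp: eventually_sequentially)
  have "(\<lambda>j. \<integral>\<^sup>+u. log_ker (z + r (j + k) * u) \<partial>unif01) \<longlonglongrightarrow> (\<integral>\<^sup>+u. log_ker z \<partial>unif01)"
  proof (rule nn_integral_dominated_convergence[where w="\<lambda>u. log_ker (z / 2)"])
    show "AE u in unif01. log_ker (z + r (j + k) * u) \<le> log_ker (z / 2)" for j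
    proof (intro AE_I2 log_ker_antimono)
      fix u assume "u \<in> space unif01"
      then have "\<bar>r (j+k) * u\<bar> \<le> \<bar>r (j+k)\<bar> * 1"
        unfolding abs_mult by (intro mult_left_mono) (auto simp: space_restrict_space)
      then show "\<bar>z / 2\<bar> \<le> \<bar>z + r (j + k) * u\<bar>" using k[of "j+k"] by (simp add: abs_if split: if_splits)
    qed
    show "AE u in unif01. (\<lambda>j. log_ker (z + r (j + k) * u)) \<longlonglongrightarrow> log_ker z"
    proof (intro AE_I2)
      fix u
      have "(\<lambda>j. z + r (j + k) * u) \<longlonglongrightarrow> z + 0 * u"
        by (intro tendsto_intros LIMSEQ_ignore_initial_segment r)
      then show "(\<lambda>j. log_ker (z + r (j + k) * u)) \<longlonglongrightarrow> log_ker z"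
        using isCont_tendsto_compose[OF log_ker_continuous[OF assms(1)]] by simp
    qed
    show "(\<integral>\<^sup>+u. log_ker (z / 2) \<partial>unif01) < \<infinity>" using assms by (simp only: emeasure_unif01_UNIV) (simp add: log_ker_def)
  qed (auto intro!: measurable_restrict_space1)
  then show ?thesis unfolding emeasure_unif01_UNIV by (rule LIMSEQ_offset)
qed

text \<open>The sigma-algebra is the trace on [0,1], so the space itself is [0,1] and bounds that
  are valid only there hold at every point of the space.\<close>

locale prob01 = prob_space \<mu> for \<mu> :: "real measure" +
  assumes sets_eq: "sets \<mu> = sets (restrict_space borel {0..1})"
begin

lemma space_eq [simp]: "space \<mu> = {0..1}"
  using sets_eq_imp_space_eq[OF sets_eq] by (simp add: space_restrict_space)

lemma id_measurable [measurable]: "(\<lambda>x. x) \<in> borel_measurable \<mu>"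
  unfolding measurable_cong_sets[OF sets_eq refl] by (rule measurable_restrict_space1) simp

lemma borel_measurable_mu: "f \<in> borel_measurable borel \<Longrightarrow> f \<in> borel_measurable \<mu>"
  using measurable_compose[OF id_measurable] by blast

lemma emeasure_01 [simp]: "emeasure \<mu> {0..1} = 1"
  using emeasure_space_1 by simp

lemma nn_const [simp]: "(\<integral>\<^sup>+x. c \<partial>\<mu>) = c"
  by simp

end

lemma prob01_iff: "prob01 \<mu> \<longleftrightarrow> \<mu> \<in> prob_measures_01"
  by (auto simp: prob01_def prob01_axioms_def prob_measures_01_def)

lemma prob01_unif01: "prob01 unif01"
proof -
  have "prob_space unif01"
    by (rule prob_spaceI) (simp add: space_restrict_space emeasure_restrict_space)
  moreover have "sets unif01 = sets (restrict_space borel {0..1})"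
    by (intro sets_restrict_space_cong) simp
  ultimately show ?thesis by (simp add: prob01_def prob01_axioms_def)
qed

lemma prob01_distr:
  assumes "prob_space M" "f \<in> borel_measurable M" "\<And>x. x \<in> space M \<Longrightarrow> f x \<in> {0..1}"
  shows "prob01 (distr M (restrict_space borel {0..1}) f)"
    and "f \<in> measurable M (restrict_space borel {0..1})"
proof -
  show m: "f \<in> measurable M (restrict_space borel {0..1})"
    using assms by (intro measurable_restrict_space2) auto
  show "prob01 (distr M (restrict_space borel {0..1}) f)"
    unfolding prob01_def prob01_axioms_def using prob_space.prob_space_distr[OF assms(1) m] by simp
qed

section \<open>Logarithmic potentials and mutual energies, full and truncated\<close>

definition cut_pot :: "real \<Rightarrow> real measure \<Rightarrow> real \<Rightarrow> real" where
  "cut_pot d \<mu> x = (\<integral>y. cut_ker d (x - y) \<partial>\<mu>)"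

definition cut_en :: "real \<Rightarrow> real measure \<Rightarrow> real measure \<Rightarrow> real" where
  "cut_en d \<mu> \<nu> = (\<integral>x. cut_pot d \<nu> x \<partial>\<mu>)"

definition log_pot :: "real measure \<Rightarrow> real \<Rightarrow> ennreal" where
  "log_pot \<mu> x = (\<integral>\<^sup>+y. log_ker (x - y) \<partial>\<mu>)"

definition log_en :: "real measure \<Rightarrow> real measure \<Rightarrow> ennreal" where
  "log_en \<mu> \<nu> = (\<integral>\<^sup>+x. log_pot \<nu> x \<partial>\<mu>)"

context prob01 begin

lemma integrable_cut_ker: "0 < d \<Longrightarrow> d < 1 \<Longrightarrow> integrable \<mu> (\<lambda>y. cut_ker d (x - y))"
  by (intro integrable_const_bound[where B="- ln d"]) (auto intro!: cut_ker_abs_le)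

lemma log_pot_measurable [measurable]: "log_pot \<mu> \<in> borel_measurable borel"
  unfolding log_pot_def[abs_def] by measurable

lemma cut_pot_measurable [measurable]: "cut_pot d \<mu> \<in> borel_measurable borel"
  unfolding cut_pot_def[abs_def] by measurable

lemma cut_pot_ennreal:
  assumes "0 < d" "d < 1" "x \<in> {0..1}"
  shows "ennreal (cut_pot d \<mu> x) = (\<integral>\<^sup>+y. ennreal (cut_ker d (x - y)) \<partial>\<mu>)"
  unfolding cut_pot_def using assms
  by (intro nn_integral_eq_integral[symmetric] integrable_cut_ker) (auto intro!: AE_I2 cut_ker_nonneg)

lemma cut_pot_abs_le:
  assumes "0 < d" "d < 1"
  shows "\<bar>cut_pot d \<mu> x\<bar> \<le> - ln d"
proof -
  have "norm (cut_pot d \<mu> x) \<le> (\<integral>y. - ln d \<partial>\<mu>)" unfolding cut_pot_def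
    using cut_ker_abs_le[OF assms] by (intro Bochner_Integration.integral_norm_bound_integral integrable_cut_ker assms) auto
  also have "\<dots> = - ln d" by (simp only: lebesgue_integral_const prob_space scaleR_one)
  finally show ?thesis by (simp only: real_norm_def)
qed

lemma cut_pot_nonneg:
  assumes "0 < d" "d < 1" "x \<in> {0..1}"
  shows "0 \<le> cut_pot d \<mu> x"
  unfolding cut_pot_def using assms by (intro integral_nonneg_AE AE_I2 cut_ker_nonneg) auto

lemma cut_pot_isCont:
  assumes "0 < d" "d < 1"
  shows "isCont (cut_pot d \<mu>) x"
  unfolding continuous_at_sequentially comp_def cut_pot_def
proof safe
  fix X assume X: "X \<longlonglongrightarrow> x"
  have c: "isCont (cut_ker d) z" for z using cut_ker_continuous_on[OF assms, of UNIV] by (simp add: continuous_on_eq_continuous_at)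
  show "(\<lambda>n. \<integral>y. cut_ker d (X n - y) \<partial>\<mu>) \<longlonglongrightarrow> (\<integral>y. cut_ker d (x - y) \<partial>\<mu>)"
    by (rule integral_dominated_convergence[where w="\<lambda>_. - ln d"])
       (auto intro!: isCont_tendsto_compose[OF c] tendsto_intros X cut_ker_abs_le assms)
qed

lemma SUP_cut_pot:
  assumes "x \<in> {0..1}"
  shows "(SUP j. ennreal (cut_pot (cut_seq j) \<mu> x)) = log_pot \<mu> x"
proof -
  have "(\<integral>\<^sup>+y. (SUP j. ennreal (cut_ker (cut_seq j) (x - y))) \<partial>\<mu>) = (SUP j. \<integral>\<^sup>+y. ennreal (cut_ker (cut_seq j) (x - y)) \<partial>\<mu>)"
    using assms by (intro nn_integral_monotone_convergence_SUP_AE AE_I2)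
      (auto intro!: ennreal_leI cut_ker_mono cut_seq cut_seq_antimono)
  moreover have "(\<integral>\<^sup>+y. (SUP j. ennreal (cut_ker (cut_seq j) (x - y))) \<partial>\<mu>) = log_pot \<mu> x"
    unfolding log_pot_def using assms by (intro nn_integral_cong SUP_cut_ker) auto
  ultimately show ?thesis using assms by (simp add: cut_pot_ennreal cut_seq)
qed

lemma cut_pot_mono:
  assumes "0 < e" "e \<le> d" "d < 1" "x \<in> {0..1}"
  shows "cut_pot d \<mu> x \<le> cut_pot e \<mu> x"
  unfolding cut_pot_def using assms by (intro integral_mono_AE integrable_cut_ker AE_I2 cut_ker_mono) auto

lemma cut_pot_le_log_pot:
  assumes "0 < d" "d < 1" "x \<in> {0..1}"
  shows "ennreal (cut_pot d \<mu> x) \<le> log_pot \<mu> x"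
  unfolding cut_pot_ennreal[OF assms] log_pot_def using assms by (intro nn_integral_mono cut_ker_le_log_ker) auto

lemma integrable_cut_pot: "prob01 \<nu> \<Longrightarrow> 0 < d \<Longrightarrow> d < 1 \<Longrightarrow> integrable \<mu> (cut_pot d \<nu>)"
  by (intro integrable_const_bound[where B="- ln d"])
     (auto intro!: prob01.cut_pot_abs_le borel_measurable_mu prob01.cut_pot_measurable)

lemma cut_en_ennreal:
  assumes "prob01 \<nu>" "0 < d" "d < 1"
  shows "ennreal (cut_en d \<mu> \<nu>) = (\<integral>\<^sup>+x. ennreal (cut_pot d \<nu> x) \<partial>\<mu>)"
  unfolding cut_en_def using assms
  by (intro nn_integral_eq_integral[symmetric] integrable_cut_pot) (auto intro!: AE_I2 prob01.cut_pot_nonneg)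

lemma SUP_cut_en:
  assumes "prob01 \<nu>"
  shows "(SUP j. ennreal (cut_en (cut_seq j) \<mu> \<nu>)) = log_en \<mu> \<nu>"
proof -
  interpret N: prob01 \<nu> by fact
  have "(\<integral>\<^sup>+y. (SUP j. ennreal (cut_pot (cut_seq j) \<nu> y)) \<partial>\<mu>) = (SUP j. \<integral>\<^sup>+y. ennreal (cut_pot (cut_seq j) \<nu> y) \<partial>\<mu>)"
    by (intro nn_integral_monotone_convergence_SUP_AE AE_I2)
      (auto intro!: ennreal_leI N.cut_pot_mono cut_seq cut_seq_antimono)
  moreover have "(\<integral>\<^sup>+y. (SUP j. ennreal (cut_pot (cut_seq j) \<nu> y)) \<partial>\<mu>) = log_en \<mu> \<nu>"
    unfolding log_en_def by (intro nn_integral_cong N.SUP_cut_pot) auto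
  ultimately show ?thesis by (simp add: cut_en_ennreal assms cut_seq)
qed

lemma cut_en_le_log_en:
  assumes "prob01 \<nu>" "0 < d" "d < 1"
  shows "ennreal (cut_en d \<mu> \<nu>) \<le> log_en \<mu> \<nu>"
  unfolding cut_en_ennreal[OF assms] log_en_def using assms by (intro nn_integral_mono prob01.cut_pot_le_log_pot) auto

lemma cut_en_mono:
  assumes "prob01 \<nu>" "0 < e" "e \<le> d" "d < 1"
  shows "cut_en d \<mu> \<nu> \<le> cut_en e \<mu> \<nu>"
  unfolding cut_en_def using assms by (intro integral_mono_AE integrable_cut_pot AE_I2 prob01.cut_pot_mono) auto

lemma log_en_commute:
  assumes "prob01 \<nu>"
  shows "log_en \<mu> \<nu> = log_en \<nu> \<mu>"
proof -
  interpret N: prob01 \<nu> by fact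
  interpret pair_sigma_finite \<mu> \<nu> ..
  show ?thesis unfolding log_en_def log_pot_def
    by (subst Fubini') (auto intro!: nn_integral_cong log_ker_commute)
qed

lemma cut_en_commute:
  assumes "prob01 \<nu>" "0 < d" "d < 1"
  shows "cut_en d \<mu> \<nu> = cut_en d \<nu> \<mu>"
proof -
  interpret N: prob01 \<nu> by fact
  interpret pair_sigma_finite \<nu> \<mu> ..
  interpret P: pair_prob_space \<nu> \<mu> ..
  have "(\<integral>x. (\<integral>y. cut_ker d (x - y) \<partial>\<nu>) \<partial>\<mu>) = (\<integral>y. (\<integral>x. cut_ker d (x - y) \<partial>\<mu>) \<partial>\<nu>)"
    by (intro Fubini_integral P.integrable_const_bound[where B="- ln d"]) (auto intro!: cut_ker_abs_le assms)
  also have "\<dots> = (\<integral>y. (\<integral>x. cut_ker d (y - x) \<partial>\<mu>) \<partial>\<nu>)"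
    by (intro Bochner_Integration.integral_cong refl cut_ker_commute)
  finally show ?thesis unfolding cut_en_def cut_pot_def .
qed

end

section \<open>Positive definiteness of the truncated kernel\<close>

text \<open>The spectral measure of the truncated kernel, from \<open>s / (s\<^sup>2 + x\<^sup>2) = \<integral> exp (- s t) cos (t x) dt\<close>.\<close>

definition spectral :: "real \<Rightarrow> real measure" where
  "spectral d = density lborel (\<lambda>t. indicator {0..} t *
     (\<integral>\<^sup>+s. ennreal (exp (- (s * t))) * indicator {d..1 / d} s \<partial>lborel))"

lemma sets_spectral [measurable_cong, simp]: "sets (spectral d) = sets borel"
  by (simp add: spectral_def)

lemma space_spectral [simp]: "space (spectral d) = UNIV"
  by (simp add: spectral_def)

lemma nn_integral_spectral:
  assumes [measurable]: "f \<in> borel_measurable borel"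
  shows "(\<integral>\<^sup>+t. f t \<partial>spectral d) =
    (\<integral>\<^sup>+t. indicator {0..} t * (\<integral>\<^sup>+s. ennreal (exp (- (s * t))) * indicator {d..1 / d} s \<partial>lborel) * f t \<partial>lborel)"
  unfolding spectral_def by (subst nn_integral_density) auto

text \<open>Adding 1 to the cosine makes the integrand nonnegative, so that integrals can later be
  exchanged without integrability conditions. The 1 contributes \<open>1 / s\<close>, the cosine the
  Poisson kernel.\<close>

lemma laplace_one_plus_cos:
  assumes s: "s > (0::real)"
  shows "(\<integral>\<^sup>+t. ennreal (exp (- (s * t)) * (1 + cos (t * x))) * indicator {0..} t \<partial>lborel)
    = ennreal (1 / s + s / (s\<^sup>2 + x\<^sup>2))"
proof -
  define q where "q = s\<^sup>2 + x\<^sup>2"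
  define g where "g t = x * sin (t * x) - s * cos (t * x)" for t
  define F where "F t = exp (- (s * t)) * (- 1 / s + g t / q)" for t
  have p: "q > 0" unfolding q_def using s by (intro add_pos_nonneg) auto
  have "(\<integral>\<^sup>+t. ennreal (exp (- (s * t)) * (1 + cos (t * x))) * indicator {0..} t \<partial>lborel) = 0 - F 0"
  proof (rule nn_integral_FTC_atLeast)
    show "(F has_real_derivative exp (- (s * t)) * (1 + cos (t * x))) (at t)" for t
    proof -
      have g: "(g has_real_derivative (x * x * cos (t * x) + s * x * sin (t * x))) (at t)"
        unfolding g_def by (auto intro!: derivative_eq_intros)
      have "(F has_real_derivative (exp (- (s * t)) * - s * (- 1 / s + g t / q)
          + exp (- (s * t)) * ((x * x * cos (t * x) + s * x * sin (t * x)) / q))) (at t)"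
        unfolding F_def using p by (auto intro!: derivative_eq_intros g)
      also have "exp (- (s * t)) * - s * (- 1 / s + g t / q)
          + exp (- (s * t)) * ((x * x * cos (t * x) + s * x * sin (t * x)) / q)
          = exp (- (s * t)) * (1 + (x * x * cos (t * x) + s * x * sin (t * x) - s * g t) / q)"
        using s by (simp add: algebra_simps diff_divide_distrib add_divide_distrib)
      also have "x * x * cos (t * x) + s * x * sin (t * x) - s * g t = cos (t * x) * q"
        by (simp add: g_def q_def power2_eq_square algebra_simps)
      finally show ?thesis using p by simp
    qed
    show "0 \<le> exp (- (s * t)) * (1 + cos (t * x))" for t
      using cos_ge_minus_one[of "t * x"] by (intro mult_nonneg_nonneg) (simp, linarith)
    show "(F \<longlongrightarrow> 0) at_top"
    proof (rule Lim_null_comparison)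
      show "\<forall>\<^sub>F t in at_top. norm (F t) \<le> (1 / s + (\<bar>x\<bar> + s) / q) * exp (- (s * t))"
      proof (intro always_eventually allI)
        fix t
        have "\<bar>g t\<bar> \<le> \<bar>x * sin (t * x)\<bar> + \<bar>s * cos (t * x)\<bar>" unfolding g_def by linarith
        also have "\<dots> \<le> \<bar>x\<bar> * 1 + \<bar>s\<bar> * 1"
          unfolding abs_mult by (intro add_mono mult_left_mono) auto
        finally have "\<bar>g t\<bar> / q \<le> (\<bar>x\<bar> + s) / q" using s p by (intro divide_right_mono) auto
        moreover have "\<bar>- 1 / s + g t / q\<bar> \<le> \<bar>- 1 / s\<bar> + \<bar>g t / q\<bar>" by (rule abs_triangle_ineq)
        ultimately have "\<bar>- 1 / s + g t / q\<bar> \<le> 1 / s + (\<bar>x\<bar> + s) / q" using s p by simp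
        then show "norm (F t) \<le> (1 / s + (\<bar>x\<bar> + s) / q) * exp (- (s * t))"
          unfolding F_def by (simp add: abs_mult mult.commute)
      qed
      have "((\<lambda>t. exp (- (s * t))) \<longlongrightarrow> 0) at_top" using s by real_asymp
      then show "((\<lambda>t. (1 / s + (\<bar>x\<bar> + s) / q) * exp (- (s * t))) \<longlongrightarrow> 0) at_top"
        by (rule tendsto_mult_right_zero)
    qed
  qed auto
  then show ?thesis using s by (simp add: F_def g_def q_def)
qed

context
  fixes d :: real assumes d: "0 < d" "d < 1"
begin

text \<open>Exchange of the t- and s-integrals leaves an elementary integral over [d, 1/d]. Of the -
  3 ln d, the summand 1 contributes - 2 ln d, the total mass of \<open>spectral d\<close>; the
  remaining - ln d is the constant by which \<open>cut_ker\<close> differs from a mixture of Poisson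
  kernels.\<close>

lemma nn_integral_spectral_one_plus_cos:
  "(\<integral>\<^sup>+t. ennreal (1 + cos (t * x)) \<partial>spectral d) = ennreal (cut_ker d x - 3 * ln d)"
proof -
  have dd: "d \<le> 1 / d" using d mult_le_one[of d d] by (simp add: field_simps)
  have c: "0 \<le> 1 + cos (t * x)" for t using cos_ge_minus_one[of "t * x"] by linarith
  have "(\<integral>\<^sup>+t. ennreal (1 + cos (t * x)) \<partial>spectral d)
    = (\<integral>\<^sup>+t. (\<integral>\<^sup>+s. ennreal (exp (- (s * t)) * (1 + cos (t * x))) * indicator {0..} t * indicator {d..1 / d} s \<partial>lborel) \<partial>lborel)"
    by (subst nn_integral_spectral)
       (auto intro!: nn_integral_cong simp: nn_integral_cmult[symmetric] nn_integral_multc[symmetric] ennreal_mult c mult_ac)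
  also have "\<dots> = (\<integral>\<^sup>+s. (\<integral>\<^sup>+t. ennreal (exp (- (s * t)) * (1 + cos (t * x))) * indicator {0..} t * indicator {d..1 / d} s \<partial>lborel) \<partial>lborel)"
    by (rule lborel_pair.Fubini') auto
  also have "\<dots> = (\<integral>\<^sup>+s. (\<integral>\<^sup>+t. ennreal (exp (- (s * t)) * (1 + cos (t * x))) * indicator {0..} t \<partial>lborel) * indicator {d..1 / d} s \<partial>lborel)"
    by (intro nn_integral_cong nn_integral_multc) auto
  also have "\<dots> = (\<integral>\<^sup>+s. ennreal (1 / s + s / (s\<^sup>2 + x\<^sup>2)) * indicator {d..1 / d} s \<partial>lborel)"
  proof (intro nn_integral_cong)
    fix s
    have "s > 0" if "s \<in> {d..1 / d}" using that d by auto
    then show "(\<integral>\<^sup>+t. ennreal (exp (- (s * t)) * (1 + cos (t * x))) * indicator {0..} t \<partial>lborel) * indicator {d..1 / d} s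
       = ennreal (1 / s + s / (s\<^sup>2 + x\<^sup>2)) * indicator {d..1 / d} s"
      by (cases "s \<in> {d..1 / d}") (simp_all only: laplace_one_plus_cos, simp)
  qed
  also have "\<dots> = ennreal ((ln (1 / d) + ln ((1 / d)\<^sup>2 + x\<^sup>2) / 2) - (ln d + ln (d\<^sup>2 + x\<^sup>2) / 2))"
  proof (rule nn_integral_FTC_Icc)
    fix s assume "s \<in> {d..1 / d}"
    then have s: "s > 0" using d by auto
    then have "s\<^sup>2 + x\<^sup>2 > 0" by (intro add_pos_nonneg) auto
    then have "((\<lambda>s. ln (s\<^sup>2 + x\<^sup>2)) has_real_derivative 2 * s / (s\<^sup>2 + x\<^sup>2)) (at s)"
      by (auto intro!: derivative_eq_intros)
    from DERIV_add[OF DERIV_ln_divide[OF s] DERIV_cdivide[OF this, of 2]]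
    have "((\<lambda>s. ln s + ln (s\<^sup>2 + x\<^sup>2) / 2) has_real_derivative 1 / s + 2 * s / (s\<^sup>2 + x\<^sup>2) / 2) (at s)" .
    moreover have "2 * s / q / 2 = s / q" for q by simp
    ultimately show "((\<lambda>s. ln s + ln (s\<^sup>2 + x\<^sup>2) / 2) has_real_derivative 1 / s + s / (s\<^sup>2 + x\<^sup>2)) (at s)"
      by (simp only:)
    show "0 \<le> 1 / s + s / (s\<^sup>2 + x\<^sup>2)" using s by auto
  qed (use dd in auto)
  also have "(ln (1 / d) + ln ((1 / d)\<^sup>2 + x\<^sup>2) / 2) - (ln d + ln (d\<^sup>2 + x\<^sup>2) / 2) = cut_ker d x - 3 * ln d"
  proof -
    have "(1 / d)\<^sup>2 + x\<^sup>2 = (1 + d\<^sup>2 * x\<^sup>2) / d\<^sup>2" using d by (simp add: field_simps)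
    then have "ln ((1 / d)\<^sup>2 + x\<^sup>2) = ln (1 + d\<^sup>2 * x\<^sup>2) - 2 * ln d"
      using cut_ker_args[OF d, of x] d by (simp add: ln_div ln_realpow)
    moreover have "ln (1 / d) = - ln d" using d by (simp add: ln_div)
    moreover have "ln ((1 + d\<^sup>2 * x\<^sup>2) / (x\<^sup>2 + d\<^sup>2)) = ln (1 + d\<^sup>2 * x\<^sup>2) - ln (d\<^sup>2 + x\<^sup>2)"
      using cut_ker_args[OF d, of x] by (simp add: ln_div add.commute)
    ultimately show ?thesis unfolding cut_ker_def by (simp only:) (simp add: field_simps)
  qed
  finally show ?thesis .
qed

lemma emeasure_spectral: "emeasure (spectral d) UNIV = ennreal (- 2 * ln d)"
proof -
  have "2 * emeasure (spectral d) UNIV = (\<integral>\<^sup>+t. ennreal (1 + cos (t * 0)) \<partial>spectral d)" by simp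
  also have "\<dots> = ennreal (2 * (- 2 * ln d))"
    unfolding nn_integral_spectral_one_plus_cos cut_ker_0[OF d] by simp
  also have "\<dots> = 2 * ennreal (- 2 * ln d)" by (subst ennreal_mult') auto
  finally show ?thesis by (simp add: ennreal_mult_cancel_left)
qed

lemma finite_measure_spectral: "finite_measure (spectral d)"
  by (rule finite_measureI) (simp add: emeasure_spectral)

lemma measure_spectral: "measure (spectral d) UNIV = - 2 * ln d"
  using emeasure_spectral d by (simp add: measure_def)

lemma integrable_spectral: "f \<in> borel_measurable borel \<Longrightarrow> (\<And>t. \<bar>f t\<bar> \<le> B) \<Longrightarrow> integrable (spectral d) (f :: real \<Rightarrow> real)"
  by (intro finite_measure.integrable_const_bound[OF finite_measure_spectral, where B=B]) (auto simp: measurable_cong_sets[OF sets_spectral refl])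

text \<open>The constant \<open>ln d\<close> is the whole defect of positive definiteness of
  \<open>cut_ker\<close>; it disappears when two probability measures are subtracted.\<close>

lemma integral_spectral_cos: "(\<integral>t. cos (t * x) \<partial>spectral d) = cut_ker d x - ln d"
proof -
  have c: "0 \<le> 1 + cos (t * x)" for t using cos_ge_minus_one[of "t * x"] by linarith
  have i: "integrable (spectral d) (\<lambda>t. cos (t * x))" by (intro integrable_spectral[where B=1]) auto
  have i1: "integrable (spectral d) (\<lambda>t. 1::real)" by (intro integrable_spectral[where B=1]) auto
  have "(\<integral>t. 1 + cos (t * x) \<partial>spectral d) = cut_ker d x - 3 * ln d"
    using c i nn_integral_spectral_one_plus_cos[of x] cut_ker_ge[OF d, of x] ln_less_zero[OF d]
    by (subst integral_eq_nn_integral) auto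
  then show ?thesis using i i1 by (subst (asm) Bochner_Integration.integral_add) (auto simp: measure_spectral)
qed

end

text \<open>Real and imaginary parts of the characteristic function, kept as real functions because
  only the sum of their squared differences is integrated against the spectral measure.\<close>

definition cos_tr :: "real measure \<Rightarrow> real \<Rightarrow> real" where "cos_tr \<mu> t = (\<integral>y. cos (t * y) \<partial>\<mu>)"
definition sin_tr :: "real measure \<Rightarrow> real \<Rightarrow> real" where "sin_tr \<mu> t = (\<integral>y. sin (t * y) \<partial>\<mu>)"

text \<open>The truncated quadratic form at the signed measure \<mu> - \<nu>, expanded so that only
  probability measures occur.\<close>

definition en_dist :: "real \<Rightarrow> real measure \<Rightarrow> real measure \<Rightarrow> real" where
  "en_dist d \<mu> \<nu> = cut_en d \<mu> \<mu> - 2 * cut_en d \<mu> \<nu> + cut_en d \<nu> \<nu>"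

context prob01 begin

lemma integrable_bdd: "f \<in> borel_measurable \<mu> \<Longrightarrow> (\<And>t. \<bar>f t\<bar> \<le> B) \<Longrightarrow> integrable \<mu> (f :: real \<Rightarrow> real)"
  by (intro integrable_const_bound[where B=B]) auto

lemma cos_tr_measurable [measurable]: "cos_tr \<mu> \<in> borel_measurable borel"
  unfolding cos_tr_def[abs_def] by measurable

lemma sin_tr_measurable [measurable]: "sin_tr \<mu> \<in> borel_measurable borel"
  unfolding sin_tr_def[abs_def] by measurable

lemma abs_integral_le_1:
  assumes "\<And>y. \<bar>f y\<bar> \<le> 1" "f \<in> borel_measurable \<mu>"
  shows "\<bar>\<integral>y. f y \<partial>\<mu>\<bar> \<le> (1::real)"
proof -
  have "norm (\<integral>y. f y \<partial>\<mu>) \<le> (\<integral>y. 1 \<partial>\<mu>)"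
    using assms by (intro Bochner_Integration.integral_norm_bound_integral integrable_bdd) auto
  also have "(\<integral>y. 1 \<partial>\<mu>) = (1::real)" by (simp only: lebesgue_integral_const prob_space scaleR_one)
  finally show ?thesis by (simp only: real_norm_def)
qed

lemma cos_tr_le: "\<bar>cos_tr \<mu> t\<bar> \<le> 1" unfolding cos_tr_def by (intro abs_integral_le_1) auto
lemma sin_tr_le: "\<bar>sin_tr \<mu> t\<bar> \<le> 1" unfolding sin_tr_def by (intro abs_integral_le_1) auto

lemma cos_tr_sin_tr_shift: "(\<integral>y. cos (t * (x - y)) \<partial>\<mu>) = cos (t * x) * cos_tr \<mu> t + sin (t * x) * sin_tr \<mu> t"
proof -
  have "(\<integral>y. cos (t * (x - y)) \<partial>\<mu>) = (\<integral>y. cos (t * x) * cos (t * y) + sin (t * x) * sin (t * y) \<partial>\<mu>)"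
    by (intro Bochner_Integration.integral_cong refl) (simp add: right_diff_distrib cos_diff)
  also have "\<dots> = cos (t * x) * cos_tr \<mu> t + sin (t * x) * sin_tr \<mu> t"
    unfolding cos_tr_def sin_tr_def
    by (subst Bochner_Integration.integral_add) (auto intro!: integrable_bdd[where B=1] integrable_mult_right)
  finally show ?thesis .
qed

text \<open>Fubini carries the spectral formula from the kernel to the potential. A point mass at x
  has the transforms \<open>cos (t * x)\<close> and \<open>sin (t * x)\<close>, so the left side is
  its spectral inner product with \<mu>.\<close>

lemma fm_cut_pot:
  assumes d: "0 < d" "d < 1"
  shows "(\<integral>t. cos (t * x) * cos_tr \<mu> t + sin (t * x) * sin_tr \<mu> t \<partial>spectral d) = cut_pot d \<mu> x - ln d"
proof -
  interpret F: finite_measure "spectral d" by (rule finite_measure_spectral[OF d])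
  interpret P: pair_sigma_finite \<mu> "spectral d" ..
  interpret Q: finite_measure "\<mu> \<Otimes>\<^sub>M spectral d" by (rule finite_measure_pair_measure) unfold_locales
  have "(\<integral>t. cos (t * x) * cos_tr \<mu> t + sin (t * x) * sin_tr \<mu> t \<partial>spectral d) = (\<integral>t. (\<integral>y. cos (t * (x - y)) \<partial>\<mu>) \<partial>spectral d)"
    by (simp add: cos_tr_sin_tr_shift)
  also have "\<dots> = (\<integral>y. (\<integral>t. cos (t * (x - y)) \<partial>spectral d) \<partial>\<mu>)"
    by (rule P.Fubini_integral, rule Q.integrable_const_bound[where B=1]) auto
  also have "\<dots> = (\<integral>y. cut_ker d (x - y) - ln d \<partial>\<mu>)" by (simp only: integral_spectral_cos[OF d])
  also have "\<dots> = cut_pot d \<mu> x - ln d"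
    unfolding cut_pot_def using integrable_cut_ker[OF d] prob_space by (subst Bochner_Integration.integral_diff) auto
  finally show ?thesis .
qed

lemma fm_cut_en:
  assumes "prob01 \<nu>" and d: "0 < d" "d < 1"
  shows "(\<integral>t. cos_tr \<nu> t * cos_tr \<mu> t + sin_tr \<nu> t * sin_tr \<mu> t \<partial>spectral d) = cut_en d \<nu> \<mu> - ln d"
proof -
  interpret N: prob01 \<nu> by fact
  interpret F: finite_measure "spectral d" by (rule finite_measure_spectral[OF d])
  interpret P: pair_sigma_finite \<nu> "spectral d" ..
  interpret Q: finite_measure "\<nu> \<Otimes>\<^sub>M spectral d" by (rule finite_measure_pair_measure) unfold_locales
  have "(\<integral>t. cos_tr \<nu> t * cos_tr \<mu> t + sin_tr \<nu> t * sin_tr \<mu> t \<partial>spectral d)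
    = (\<integral>t. (\<integral>x. cos (t * x) * cos_tr \<mu> t + sin (t * x) * sin_tr \<mu> t \<partial>\<nu>) \<partial>spectral d)"
  proof (intro Bochner_Integration.integral_cong refl)
    fix t
    show "cos_tr \<nu> t * cos_tr \<mu> t + sin_tr \<nu> t * sin_tr \<mu> t = (\<integral>x. cos (t * x) * cos_tr \<mu> t + sin (t * x) * sin_tr \<mu> t \<partial>\<nu>)"
      by (subst Bochner_Integration.integral_add)
         (auto intro!: N.integrable_bdd[where B=1] integrable_mult_left simp: cos_tr_def sin_tr_def)
  qed
  also have "\<dots> = (\<integral>x. (\<integral>t. cos (t * x) * cos_tr \<mu> t + sin (t * x) * sin_tr \<mu> t \<partial>spectral d) \<partial>\<nu>)"
  proof (rule P.Fubini_integral, rule Q.integrable_const_bound[where B=2])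
    show "AE p in \<nu> \<Otimes>\<^sub>M spectral d. norm (case p of (x, t) \<Rightarrow> cos (t * x) * cos_tr \<mu> t + sin (t * x) * sin_tr \<mu> t) \<le> 2"
    proof (intro AE_I2, clarify)
      fix x t
      have "\<bar>cos (t * x) * cos_tr \<mu> t + sin (t * x) * sin_tr \<mu> t\<bar> \<le> \<bar>cos (t * x)\<bar> * \<bar>cos_tr \<mu> t\<bar> + \<bar>sin (t * x)\<bar> * \<bar>sin_tr \<mu> t\<bar>"
        unfolding abs_mult[symmetric] by linarith
      also have "\<dots> \<le> 1 * 1 + 1 * 1" by (intro add_mono mult_mono cos_tr_le sin_tr_le) auto
      finally show "norm (cos (t * x) * cos_tr \<mu> t + sin (t * x) * sin_tr \<mu> t) \<le> 2" by simp
    qed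
  qed auto
  also have "\<dots> = (\<integral>x. cut_pot d \<mu> x - ln d \<partial>\<nu>)" by (simp only: fm_cut_pot[OF d])
  also have "\<dots> = cut_en d \<nu> \<mu> - ln d"
    unfolding cut_en_def using N.integrable_cut_pot[OF prob01_axioms d] N.prob_space by (subst Bochner_Integration.integral_diff) auto
  finally show ?thesis .
qed

end

lemma abs_mult_le_1: "\<bar>a\<bar> \<le> 1 \<Longrightarrow> \<bar>b\<bar> \<le> 1 \<Longrightarrow> \<bar>a * b\<bar> \<le> (1::real)"
  unfolding abs_mult by (rule mult_le_one) auto

context
  fixes d :: real and \<mu> \<nu> :: "real measure"
  assumes d: "0 < d" "d < 1" and M: "prob01 \<mu>" and N: "prob01 \<nu>"
begin

interpretation M: prob01 \<mu> by (rule M)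
interpretation N: prob01 \<nu> by (rule N)

lemma integrable_CfSf:
  "integrable (spectral d) (\<lambda>t. cos_tr \<mu> t * cos_tr \<nu> t)" "integrable (spectral d) (\<lambda>t. sin_tr \<mu> t * sin_tr \<nu> t)"
  "integrable (spectral d) (\<lambda>t. cos (t * x) * cos_tr \<mu> t)" "integrable (spectral d) (\<lambda>t. sin (t * x) * sin_tr \<mu> t)"
  by (auto intro!: integrable_spectral[OF d, where B=1] abs_mult_le_1 M.cos_tr_le M.sin_tr_le N.cos_tr_le N.sin_tr_le simp del: abs_mult)

end

text \<open>The constant - ln d enters the three mutual energies with weights 1, -2 and 1 and
  cancels, leaving a sum of squares.\<close>

lemma
  assumes d: "0 < d" "d < 1" and M: "prob01 \<mu>" and N: "prob01 \<nu>"
  shows en_dist_eq: "en_dist d \<mu> \<nu> = (\<integral>t. (cos_tr \<mu> t - cos_tr \<nu> t)\<^sup>2 + (sin_tr \<mu> t - sin_tr \<nu> t)\<^sup>2 \<partial>spectral d)"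
    and integrable_en_dist: "integrable (spectral d) (\<lambda>t. (cos_tr \<mu> t - cos_tr \<nu> t)\<^sup>2 + (sin_tr \<mu> t - sin_tr \<nu> t)\<^sup>2)"
proof -
  note I = integrable_CfSf(1,2)[OF d M M] integrable_CfSf(1,2)[OF d M N] integrable_CfSf(1,2)[OF d N N]
  define a where "a t = cos_tr \<mu> t * cos_tr \<mu> t + sin_tr \<mu> t * sin_tr \<mu> t" for t
  define b where "b t = cos_tr \<mu> t * cos_tr \<nu> t + sin_tr \<mu> t * sin_tr \<nu> t" for t
  define c where "c t = cos_tr \<nu> t * cos_tr \<nu> t + sin_tr \<nu> t * sin_tr \<nu> t" for t
  have i: "integrable (spectral d) a" "integrable (spectral d) b" "integrable (spectral d) c"
    unfolding a_def b_def c_def by (intro Bochner_Integration.integrable_add I)+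
  have v: "(\<integral>t. a t \<partial>spectral d) = cut_en d \<mu> \<mu> - ln d" "(\<integral>t. b t \<partial>spectral d) = cut_en d \<mu> \<nu> - ln d"
    "(\<integral>t. c t \<partial>spectral d) = cut_en d \<nu> \<nu> - ln d"
    unfolding a_def b_def c_def by (intro prob01.fm_cut_en M N d)+
  have "(cos_tr \<mu> t - cos_tr \<nu> t)\<^sup>2 + (sin_tr \<mu> t - sin_tr \<nu> t)\<^sup>2 = a t - 2 * b t + c t" for t
    unfolding a_def b_def c_def by (simp add: power2_eq_square algebra_simps)
  then have eq: "(\<lambda>t. (cos_tr \<mu> t - cos_tr \<nu> t)\<^sup>2 + (sin_tr \<mu> t - sin_tr \<nu> t)\<^sup>2) = (\<lambda>t. a t - 2 * b t + c t)" by blast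
  show "en_dist d \<mu> \<nu> = (\<integral>t. (cos_tr \<mu> t - cos_tr \<nu> t)\<^sup>2 + (sin_tr \<mu> t - sin_tr \<nu> t)\<^sup>2 \<partial>spectral d)"
    unfolding eq using i v by (simp add: en_dist_def)
  show "integrable (spectral d) (\<lambda>t. (cos_tr \<mu> t - cos_tr \<nu> t)\<^sup>2 + (sin_tr \<mu> t - sin_tr \<nu> t)\<^sup>2)"
    unfolding eq using i by simp
qed

lemma en_dist_nonneg: "0 < d \<Longrightarrow> d < 1 \<Longrightarrow> prob01 \<mu> \<Longrightarrow> prob01 \<nu> \<Longrightarrow> 0 \<le> en_dist d \<mu> \<nu>"
  by (subst en_dist_eq) (auto intro!: integral_nonneg_AE AE_I2)

text \<open>Cauchy--Schwarz for the positive definite form, between a point mass at \<open>x\<close> and \<open>\<mu> - \<nu>\<close>.\<close>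

lemma cut_pot_diff_le:
  assumes d: "0 < d" "d < 1" and M: "prob01 \<mu>" and N: "prob01 \<nu>"
  shows "\<bar>cut_pot d \<mu> x - cut_pot d \<nu> x\<bar> \<le> sqrt (- 2 * ln d * en_dist d \<mu> \<nu>)"
proof -
  note I = integrable_CfSf(1,2)[OF d M M] integrable_CfSf(1,2)[OF d M N] integrable_CfSf(1,2)[OF d N N]
    integrable_CfSf(3,4)[OF d M N, of x] integrable_CfSf(3,4)[OF d N N, of x]
  define D where "D = cut_pot d \<mu> x - cut_pot d \<nu> x"
  \<comment> \<open>The minimizer in c of the polynomial
    \<open>en_dist d \<mu> \<nu> + 2 * c * D - 2 * c\<^sup>2 * ln d\<close>, in which - 2 ln d is
    the total spectral mass. Nonnegativity of its minimum is the Cauchy--Schwarz inequality.\<close>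
  define c where "c = D / (2 * ln d)"
  have i1: "integrable (spectral d) (\<lambda>t. 1::real)" by (intro integrable_spectral[OF d, where B=1]) auto
  let ?A = "\<lambda>t. (cos_tr \<mu> t - cos_tr \<nu> t)\<^sup>2 + (sin_tr \<mu> t - sin_tr \<nu> t)\<^sup>2"
  let ?B = "\<lambda>t. (cos (t * x) * cos_tr \<mu> t + sin (t * x) * sin_tr \<mu> t) - (cos (t * x) * cos_tr \<nu> t + sin (t * x) * sin_tr \<nu> t)"
  have iA: "integrable (spectral d) ?A" by (rule integrable_en_dist[OF d M N])
  have iB: "integrable (spectral d) ?B"
    by (intro Bochner_Integration.integrable_add Bochner_Integration.integrable_diff I)
  have "(\<integral>t. ?B t \<partial>spectral d) = (cut_pot d \<mu> x - ln d) - (cut_pot d \<nu> x - ln d)"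
    unfolding prob01.fm_cut_pot[OF M d, symmetric] prob01.fm_cut_pot[OF N d, symmetric]
    by (intro Bochner_Integration.integral_diff Bochner_Integration.integrable_add I)
  then have B: "(\<integral>t. ?B t \<partial>spectral d) = D" by (simp add: D_def)
  have "0 \<le> (\<integral>t. (cos_tr \<mu> t - cos_tr \<nu> t + c * cos (t * x))\<^sup>2 + (sin_tr \<mu> t - sin_tr \<nu> t + c * sin (t * x))\<^sup>2 \<partial>spectral d)"
    by (intro integral_nonneg_AE) auto
  also have "\<dots> = (\<integral>t. ?A t + 2 * c * ?B t + c\<^sup>2 * 1 \<partial>spectral d)"
  proof (intro Bochner_Integration.integral_cong refl)
    fix t
    have "c\<^sup>2 * (cos (t * x))\<^sup>2 + c\<^sup>2 * (sin (t * x))\<^sup>2 = c\<^sup>2"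
      by (simp only: distrib_left[symmetric] sin_cos_squared_add2 mult_1_right)
    then show "(cos_tr \<mu> t - cos_tr \<nu> t + c * cos (t * x))\<^sup>2 + (sin_tr \<mu> t - sin_tr \<nu> t + c * sin (t * x))\<^sup>2 = ?A t + 2 * c * ?B t + c\<^sup>2 * 1"
      by (simp add: power2_eq_square algebra_simps)
  qed
  also have "\<dots> = en_dist d \<mu> \<nu> + 2 * c * D + c\<^sup>2 * (- 2 * ln d)"
  proof -
    have gen: "(\<integral>t. A t + B t + k \<partial>spectral d) = (\<integral>t. A t \<partial>spectral d) + (\<integral>t. B t \<partial>spectral d) + (\<integral>t. k \<partial>spectral d)"
      if "integrable (spectral d) A" "integrable (spectral d) B" for A B and k :: real
      using that finite_measure.integrable_const[OF finite_measure_spectral[OF d], of k]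
      by (subst Bochner_Integration.integral_add) auto
    have "(\<integral>t. ?A t + 2 * c * ?B t + c\<^sup>2 * 1 \<partial>spectral d)
       = (\<integral>t. ?A t \<partial>spectral d) + (\<integral>t. 2 * c * ?B t \<partial>spectral d) + (\<integral>t. c\<^sup>2 * 1 \<partial>spectral d)"
      by (rule gen[OF iA integrable_mult_right[OF iB]])
    also have "(\<integral>t. 2 * c * ?B t \<partial>spectral d) = 2 * c * (\<integral>t. ?B t \<partial>spectral d)"
      by (rule integral_mult_right_zero)
    also have "(\<integral>t. c\<^sup>2 * 1 \<partial>spectral d) = c\<^sup>2 * (- 2 * ln d)" using measure_spectral[OF d] by simp
    finally show ?thesis by (simp only: B en_dist_eq[OF d M N])
  qed
  finally have "0 \<le> en_dist d \<mu> \<nu> + 2 * c * D + c\<^sup>2 * (- 2 * ln d)" .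
  moreover have l: "ln d < 0" using d by simp
  moreover have "2 * c * D + c\<^sup>2 * (- 2 * ln d) = D\<^sup>2 / (2 * ln d)"
    using l by (simp add: c_def field_simps power2_eq_square)
  ultimately have "0 \<le> en_dist d \<mu> \<nu> + D\<^sup>2 / (2 * ln d)" by simp
  then have "D\<^sup>2 \<le> - 2 * ln d * en_dist d \<mu> \<nu>" using l by (simp add: field_simps)
  then show ?thesis unfolding D_def[symmetric] by (rule real_le_rsqrt[of "\<bar>D\<bar>", simplified])
qed

text \<open>The spectral density at t is the integral of a positive function over [d, 1/d], an
  interval that grows as d decreases, while the integrand of squares is the same for all d.\<close>

lemma en_dist_mono:
  assumes e: "0 < e" "e \<le> d" "d < 1" and M: "prob01 \<mu>" and N: "prob01 \<nu>"
  shows "en_dist d \<mu> \<nu> \<le> en_dist e \<mu> \<nu>"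
proof -
  interpret M: prob01 \<mu> by (rule M)
  interpret N: prob01 \<nu> by (rule N)
  let ?f = "\<lambda>t. (cos_tr \<mu> t - cos_tr \<nu> t)\<^sup>2 + (sin_tr \<mu> t - sin_tr \<nu> t)\<^sup>2"
  have eq: "ennreal (en_dist d' \<mu> \<nu>) = (\<integral>\<^sup>+t. ennreal (?f t) \<partial>spectral d')" if "0 < d'" "d' < 1" for d'
  proof -
    show ?thesis unfolding en_dist_eq[OF that M N]
      by (intro nn_integral_eq_integral[symmetric] integrable_en_dist that M N AE_I2) auto
  qed
  have d: "0 < d" and e1: "e < 1" using e by auto
  have [measurable]: "(\<lambda>t. ennreal (?f t)) \<in> borel_measurable borel" by measurable
  have "(\<integral>\<^sup>+t. ennreal (?f t) \<partial>spectral d) \<le> (\<integral>\<^sup>+t. ennreal (?f t) \<partial>spectral e)"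
    unfolding nn_integral_spectral[OF \<open>(\<lambda>t. ennreal (?f t)) \<in> borel_measurable borel\<close>]
  proof (rule nn_integral_mono, rule mult_right_mono, rule mult_left_mono, rule nn_integral_mono, rule mult_left_mono)
    fix t s :: real
    have "1 / d \<le> 1 / e" using e by (intro divide_left_mono) auto
    then show "indicator {d..1 / d} s \<le> (indicator {e..1 / e} s :: ennreal)"
      using e by (auto simp: indicator_def)
  qed (rule zero_le)+
  then have "ennreal (en_dist d \<mu> \<nu>) \<le> ennreal (en_dist e \<mu> \<nu>)"
    unfolding eq[OF d e(3)] eq[OF e(1) e1] .
  then show ?thesis using en_dist_nonneg[OF e(1) e1 M N] by (simp add: ennreal_le_iff)
qed

lemma spectral_weight_pos:
  assumes d: "0 < d" "d < (1::real)"
  shows "(\<integral>\<^sup>+s. ennreal (exp (- (s * t))) * indicator {d..1 / d} s \<partial>lborel) \<noteq> 0"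
proof
  assume "(\<integral>\<^sup>+s. ennreal (exp (- (s * t))) * indicator {d..1 / d} s \<partial>lborel) = 0"
  then have "AE s in lborel. ennreal (exp (- (s * t))) * indicator {d..1 / d} s = 0"
    by (subst (asm) nn_integral_0_iff_AE) auto
  then have "AE s in lborel. s \<notin> {d..1 / d}" by eventually_elim (auto simp: indicator_def split: if_splits)
  then have "emeasure lborel {d..1 / d} = 0" by (subst (asm) AE_iff_null_sets[symmetric]) auto
  moreover have "d < 1 / d" using d mult_strict_mono[of d 1 d 1] by (simp add: field_simps)
  ultimately show False by (simp add: ennreal_eq_0_iff)
qed

context prob01 begin

lemma real_distribution_mu: "real_distribution (distr \<mu> borel (\<lambda>x. x))"
  by (intro real_distribution_distr) auto

lemma char_eq: "char (distr \<mu> borel (\<lambda>x. x)) t = Complex (cos_tr \<mu> t) (sin_tr \<mu> t)"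
proof -
  have i: "integrable \<mu> (\<lambda>y. iexp (t * y))"
    by (intro integrable_const_bound[where B=1]) auto
  have "char (distr \<mu> borel (\<lambda>x. x)) t = (CLINT y|\<mu>. iexp (t * y))"
    unfolding char_def by (subst integral_distr) auto
  moreover have "Re (CLINT y|\<mu>. iexp (t * y)) = cos_tr \<mu> t"
    unfolding cos_tr_def by (subst integral_Re[OF i, symmetric]) (simp add: Re_exp)
  moreover have "Im (CLINT y|\<mu>. iexp (t * y)) = sin_tr \<mu> t"
    unfolding sin_tr_def by (subst integral_Im[OF i, symmetric]) (simp add: Im_exp)
  ultimately show ?thesis by (metis complex_surj)
qed

lemma cos_tr_sin_tr_isCont: "isCont (cos_tr \<mu>) t" "isCont (sin_tr \<mu>) t"
proof -
  have "isCont (\<lambda>t. Complex (cos_tr \<mu> t) (sin_tr \<mu> t)) t"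
    using real_distribution.isCont_char[OF real_distribution_mu, of t] by (simp add: char_eq[abs_def])
  from continuous_Re[OF this] continuous_Im[OF this] show "isCont (cos_tr \<mu>) t" "isCont (sin_tr \<mu>) t" by simp_all
qed

end

text \<open>Levy's uniqueness theorem speaks of distributions on the whole line, whereas these
  measures carry the trace sigma-algebra of [0,1]; equality is transferred back here.\<close>

lemma prob01_eqI:
  assumes M: "prob01 \<mu>" and N: "prob01 \<nu>" and eq: "distr \<mu> borel (\<lambda>x. x) = distr \<nu> borel (\<lambda>x. x)"
  shows "\<mu> = \<nu>"
proof (rule measure_eqI)
  interpret M: prob01 \<mu> by (rule M)
  interpret N: prob01 \<nu> by (rule N)
  show s: "sets \<mu> = sets \<nu>" by (simp add: M.sets_eq N.sets_eq)
  fix A assume A: "A \<in> sets \<mu>"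
  then have sub: "A \<subseteq> {0..1}" using sets.sets_into_space[of A \<mu>] by simp
  obtain B where B: "B \<in> sets borel" "A = {0..1} \<inter> B"
    using A unfolding M.sets_eq sets_restrict_space by auto
  have "A \<in> sets borel" unfolding B(2) using B(1) by (intro sets.Int) auto
  moreover have "(\<lambda>x. x) -` A \<inter> space \<mu> = A" "(\<lambda>x. x) -` A \<inter> space \<nu> = A" using sub by auto
  ultimately have "emeasure (distr \<mu> borel (\<lambda>x. x)) A = emeasure \<mu> A" "emeasure (distr \<nu> borel (\<lambda>x. x)) A = emeasure \<nu> A"
    using emeasure_distr[OF M.id_measurable, of A] emeasure_distr[OF N.id_measurable, of A] by simp_all
  then show "emeasure \<mu> A = emeasure \<nu> A" unfolding eq by simp
qed

text \<open>The spectral density is positive on the half-line, so the transforms agree almost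
  everywhere for t > 0, then everywhere there by continuity, and for t < 0 by parity. Characteristic
  functions determine the measure.\<close>

lemma en_dist_eq_0_imp_eq:
  assumes d: "0 < d" "d < 1" and M: "prob01 \<mu>" and N: "prob01 \<nu>" and E: "en_dist d \<mu> \<nu> = 0"
  shows "\<mu> = \<nu>"
proof -
  interpret M: prob01 \<mu> by (rule M)
  interpret N: prob01 \<nu> by (rule N)
  let ?f = "\<lambda>t. (cos_tr \<mu> t - cos_tr \<nu> t)\<^sup>2 + (sin_tr \<mu> t - sin_tr \<nu> t)\<^sup>2"
  have "AE t in spectral d. ?f t = 0"
    using E integrable_en_dist[OF d M N] unfolding en_dist_eq[OF d M N]
    by (subst (asm) integral_nonneg_eq_0_iff_AE) auto
  then have "AE t in lborel. 0 < indicator {0..} t * (\<integral>\<^sup>+s. ennreal (exp (- (s * t))) * indicator {d..1 / d} s \<partial>lborel) \<longrightarrow> ?f t = 0"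
    unfolding spectral_def by (subst (asm) AE_density) auto
  then have "AE t in lborel. t \<in> {0<..} \<longrightarrow> t \<in> {t. ?f t = 0}"
  proof eventually_elim
    case (elim t)
    have "0 < (\<integral>\<^sup>+s. ennreal (exp (- (s * t))) * indicator {d..1 / d} s \<partial>lborel)"
      using spectral_weight_pos[OF d, of t] by (simp only: zero_less_iff_neq_zero not_False_eq_True)
    then show ?case using elim by (auto simp: indicator_def)
  qed
  then have ae: "AE t in lebesgue. t \<in> {0<..} \<longrightarrow> t \<in> {t. ?f t = 0}" by (rule AE_completion)
  have cl: "closed {t. ?f t = 0}"
    by (intro closed_Collect_eq continuous_intros)
       (auto simp: continuous_on_eq_continuous_at intro!: M.cos_tr_sin_tr_isCont N.cos_tr_sin_tr_isCont)
  have pos: "?f t = 0" if "t > 0" for t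
    using mem_closed_if_AE_lebesgue_open[OF _ cl ae, of t] that by auto
  have z: "cos_tr \<mu> t = cos_tr \<nu> t \<and> sin_tr \<mu> t = sin_tr \<nu> t" for t
  proof -
    have p: "cos_tr \<mu> t = cos_tr \<nu> t \<and> sin_tr \<mu> t = sin_tr \<nu> t" if "t > 0" for t
      using pos[OF that] by (simp add: sum_power2_eq_zero_iff)
    consider "t > 0" | "t = 0" | "- t > 0" by linarith
    then show ?thesis
    proof cases
      case 2 then show ?thesis using M.prob_space N.prob_space by (simp add: cos_tr_def sin_tr_def)
    next
      case 3
      from p[OF this] show ?thesis by (simp add: cos_tr_def sin_tr_def)
    qed (rule p)
  qed
  show ?thesis
    by (rule prob01_eqI[OF M N], rule Levy_uniqueness[OF M.real_distribution_mu N.real_distribution_mu], rule ext)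
       (simp only: M.char_eq N.char_eq z)
qed

section \<open>The energy functional\<close>

definition ext_pot :: "real \<Rightarrow> real \<Rightarrow> real \<Rightarrow> ennreal" where
  "ext_pot a b x = ennreal a * log_ker x + ennreal b * log_ker (1 - x)"

definition cut_ext :: "real \<Rightarrow> real \<Rightarrow> real \<Rightarrow> real \<Rightarrow> real" where
  "cut_ext d a b x = a * cut_ker d x + b * cut_ker d (1 - x)"

text \<open>Up to the factor \<rho>^2 and an additive constant this is the Hiai--Petz functional.
  Values in \<open>ennreal\<close> make infinite energy an ordinary value, since all kernels
  involved are nonnegative.\<close>

definition energy :: "real \<Rightarrow> real \<Rightarrow> real measure \<Rightarrow> ennreal" where
  "energy a b \<mu> = log_en \<mu> \<mu> + (\<integral>\<^sup>+x. ext_pot a b x \<partial>\<mu>)"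

definition cut_energy :: "real \<Rightarrow> real \<Rightarrow> real \<Rightarrow> real measure \<Rightarrow> real" where
  "cut_energy d a b \<mu> = cut_en d \<mu> \<mu> + (\<integral>x. cut_ext d a b x \<partial>\<mu>)"

text \<open>Twice the potential \<open>V - \<integral> log \<bar>x - y\<bar> d\<mu>\<close>, which avoids halves throughout.\<close>

definition eff_pot :: "real \<Rightarrow> real \<Rightarrow> real measure \<Rightarrow> real \<Rightarrow> ennreal" where
  "eff_pot a b \<mu> x = ext_pot a b x + 2 * log_pot \<mu> x"

definition cut_eff :: "real \<Rightarrow> real \<Rightarrow> real \<Rightarrow> real measure \<Rightarrow> real \<Rightarrow> real" where
  "cut_eff d a b \<mu> x = cut_ext d a b x + 2 * cut_pot d \<mu> x"

lemma ext_pot_measurable [measurable]: "ext_pot a b \<in> borel_measurable borel"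
  unfolding ext_pot_def[abs_def] by measurable

lemma cut_ext_measurable [measurable]: "cut_ext d a b \<in> borel_measurable borel"
  unfolding cut_ext_def[abs_def] by measurable

lemma SUP_ennreal_add:
  fixes f g :: "nat \<Rightarrow> real"
  assumes "incseq f" "incseq g" "\<And>j. 0 \<le> f j" "\<And>j. 0 \<le> g j"
  shows "(SUP j. ennreal (f j + g j)) = (SUP j. ennreal (f j)) + (SUP j. ennreal (g j))"
  using assms by (subst ennreal_SUP_add[symmetric]) (auto simp: incseq_def ennreal_plus intro!: ennreal_leI)

lemma SUP_ennreal_cmult:
  fixes f :: "nat \<Rightarrow> real"
  assumes "0 \<le> c" "\<And>j. 0 \<le> f j"
  shows "(SUP j. ennreal (c * f j)) = ennreal c * (SUP j. ennreal (f j))"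
  using assms by (simp add: SUP_mult_left_ennreal ennreal_mult)

context
  fixes a b :: real assumes a: "0 \<le> a" and b: "0 \<le> b"
begin

lemma cut_ext_nonneg: "0 < d \<Longrightarrow> d < 1 \<Longrightarrow> x \<in> {0..1} \<Longrightarrow> 0 \<le> cut_ext d a b x"
  unfolding cut_ext_def using a b by (intro add_nonneg_nonneg mult_nonneg_nonneg cut_ker_nonneg) auto

lemma cut_ext_abs_le: "0 < d \<Longrightarrow> d < 1 \<Longrightarrow> \<bar>cut_ext d a b x\<bar> \<le> (a + b) * (- ln d)"
proof -
  assume d: "0 < d" "d < 1"
  have "\<bar>cut_ext d a b x\<bar> \<le> \<bar>a * cut_ker d x\<bar> + \<bar>b * cut_ker d (1 - x)\<bar>" unfolding cut_ext_def by linarith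
  also have "\<dots> = a * \<bar>cut_ker d x\<bar> + b * \<bar>cut_ker d (1 - x)\<bar>" using a b by (simp add: abs_mult)
  also have "\<dots> \<le> a * (- ln d) + b * (- ln d)"
    using a b by (intro add_mono mult_left_mono cut_ker_abs_le d)
  finally show ?thesis by (simp add: algebra_simps)
qed

lemma cut_ext_mono: "0 < e \<Longrightarrow> e \<le> d \<Longrightarrow> d < 1 \<Longrightarrow> x \<in> {0..1} \<Longrightarrow> cut_ext d a b x \<le> cut_ext e a b x"
  unfolding cut_ext_def using a b by (intro add_mono mult_left_mono cut_ker_mono) auto

lemma SUP_cut_ext: "x \<in> {0..1} \<Longrightarrow> (SUP j. ennreal (cut_ext (cut_seq j) a b x)) = ext_pot a b x"
proof -
  assume x: "x \<in> {0..1}"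
  have i: "incseq (\<lambda>j. cut_ker (cut_seq j) y)" "\<And>j. 0 \<le> cut_ker (cut_seq j) y" if "\<bar>y\<bar> \<le> 1" for y
    using that by (auto intro!: incseq_cut_ker cut_ker_nonneg cut_seq)
  have x': "\<bar>x\<bar> \<le> 1" "\<bar>1 - x\<bar> \<le> 1" using x by auto
  show ?thesis
    unfolding cut_ext_def ext_pot_def
    using a b i[OF x'(1)] i[OF x'(2)] SUP_cut_ker[OF x'(1)] SUP_cut_ker[OF x'(2)]
    by (subst SUP_ennreal_add) (auto simp: SUP_ennreal_cmult incseq_def intro!: mult_left_mono)
qed

lemma cut_ext_le_ext_pot: "0 < d \<Longrightarrow> d < 1 \<Longrightarrow> x \<in> {0..1} \<Longrightarrow> ennreal (cut_ext d a b x) \<le> ext_pot a b x"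
  unfolding cut_ext_def ext_pot_def using a b
  by (intro order_trans[OF ennreal_add_le] add_mono)
     (auto simp: ennreal_mult' intro!: mult_left_mono cut_ker_le_log_ker)

lemma cut_ext_isCont: "0 < d \<Longrightarrow> d < 1 \<Longrightarrow> isCont (cut_ext d a b) x"
proof -
  assume d: "0 < d" "d < 1"
  have c: "isCont (cut_ker d) z" for z using cut_ker_continuous_on[OF d, of UNIV] by (simp add: continuous_on_eq_continuous_at)
  show ?thesis unfolding cut_ext_def[abs_def]
    by (intro continuous_intros isCont_o2[OF _ c] c)
qed

end

context prob01 begin

context
  fixes a b :: real assumes a: "0 \<le> a" and b: "0 \<le> b"
begin

lemma integrable_cut_ext: "0 < d \<Longrightarrow> d < 1 \<Longrightarrow> integrable \<mu> (cut_ext d a b)"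
  by (intro integrable_bdd[where B="(a + b) * (- ln d)"] borel_measurable_mu cut_ext_measurable cut_ext_abs_le a b)

lemma cut_ext_ennreal: "0 < d \<Longrightarrow> d < 1 \<Longrightarrow> ennreal (\<integral>x. cut_ext d a b x \<partial>\<mu>) = (\<integral>\<^sup>+x. ennreal (cut_ext d a b x) \<partial>\<mu>)"
  by (intro nn_integral_eq_integral[symmetric] integrable_cut_ext AE_I2 cut_ext_nonneg a b) auto

lemma cut_ext_int_nonneg: "0 < d \<Longrightarrow> d < 1 \<Longrightarrow> 0 \<le> (\<integral>x. cut_ext d a b x \<partial>\<mu>)"
  by (intro integral_nonneg_AE AE_I2 cut_ext_nonneg a b) auto

lemma cut_ext_int_mono: "0 < e \<Longrightarrow> e \<le> d \<Longrightarrow> d < 1 \<Longrightarrow> (\<integral>x. cut_ext d a b x \<partial>\<mu>) \<le> (\<integral>x. cut_ext e a b x \<partial>\<mu>)"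
  by (intro integral_mono_AE integrable_cut_ext AE_I2 cut_ext_mono a b) auto

lemma cut_en_nonneg: "prob01 \<nu> \<Longrightarrow> 0 < d \<Longrightarrow> d < 1 \<Longrightarrow> 0 \<le> cut_en d \<mu> \<nu>"
  unfolding cut_en_def by (intro integral_nonneg_AE AE_I2 prob01.cut_pot_nonneg) auto

text \<open>Monotone convergence in the truncation. Together with the weak continuity of each
  \<open>cut_energy\<close> it makes the energy weakly lower semicontinuous.\<close>

lemma SUP_cut_energy: "(SUP j. ennreal (cut_energy (cut_seq j) a b \<mu>)) = energy a b \<mu>"
proof -
  have "(\<integral>\<^sup>+y. (SUP j. ennreal (cut_ext (cut_seq j) a b y)) \<partial>\<mu>) = (SUP j. \<integral>\<^sup>+y. ennreal (cut_ext (cut_seq j) a b y) \<partial>\<mu>)"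
  proof (rule nn_integral_monotone_convergence_SUP_AE)
    show "AE y in \<mu>. ennreal (cut_ext (cut_seq j) a b y) \<le> ennreal (cut_ext (cut_seq (Suc j)) a b y)" for j
      by (intro AE_I2 ennreal_leI cut_ext_mono a b cut_seq cut_seq_antimono) auto
    show "(\<lambda>y. ennreal (cut_ext (cut_seq j) a b y)) \<in> borel_measurable \<mu>" for j
      by (intro borel_measurable_mu) measurable
  qed
  moreover have "(\<integral>\<^sup>+y. (SUP j. ennreal (cut_ext (cut_seq j) a b y)) \<partial>\<mu>) = (\<integral>\<^sup>+y. ext_pot a b y \<partial>\<mu>)"
    by (intro nn_integral_cong SUP_cut_ext a b) auto
  ultimately have v: "(SUP j. ennreal (\<integral>y. cut_ext (cut_seq j) a b y \<partial>\<mu>)) = (\<integral>\<^sup>+y. ext_pot a b y \<partial>\<mu>)"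
    by (simp add: cut_ext_ennreal cut_seq)
  have i: "incseq (\<lambda>j. cut_en (cut_seq j) \<mu> \<mu>)" "incseq (\<lambda>j. \<integral>y. cut_ext (cut_seq j) a b y \<partial>\<mu>)"
    unfolding incseq_def by (intro allI impI cut_en_mono cut_ext_int_mono prob01_axioms cut_seq cut_seq_antimono; assumption)+
  show ?thesis unfolding cut_energy_def energy_def
    by (subst SUP_ennreal_add[OF i cut_en_nonneg cut_ext_int_nonneg])
       (auto simp: SUP_cut_en prob01_axioms v cut_seq)
qed

lemma cut_energy_le_energy: "0 < d \<Longrightarrow> d < 1 \<Longrightarrow> ennreal (cut_energy d a b \<mu>) \<le> energy a b \<mu>"
  unfolding cut_energy_def energy_def
  by (intro order_trans[OF ennreal_add_le] add_mono cut_en_le_log_en prob01_axioms)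
     (auto simp: cut_ext_ennreal intro!: nn_integral_mono cut_ext_le_ext_pot a b)

lemma energy_eq_nn: "(\<integral>\<^sup>+x. ext_pot a b x \<partial>\<mu>) = ennreal a * (\<integral>\<^sup>+x. log_ker x \<partial>\<mu>) + ennreal b * (\<integral>\<^sup>+x. log_ker (1 - x) \<partial>\<mu>)"
  unfolding ext_pot_def by (subst nn_integral_add) (auto simp: nn_integral_cmult intro!: borel_measurable_mu)

end

end

section \<open>Existence of the equilibrium measure\<close>

text \<open>Measures on [0,1] are tight, so a subsequence converges weakly on the line. The clamp
  \<open>cl\<close> pushes the limit back onto [0,1]; it fixes the points of [0,1], so the integrals
  against the approximating measures do not change.\<close>

lemma prob01_weak_limit:
  assumes M: "\<And>j. prob01 (M j)"
  obtains r \<mu> where "strict_mono (r :: nat \<Rightarrow> nat)" "prob01 \<mu>"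
    "\<And>f B. (\<And>x::real. isCont f x) \<Longrightarrow> (\<And>x. \<bar>f x\<bar> \<le> (B::real)) \<Longrightarrow>
       (\<lambda>j. \<integral>x. f x \<partial>M (r j)) \<longlonglongrightarrow> (\<integral>x. f x \<partial>\<mu>)"
proof -
  define N where "N j = distr (M j) borel (\<lambda>x. x)" for j
  have rd: "real_distribution (N j)" for j unfolding N_def by (rule prob01.real_distribution_mu[OF M])
  have "tight N"
    unfolding tight_def
  proof (intro conjI allI impI rd)
    fix \<epsilon> :: real assume "\<epsilon> > 0"
    have "measure (N j) {-1<..2} = 1" for j
    proof -
      interpret prob01 "M j" by (rule M)
      have "(\<lambda>x. x) -` {-1<..2} \<inter> space (M j) = space (M j)" by auto
      then show ?thesis unfolding N_def by (subst measure_distr) (use prob_space in auto)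
    qed
    then show "\<exists>a b. a < b \<and> (\<forall>n. 1 - \<epsilon> < measure (N n) {a<..b})"
      using \<open>\<epsilon> > 0\<close> by (intro exI[of _ "-1"] exI[of _ 2]) auto
  qed
  from tight_imp_convergent_subsubsequence[OF this strict_mono_id]
  obtain r L where r: "strict_mono (r :: nat \<Rightarrow> nat)" and L: "real_distribution L"
    and w: "weak_conv_m (N \<circ> r) L" by (auto simp: comp_def)
  define cl where "cl x = max 0 (min 1 x)" for x :: real
  have [measurable]: "cl \<in> borel_measurable borel" unfolding cl_def[abs_def] by measurable
  have clc: "isCont cl x" for x unfolding cl_def[abs_def] by (intro continuous_intros)
  interpret L: real_distribution L by fact
  define \<mu> where "\<mu> = distr L (restrict_space borel {0..1}) cl"
  have cl_meas: "cl \<in> borel_measurable L" by simp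
  have cl01: "cl x \<in> {0..1}" for x by (auto simp: cl_def)
  note mu = prob01_distr[OF L.prob_space_axioms cl_meas cl01]
  show thesis
  proof (rule that[OF r, of \<mu>])
    show "prob01 \<mu>" unfolding \<mu>_def by (rule mu(1))
    fix f :: "real \<Rightarrow> real" and B assume c: "\<And>x. isCont f x" and bd: "\<And>x. \<bar>f x\<bar> \<le> B"
    have [measurable]: "f \<in> borel_measurable borel"
      using c by (intro borel_measurable_continuous_onI continuous_at_imp_continuous_on) auto
    have "(\<lambda>n. integral\<^sup>L ((N \<circ> r) n) (\<lambda>x. f (cl x))) \<longlonglongrightarrow> integral\<^sup>L L (\<lambda>x. f (cl x))"
    proof (rule weak_conv_imp_integral_bdd_continuous_conv[OF _ L w])
      show "real_distribution ((N \<circ> r) n)" for n by (simp add: rd)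
      show "isCont (\<lambda>x. f (cl x)) x" for x by (rule isCont_o2[OF clc c])
      show "norm (f (cl x)) \<le> B" for x by (simp add: bd)
    qed
    moreover have "integral\<^sup>L ((N \<circ> r) n) (\<lambda>x. f (cl x)) = (\<integral>x. f x \<partial>M (r n))" for n
    proof -
      interpret prob01 "M (r n)" by (rule M)
      have "integral\<^sup>L ((N \<circ> r) n) (\<lambda>x. f (cl x)) = (\<integral>x. f (cl x) \<partial>M (r n))"
        unfolding N_def comp_def by (subst integral_distr) auto
      also have "\<dots> = (\<integral>x. f x \<partial>M (r n))"
        by (intro Bochner_Integration.integral_cong refl) (auto simp: cl_def)
      finally show ?thesis .
    qed
    moreover have "integral\<^sup>L L (\<lambda>x. f (cl x)) = (\<integral>x. f x \<partial>\<mu>)"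
      unfolding \<mu>_def by (subst integral_distr[OF mu(2)]) (auto intro!: measurable_restrict_space1)
    ultimately show "(\<lambda>j. \<integral>x. f x \<partial>M (r j)) \<longlonglongrightarrow> (\<integral>x. f x \<partial>\<mu>)" by simp
  qed
qed

text \<open>The law of x + r U with U uniform on [0,1]. A negative r is allowed, so that every x in
  [0,1], including 1, is an endpoint of a segment inside [0,1].\<close>

definition unif_seg :: "real \<Rightarrow> real \<Rightarrow> real measure" where
  "unif_seg x r = distr unif01 (restrict_space borel {0..1}) (\<lambda>u. x + r * u)"

lemma id_unif01 [measurable]: "(\<lambda>u. u) \<in> borel_measurable unif01"
  by (intro measurable_restrict_space1) simp

lemma
  assumes "x \<in> {0..1}" "x + r \<in> {0..1}"
  shows prob01_unif_seg: "prob01 (unif_seg x r)"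
    and nn_integral_unif_seg: "f \<in> borel_measurable borel \<Longrightarrow> (\<integral>\<^sup>+y. f y \<partial>unif_seg x r) = (\<integral>\<^sup>+u. f (x + r * u) \<partial>unif01)"
proof -
  have 1: "(\<lambda>u. x + r * u) \<in> borel_measurable unif01" by measurable
  have 2: "x + r * u \<in> {0..1}" if "u \<in> space unif01" for u
  proof -
    have u: "0 \<le> u" "u \<le> 1" using that by (auto simp: space_restrict_space)
    have "x + r * u = (1 - u) * x + u * (x + r)" by (simp add: algebra_simps)
    moreover have "(1 - u) * x + u * (x + r) \<le> (1 - u) * 1 + u * 1"
      using assms u by (intro add_mono[of "(1 - u) * x"] mult_left_mono) auto
    moreover have "0 \<le> (1 - u) * x + u * (x + r)"
      using assms u by (intro add_nonneg_nonneg[of "(1 - u) * x"] mult_nonneg_nonneg[of _ "x + r"] mult_nonneg_nonneg[of _ x]) auto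
    ultimately show ?thesis by simp
  qed
  note * = prob01_distr[OF prob01.axioms(1)[OF prob01_unif01] 1 2]
  show "prob01 (unif_seg x r)" unfolding unif_seg_def by (rule *(1))
  show "f \<in> borel_measurable borel \<Longrightarrow> (\<integral>\<^sup>+y. f y \<partial>unif_seg x r) = (\<integral>\<^sup>+u. f (x + r * u) \<partial>unif01)"
    unfolding unif_seg_def by (subst nn_integral_distr[OF *(2)]) (auto intro: measurable_restrict_space1)
qed

lemma unif_seg_0_1: "x = 0 \<Longrightarrow> r = 1 \<Longrightarrow> unif_seg x r = unif01"
  unfolding unif_seg_def using prob01.sets_eq[OF prob01_unif01] by (simp add: distr_id2)

lemma unif_seg_density_le:
  assumes "x \<in> {0..1}" "x + r \<in> {0..1}" "r \<noteq> 0" and f [measurable]: "f \<in> borel_measurable borel"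
  shows "(\<integral>\<^sup>+y. f y \<partial>unif_seg x r) \<le> ennreal (1 / \<bar>r\<bar>) * (\<integral>\<^sup>+y. f y \<partial>unif01)"
proof -
  have "(\<integral>\<^sup>+y. f y \<partial>unif_seg x r) = (\<integral>\<^sup>+y. f y * indicator {0..1} y \<partial>unif_seg x r)"
    using prob01.space_eq[OF prob01_unif_seg[OF assms(1,2)]] by (intro nn_integral_cong) auto
  also have "\<dots> = (\<integral>\<^sup>+u. f (x + r * u) * indicator {0..1} (x + r * u) \<partial>unif01)"
    by (intro nn_integral_unif_seg assms) auto
  also have "\<dots> \<le> ennreal (1 / \<bar>r\<bar>) * (\<integral>\<^sup>+y. f y * indicator {0..1} y \<partial>lborel)"
    by (intro nn_integral_unif01_affine_le[where f="\<lambda>y. f y * indicator {0..1} y"] assms) auto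
  finally show ?thesis by (simp only: nn_integral_unif01)
qed

lemma log_pot_unif_seg_le:
  assumes "x \<in> {0..1}" "x + r \<in> {0..1}" "r \<noteq> 0"
  shows "log_pot (unif_seg x r) y \<le> ennreal (2 / \<bar>r\<bar>)"
proof -
  have "log_pot (unif_seg x r) y = (\<integral>\<^sup>+u. log_ker (y - x + - r * u) \<partial>unif01)"
    unfolding log_pot_def by (subst nn_integral_unif_seg[OF assms(1,2)]) (auto simp: algebra_simps)
  also have "\<dots> \<le> ennreal (1 / \<bar>- r\<bar>) * (\<integral>\<^sup>+x. log_ker x \<partial>lborel)"
    by (intro nn_integral_unif01_affine_le) (use assms in auto)
  also have "\<dots> = ennreal (2 / \<bar>r\<bar>)"
    unfolding nn_integral_log_ker by (simp add: ennreal_mult''[symmetric] flip: ennreal_numeral)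
  finally show ?thesis .
qed

lemma energy_unif01_finite: "energy a b unif01 < \<infinity>"
proof -
  interpret prob01 unif01 by (rule prob01_unif01)
  have l: "log_pot unif01 x \<le> 2" for x
    using log_pot_unif_seg_le[of 0 1 x] by (simp add: unif_seg_0_1)
  have "(\<integral>\<^sup>+x. log_ker x \<partial>unif01) = log_pot unif01 0" "(\<integral>\<^sup>+x. log_ker (1 - x) \<partial>unif01) = log_pot unif01 1"
    by (simp_all add: log_pot_def)
  moreover have "log_en unif01 unif01 \<le> (\<integral>\<^sup>+x. 2 \<partial>unif01)" unfolding log_en_def by (intro nn_integral_mono l)
  ultimately have "energy a b unif01 \<le> 2 + (ennreal a * 2 + ennreal b * 2)"
    unfolding energy_def ext_pot_def
    by (subst nn_integral_add) (auto simp: nn_integral_cmult l intro!: add_mono mult_left_mono borel_measurable_mu)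
  also have "\<dots> < \<infinity>" by (simp add: ennreal_mult_less_top ennreal_numeral_less_top)
  finally show ?thesis .
qed

text \<open>The spectral formula turns the double integral into a single integral of squared
  transforms. These converge pointwise by weak convergence and are bounded, and the spectral measure
  is finite, so dominated convergence applies.\<close>

lemma cut_energy_weak_limit:
  assumes ab: "0 \<le> a" "0 \<le> b" and d: "0 < d" "d < 1"
    and M: "\<And>j. prob01 (M j)" and mu: "prob01 \<mu>"
    and lim: "\<And>f B. (\<And>x::real. isCont f x) \<Longrightarrow> (\<And>x. \<bar>f x\<bar> \<le> (B::real)) \<Longrightarrow>
       (\<lambda>j. \<integral>x. f x \<partial>M j) \<longlonglongrightarrow> (\<integral>x. f x \<partial>\<mu>)"
  shows "(\<lambda>j. cut_energy d a b (M j)) \<longlonglongrightarrow> cut_energy d a b \<mu>"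
proof -
  have C: "(\<lambda>j. cos_tr (M j) t) \<longlonglongrightarrow> cos_tr \<mu> t" and S: "(\<lambda>j. sin_tr (M j) t) \<longlonglongrightarrow> sin_tr \<mu> t" for t
    unfolding cos_tr_def sin_tr_def by (rule lim[where B=1]; (intro continuous_intros | simp))+
  have V: "(\<lambda>j. \<integral>x. cut_ext d a b x \<partial>M j) \<longlonglongrightarrow> (\<integral>x. cut_ext d a b x \<partial>\<mu>)"
    by (rule lim[OF cut_ext_isCont[OF ab d] cut_ext_abs_le[OF ab d]])
  have cut_en: "cut_en d N N = (\<integral>t. cos_tr N t * cos_tr N t + sin_tr N t * sin_tr N t \<partial>spectral d) + ln d" if "prob01 N" for N
    using prob01.fm_cut_en[OF that that d] by simp
  have "(\<lambda>j. \<integral>t. cos_tr (M j) t * cos_tr (M j) t + sin_tr (M j) t * sin_tr (M j) t \<partial>spectral d)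
     \<longlonglongrightarrow> (\<integral>t. cos_tr \<mu> t * cos_tr \<mu> t + sin_tr \<mu> t * sin_tr \<mu> t \<partial>spectral d)"
  proof (rule integral_dominated_convergence[where w="\<lambda>_. 2"])
    have m: "cos_tr N \<in> borel_measurable (spectral d)" "sin_tr N \<in> borel_measurable (spectral d)" if "prob01 N" for N
      using prob01.cos_tr_measurable[OF that] prob01.sin_tr_measurable[OF that]
      by (simp_all add: measurable_cong_sets[OF sets_spectral refl])
    show "(\<lambda>t. cos_tr \<mu> t * cos_tr \<mu> t + sin_tr \<mu> t * sin_tr \<mu> t) \<in> borel_measurable (spectral d)"
      by (intro borel_measurable_add borel_measurable_times m mu)
    show "(\<lambda>t. cos_tr (M j) t * cos_tr (M j) t + sin_tr (M j) t * sin_tr (M j) t) \<in> borel_measurable (spectral d)" for j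
      by (intro borel_measurable_add borel_measurable_times m M)
    show "integrable (spectral d) (\<lambda>_. 2::real)"
      by (rule finite_measure.integrable_const[OF finite_measure_spectral[OF d]])
    show "AE t in spectral d. (\<lambda>j. cos_tr (M j) t * cos_tr (M j) t + sin_tr (M j) t * sin_tr (M j) t)
        \<longlonglongrightarrow> cos_tr \<mu> t * cos_tr \<mu> t + sin_tr \<mu> t * sin_tr \<mu> t"
      by (intro AE_I2 tendsto_intros C S)
    show "AE t in spectral d. norm (cos_tr (M j) t * cos_tr (M j) t + sin_tr (M j) t * sin_tr (M j) t) \<le> 2" for j
    proof (intro AE_I2)
      fix t
      have "\<bar>cos_tr (M j) t * cos_tr (M j) t\<bar> \<le> 1" "\<bar>sin_tr (M j) t * sin_tr (M j) t\<bar> \<le> 1"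
        by (intro abs_mult_le_1 prob01.cos_tr_le prob01.sin_tr_le M)+
      then show "norm (cos_tr (M j) t * cos_tr (M j) t + sin_tr (M j) t * sin_tr (M j) t) \<le> 2" 
        unfolding real_norm_def by linarith
    qed
  qed
  then show ?thesis unfolding cut_energy_def cut_en[OF M] cut_en[OF mu] by (intro tendsto_intros V)
qed

lemma energy_minimizer_exists:
  assumes ab: "0 \<le> a" "0 \<le> b"
  obtains \<mu> where "prob01 \<mu>" "\<And>\<nu>. prob01 \<nu> \<Longrightarrow> energy a b \<mu> \<le> energy a b \<nu>" "energy a b \<mu> < \<infinity>"
proof -
  define c where "c = (INF \<nu>\<in>Collect prob01. energy a b \<nu>)"
  have c_le: "c \<le> energy a b \<nu>" if "prob01 \<nu>" for \<nu> unfolding c_def using that by (intro INF_lower) auto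
  then have cfin: "c < \<infinity>" using energy_unif01_finite[of a b] prob01_unif01 by (metis le_less_trans)
  have "\<exists>\<nu>. prob01 \<nu> \<and> energy a b \<nu> < c + ennreal (cut_seq j)" for j
  proof -
    have "c < c + ennreal (cut_seq j)" using cfin cut_seq[of j] by (cases c) (auto simp flip: ennreal_plus intro!: ennreal_lessI)
    then have "(INF \<nu>\<in>Collect prob01. energy a b \<nu>) < c + ennreal (cut_seq j)" unfolding c_def .
    then show ?thesis unfolding INF_less_iff by auto
  qed
  then obtain M where M: "\<And>j. prob01 (M j)" "\<And>j. energy a b (M j) < c + ennreal (cut_seq j)" by metis
  obtain r \<mu> where r: "strict_mono (r :: nat \<Rightarrow> nat)" and mu: "prob01 \<mu>"
    and lim: "\<And>f B. (\<And>x::real. isCont f x) \<Longrightarrow> (\<And>x. \<bar>f x\<bar> \<le> (B::real)) \<Longrightarrow>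
       (\<lambda>j. \<integral>x. f x \<partial>M (r j)) \<longlonglongrightarrow> (\<integral>x. f x \<partial>\<mu>)"
    by (rule prob01_weak_limit[of M, OF M(1)]) blast
  \<comment> \<open>The truncation level i is fixed while the weak limit is taken along the
    minimizing sequence; only afterwards is the supremum over i formed.\<close>
  have "ennreal (cut_energy (cut_seq i) a b \<mu>) \<le> c" for i
  proof (rule LIMSEQ_le)
    show "(\<lambda>j. ennreal (cut_energy (cut_seq i) a b (M (r j)))) \<longlonglongrightarrow> ennreal (cut_energy (cut_seq i) a b \<mu>)"
      by (intro tendsto_ennrealI cut_energy_weak_limit[OF ab cut_seq M(1) mu lim])
    have "(\<lambda>j. ennreal (cut_seq (r j))) \<longlonglongrightarrow> ennreal 0"
      using LIMSEQ_subseq_LIMSEQ[OF cut_seq_lim r] by (intro tendsto_ennrealI) (simp add: comp_def)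
    then have "(\<lambda>j. c + ennreal (cut_seq (r j))) \<longlonglongrightarrow> c + ennreal 0" by (intro tendsto_add tendsto_const)
    then show "(\<lambda>j. c + ennreal (cut_seq (r j))) \<longlonglongrightarrow> c" by simp
    have "ennreal (cut_energy (cut_seq i) a b (M (r j))) \<le> c + ennreal (cut_seq (r j))" for j
      using prob01.cut_energy_le_energy[OF M(1) ab cut_seq[of i], of "r j"] M(2)[of "r j"] by (meson less_imp_le order_trans)
    then show "\<exists>N. \<forall>n\<ge>N. ennreal (cut_energy (cut_seq i) a b (M (r n))) \<le> c + ennreal (cut_seq (r n))" by blast
  qed
  then have le: "energy a b \<mu> \<le> c" unfolding prob01.SUP_cut_energy[OF mu ab, symmetric] by (intro SUP_least)
  show thesis
  proof (rule that[OF mu])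
    show "energy a b \<mu> \<le> energy a b \<nu>" if "prob01 \<nu>" for \<nu> using le c_le[OF that] by (rule order_trans)
    show "energy a b \<mu> < \<infinity>" using le cfin by (rule le_less_trans)
  qed
qed

text \<open>A Bernoulli choice between the two measures, written as a monadic bind, provides the
  convex combination along which the energy is varied, together with its integral formula.\<close>

lemma prob01_mixture:
  assumes M: "prob01 \<mu>" and N: "prob01 \<nu>" and t: "0 \<le> t" "t \<le> 1"
  obtains m where "prob01 m" "\<And>f. f \<in> borel_measurable borel \<Longrightarrow>
    (\<integral>\<^sup>+x. f x \<partial>m) = ennreal (1 - t) * (\<integral>\<^sup>+x. f x \<partial>\<mu>) + ennreal t * (\<integral>\<^sup>+x. f x \<partial>\<nu>)"
proof -
  interpret M: prob01 \<mu> by (rule M)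
  interpret N: prob01 \<nu> by (rule N)
  let ?B = "restrict_space borel {0..1::real}"
  let ?K = "\<lambda>b. if b then \<nu> else \<mu>"
  define m where "m = measure_pmf (bernoulli_pmf t) \<bind> ?K"
  have "?K b \<in> space (subprob_algebra ?B)" for b
    by (cases b) (auto simp: space_subprob_algebra M.sets_eq N.sets_eq
      intro!: prob_space_imp_subprob_space M.prob_space_axioms N.prob_space_axioms)
  then have K: "?K \<in> measurable (measure_pmf (bernoulli_pmf t)) (subprob_algebra ?B)"
    unfolding measurable_pmf_measure1 by blast
  have int: "(\<integral>\<^sup>+x. f x \<partial>m) = ennreal (1 - t) * (\<integral>\<^sup>+x. f x \<partial>\<mu>) + ennreal t * (\<integral>\<^sup>+x. f x \<partial>\<nu>)"
    if "f \<in> borel_measurable ?B" for f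
    unfolding m_def nn_integral_bind[OF that K] using t by (subst nn_integral_bernoulli_pmf) (auto simp: mult.commute add.commute)
  have "sets (?K b) = sets ?B" for b by (cases b) (simp_all add: M.sets_eq N.sets_eq)
  then have s: "sets m = sets ?B" unfolding m_def by (rule sets_bind) simp
  then have sp: "space m = {0..1}" using sets_eq_imp_space_eq[OF s] by (simp add: space_restrict_space)
  have "emeasure m (space m) = (\<integral>\<^sup>+x. 1 \<partial>m)" by simp
  also have "\<dots> = ennreal (1 - t) + ennreal t" by (subst int) simp_all
  also have "\<dots> = 1" using t by (subst ennreal_plus[symmetric]) auto
  finally have "prob_space m" by (rule prob_spaceI)
  then have "prob01 m" using s by (simp add: prob01_def prob01_axioms_def)
  then show thesis by (rule that) (intro int measurable_restrict_space1)
qed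

text \<open>Along \<open>(1 - t) \<mu> + t \<nu>\<close> the energy is a quadratic polynomial in t,
  minimal on [0,1] at t = 0, so its derivative there is nonnegative. The finiteness assumptions make
  its coefficients real numbers.\<close>

lemma energy_variation:
  assumes M: "prob01 \<mu>" and min: "\<And>\<nu>. prob01 \<nu> \<Longrightarrow> energy a b \<mu> \<le> energy a b \<nu>" and fin: "energy a b \<mu> < \<infinity>"
    and N: "prob01 \<nu>" and finN: "energy a b \<nu> < \<infinity>" and finc: "log_en \<nu> \<mu> < \<infinity>"
  shows "2 * log_en \<mu> \<mu> + (\<integral>\<^sup>+x. ext_pot a b x \<partial>\<mu>) \<le> (\<integral>\<^sup>+x. eff_pot a b \<mu> x \<partial>\<nu>)"
proof -
  interpret M: prob01 \<mu> by (rule M)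
  interpret N: prob01 \<nu> by (rule N)
  obtain e where e: "log_en \<mu> \<mu> = ennreal e" "0 \<le> e" using fin unfolding energy_def by (cases "log_en \<mu> \<mu>") auto
  obtain v where v: "(\<integral>\<^sup>+x. ext_pot a b x \<partial>\<mu>) = ennreal v" "0 \<le> v" using fin unfolding energy_def by (cases "\<integral>\<^sup>+x. ext_pot a b x \<partial>\<mu>") auto
  obtain e' where e': "log_en \<nu> \<nu> = ennreal e'" "0 \<le> e'" using finN unfolding energy_def by (cases "log_en \<nu> \<nu>") auto
  obtain v' where v': "(\<integral>\<^sup>+x. ext_pot a b x \<partial>\<nu>) = ennreal v'" "0 \<le> v'" using finN unfolding energy_def by (cases "\<integral>\<^sup>+x. ext_pot a b x \<partial>\<nu>") auto
  obtain c where c: "log_en \<nu> \<mu> = ennreal c" "0 \<le> c" using finc by (cases "log_en \<nu> \<mu>") auto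
  have c': "log_en \<mu> \<nu> = ennreal c" using M.log_en_commute[OF N] c by simp
  have ineq: "e + v \<le> (1 - t) * ((1 - t) * e + t * c) + t * ((1 - t) * c + t * e') + (1 - t) * v + t * v'"
    if t: "0 \<le> t" "t \<le> 1" for t
  proof -
    obtain m where m: "prob01 m" and int: "\<And>f. f \<in> borel_measurable borel \<Longrightarrow>
      (\<integral>\<^sup>+x. f x \<partial>m) = ennreal (1 - t) * (\<integral>\<^sup>+x. f x \<partial>\<mu>) + ennreal t * (\<integral>\<^sup>+x. f x \<partial>\<nu>)"
      by (rule prob01_mixture[OF M N t]) blast
    have lp: "log_pot m x = ennreal (1 - t) * log_pot \<mu> x + ennreal t * log_pot \<nu> x" for x
      unfolding log_pot_def by (rule int) measurable
    have l1: "(\<integral>\<^sup>+x. log_pot m x \<partial>\<mu>) = ennreal (1 - t) * log_en \<mu> \<mu> + ennreal t * log_en \<mu> \<nu>"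
      unfolding lp log_en_def by (subst nn_integral_add) (auto simp: nn_integral_cmult M.borel_measurable_mu)
    have l2: "(\<integral>\<^sup>+x. log_pot m x \<partial>\<nu>) = ennreal (1 - t) * log_en \<nu> \<mu> + ennreal t * log_en \<nu> \<nu>"
      unfolding lp log_en_def by (subst nn_integral_add) (auto simp: nn_integral_cmult N.borel_measurable_mu)
    have "log_en m m = ennreal (1 - t) * (\<integral>\<^sup>+x. log_pot m x \<partial>\<mu>) + ennreal t * (\<integral>\<^sup>+x. log_pot m x \<partial>\<nu>)"
      unfolding log_en_def by (rule int) (rule prob01.log_pot_measurable[OF m])
    then have "energy a b m = ennreal (1 - t) * (ennreal (1 - t) * ennreal e + ennreal t * ennreal c)
        + ennreal t * (ennreal (1 - t) * ennreal c + ennreal t * ennreal e')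
        + (ennreal (1 - t) * ennreal v + ennreal t * ennreal v')"
      unfolding energy_def l1 l2 int[OF ext_pot_measurable] e v e' v' c c' by simp
    also have "\<dots> = ennreal ((1 - t) * ((1 - t) * e + t * c) + t * ((1 - t) * c + t * e') + ((1 - t) * v + t * v'))"
      using t e(2) v(2) e'(2) v'(2) c(2) by (simp add: ennreal_mult ennreal_plus)
    finally have "ennreal (e + v) \<le> ennreal ((1 - t) * ((1 - t) * e + t * c) + t * ((1 - t) * c + t * e') + ((1 - t) * v + t * v'))"
      using min[OF m] e v unfolding energy_def by (simp add: ennreal_plus)
    moreover have "0 \<le> (1 - t) * ((1 - t) * e + t * c) + t * ((1 - t) * c + t * e') + ((1 - t) * v + t * v')"
      using t e(2) v(2) e'(2) v'(2) c(2) by (intro add_nonneg_nonneg mult_nonneg_nonneg) auto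
    ultimately show ?thesis by (simp only: ennreal_le_iff add.assoc)
  qed
  have "2 * e + v \<le> 2 * c + v'"
  proof (rule ccontr)
    assume neg: "\<not> 2 * e + v \<le> 2 * c + v'"
    \<comment> \<open>Here - \<delta> is the derivative at t = 0, and k > 0 bounds the second-order
      coefficient. The choice of t keeps the second-order correction below \<delta> / 2, too small
      to compensate.\<close>
    define \<delta> where "\<delta> = 2 * e + v - 2 * c - v'"
    define k where "k = \<bar>e - 2 * c + e'\<bar> + 1"
    define t where "t = min 1 (\<delta> / (2 * k))"
    have pos: "\<delta> > 0" "k > 0" using neg by (auto simp: \<delta>_def k_def)
    have t: "0 < t" "t \<le> 1" using pos by (auto simp: t_def)
    have "t * \<delta> \<le> t * (t * (e - 2 * c + e'))"
      using ineq[of t] t by (simp add: \<delta>_def algebra_simps)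
    then have "\<delta> \<le> t * (e - 2 * c + e')" using t by simp
    also have "\<dots> \<le> t * k" using t by (intro mult_left_mono) (auto simp: k_def)
    also have "\<dots> \<le> \<delta> / (2 * k) * k" using pos by (intro mult_right_mono) (auto simp: t_def)
    also have "\<dots> = \<delta> / 2" using pos by simp
    finally show False using pos by simp
  qed
  moreover have "(\<integral>\<^sup>+x. eff_pot a b \<mu> x \<partial>\<nu>) = ennreal (v' + 2 * c)"
  proof -
    have "(\<integral>\<^sup>+x. eff_pot a b \<mu> x \<partial>\<nu>) = (\<integral>\<^sup>+x. ext_pot a b x \<partial>\<nu>) + 2 * (\<integral>\<^sup>+x. log_pot \<mu> x \<partial>\<nu>)"
      unfolding eff_pot_def by (subst nn_integral_add) (auto simp: nn_integral_cmult intro!: N.borel_measurable_mu)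
    then show ?thesis using c v' by (simp add: log_en_def ennreal_plus ennreal_mult)
  qed
  ultimately show ?thesis using e v c v' 
    by (simp add: ennreal_mult'[symmetric] ennreal_plus[symmetric] ennreal_leI del: ennreal_plus flip: ennreal_numeral)
qed

lemma eff_pot_measurable [measurable]: "prob01 \<mu> \<Longrightarrow> eff_pot a b \<mu> \<in> borel_measurable borel"
  unfolding eff_pot_def[abs_def] using prob01.log_pot_measurable[of \<mu>] by measurable

text \<open>The smearing constant 4 does not depend on the scale, so
  \<open>log_ker (x - y) + 4\<close> is a common majorant. Pointwise convergence could fail only at
  y = x, which has no mass when the potential at x is finite.\<close>

lemma eff_pot_unif_seg_lim:
  assumes M: "prob01 \<mu>" and fin: "eff_pot a b \<mu> x < \<infinity>" and x: "x \<in> {0..1}"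
    and r: "r \<longlonglongrightarrow> 0" "\<And>j. x + r j \<in> {0..1}"
  shows "(\<lambda>j. \<integral>\<^sup>+y. eff_pot a b \<mu> y \<partial>unif_seg x (r j)) \<longlonglongrightarrow> eff_pot a b \<mu> x"
proof -
  interpret M: prob01 \<mu> by (rule M)
  interpret L: prob01 unif01 by (rule prob01_unif01)
  interpret LM: pair_sigma_finite unif01 \<mu> ..
  \<comment> \<open>At z = 0 finiteness forces \<open>ennreal a = 0\<close>, and the term vanishes
    identically; this covers the endpoints of [0,1].\<close>
  have cm: "(\<lambda>j. ennreal a * (\<integral>\<^sup>+u. log_ker (z + s j * u) \<partial>unif01)) \<longlonglongrightarrow> ennreal a * log_ker z"
    if "ennreal a * log_ker z < \<infinity>" "s \<longlonglongrightarrow> 0" for z s a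
  proof (cases "a \<le> 0")
    case True then show ?thesis by (simp add: ennreal_neg)
  next
    case False
    then have "z \<noteq> 0" using that by (auto simp: log_ker_def ennreal_mult_top)
    then show ?thesis using that by (intro ennreal_tendsto_cmult log_ker_smear_lim) auto
  qed
  have fin1: "ennreal a * log_ker x < \<infinity>" "ennreal b * log_ker (1 - x) < \<infinity>" "log_pot \<mu> x < \<infinity>"
    using fin by (auto simp: eff_pot_def ext_pot_def ennreal_mult_less_top)
  have r': "(\<lambda>j. - r j) \<longlonglongrightarrow> 0" using tendsto_minus[OF r(1)] by simp
  have pright: "(\<lambda>j. \<integral>\<^sup>+y. (\<integral>\<^sup>+u. log_ker (x - y + r j * u) \<partial>unif01) \<partial>\<mu>) \<longlonglongrightarrow> (\<integral>\<^sup>+y. log_ker (x - y) \<partial>\<mu>)"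
  proof (rule nn_integral_dominated_convergence[where w="\<lambda>y. log_ker (x - y) + 4"])
    show "AE y in \<mu>. (\<integral>\<^sup>+u. log_ker (x - y + r j * u) \<partial>unif01) \<le> log_ker (x - y) + 4" for j
      by (intro AE_I2 log_ker_smear)
    show "(\<integral>\<^sup>+y. log_ker (x - y) + 4 \<partial>\<mu>) < \<infinity>"
      using fin1(3) by (subst nn_integral_add) (auto simp: log_pot_def)
    have "AE y in \<mu>. log_ker (x - y) \<noteq> \<infinity>"
      using fin1(3) by (intro nn_integral_PInf_AE) (auto simp: log_pot_def)
    then show "AE y in \<mu>. (\<lambda>j. \<integral>\<^sup>+u. log_ker (x - y + r j * u) \<partial>unif01) \<longlonglongrightarrow> log_ker (x - y)"
    proof eventually_elim
      case (elim y)
      then have "x - y \<noteq> 0" by (auto simp: log_ker_def)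
      then show ?case using r(1) by (rule log_ker_smear_lim)
    qed
  qed measurable
  have "(\<integral>\<^sup>+y. eff_pot a b \<mu> y \<partial>unif_seg x (r j)) = ennreal a * (\<integral>\<^sup>+u. log_ker (x + r j * u) \<partial>unif01)
     + ennreal b * (\<integral>\<^sup>+u. log_ker (1 - x + - r j * u) \<partial>unif01) + 2 * (\<integral>\<^sup>+y. (\<integral>\<^sup>+u. log_ker (x - y + r j * u) \<partial>unif01) \<partial>\<mu>)" for j
  proof -
    have "(\<integral>\<^sup>+y. eff_pot a b \<mu> y \<partial>unif_seg x (r j)) = (\<integral>\<^sup>+u. eff_pot a b \<mu> (x + r j * u) \<partial>unif01)"
      by (rule nn_integral_unif_seg[OF x r(2)]) (rule eff_pot_measurable[OF M])
    also have "\<dots> = ennreal a * (\<integral>\<^sup>+u. log_ker (x + r j * u) \<partial>unif01)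
     + ennreal b * (\<integral>\<^sup>+u. log_ker (1 - (x + r j * u)) \<partial>unif01) + 2 * (\<integral>\<^sup>+u. log_pot \<mu> (x + r j * u) \<partial>unif01)"
      unfolding eff_pot_def ext_pot_def
      by (subst nn_integral_add; (subst nn_integral_add)?) (auto simp: nn_integral_cmult)
    also have "(\<integral>\<^sup>+u. log_pot \<mu> (x + r j * u) \<partial>unif01) = (\<integral>\<^sup>+y. (\<integral>\<^sup>+u. log_ker (x + r j * u - y) \<partial>unif01) \<partial>\<mu>)"
      unfolding log_pot_def by (rule LM.Fubini'[symmetric]) measurable
    finally show ?thesis by (simp add: algebra_simps)
  qed
  then show ?thesis
    unfolding eff_pot_def ext_pot_def log_pot_def
    by (simp only:) (intro tendsto_add ennreal_tendsto_cmult cm[OF fin1(1) r(1)] cm[OF fin1(2) r'] pright; simp)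
qed

section \<open>The Euler--Lagrange inequality\<close>

text \<open>The first variation only gives an averaged inequality for measures of finite energy.
  Uniform laws on segments shrinking to x qualify, since their density is bounded, and their
  averages of \<open>eff_pot\<close> converge to the value at x itself.\<close>

lemma eff_pot_ge:
  assumes ab: "0 \<le> a" "0 \<le> b" and M: "prob01 \<mu>" and min: "\<And>\<nu>. prob01 \<nu> \<Longrightarrow> energy a b \<mu> \<le> energy a b \<nu>" and fin: "energy a b \<mu> < \<infinity>"
    and x: "x \<in> {0..1}"
  shows "2 * log_en \<mu> \<mu> + (\<integral>\<^sup>+x. ext_pot a b x \<partial>\<mu>) \<le> eff_pot a b \<mu> x"
proof (cases "eff_pot a b \<mu> x < \<infinity>")
  case True
  \<comment> \<open>The segment points from x towards the far end of [0,1]; its length is at most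
    1/2, so it stays inside.\<close>
  define \<sigma> :: real where "\<sigma> = (if x \<le> 1 / 2 then 1 else - 1)"
  define r where "r j = \<sigma> * cut_seq j" for j
  have dq2: "cut_seq j \<le> 1 / 2" for j by (simp add: cut_seq_def field_simps)
  have r0: "r \<longlonglongrightarrow> 0" unfolding r_def using tendsto_mult_right_zero[OF cut_seq_lim] by simp
  have xr: "x + r j \<in> {0..1}" "r j \<noteq> 0" for j
    using dq2[of j] cut_seq[of j] x by (auto simp: r_def \<sigma>_def)
  show ?thesis
  proof (rule LIMSEQ_le_const[OF eff_pot_unif_seg_lim[OF M True x r0 xr(1)]], intro exI[of _ 0] allI impI)
    fix j
    note N = prob01_unif_seg[OF x xr(1)[of j]]
    interpret N: prob01 "unif_seg x (r j)" by (rule N)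
    interpret M: prob01 \<mu> by (rule M)
    have lp: "log_pot (unif_seg x (r j)) y \<le> ennreal (2 / \<bar>r j\<bar>)" for y by (rule log_pot_unif_seg_le[OF x xr])
    have log_en_fin: "log_en \<nu> (unif_seg x (r j)) < \<infinity>" if "prob01 \<nu>" for \<nu>
    proof -
      have "log_en \<nu> (unif_seg x (r j)) \<le> (\<integral>\<^sup>+y. ennreal (2 / \<bar>r j\<bar>) \<partial>\<nu>)" unfolding log_en_def by (intro nn_integral_mono lp)
      also have "\<dots> < \<infinity>" by (simp only: prob01.nn_const[OF that]) simp
      finally show ?thesis .
    qed
    have "(\<integral>\<^sup>+y. log_ker (0 - y) \<partial>unif_seg x (r j)) < \<infinity>" "(\<integral>\<^sup>+y. log_ker (1 - y) \<partial>unif_seg x (r j)) < \<infinity>"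
      using lp[of 0] lp[of 1] unfolding log_pot_def by (auto simp: less_top[symmetric] top_unique)
    then have "(\<integral>\<^sup>+y. ext_pot a b y \<partial>unif_seg x (r j)) < \<infinity>"
      by (subst N.energy_eq_nn[OF ab]) (auto simp: ennreal_mult_less_top)
    then have "energy a b (unif_seg x (r j)) < \<infinity>" unfolding energy_def using log_en_fin[OF N] by simp
    moreover have "log_en (unif_seg x (r j)) \<mu> < \<infinity>" using log_en_fin[OF M] N.log_en_commute[OF M] by simp
    ultimately show "2 * log_en \<mu> \<mu> + (\<integral>\<^sup>+x. ext_pot a b x \<partial>\<mu>) \<le> (\<integral>\<^sup>+y. eff_pot a b \<mu> y \<partial>unif_seg x (r j))"
      by (intro energy_variation M min fin N)
  qed
qed (auto simp: top_unique less_top[symmetric])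

context
  fixes a b :: real and \<mu> :: "real measure"
  assumes ab: "0 \<le> a" "0 \<le> b" and M: "prob01 \<mu>"
begin

interpretation M: prob01 \<mu> by (rule M)

lemma cut_eff_mono: "0 < e \<Longrightarrow> e \<le> d \<Longrightarrow> d < 1 \<Longrightarrow> x \<in> {0..1} \<Longrightarrow> cut_eff d a b \<mu> x \<le> cut_eff e a b \<mu> x"
  unfolding cut_eff_def by (intro add_mono mult_left_mono cut_ext_mono M.cut_pot_mono ab) auto

lemma cut_eff_nonneg: "0 < d \<Longrightarrow> d < 1 \<Longrightarrow> x \<in> {0..1} \<Longrightarrow> 0 \<le> cut_eff d a b \<mu> x"
  unfolding cut_eff_def by (intro add_nonneg_nonneg mult_nonneg_nonneg cut_ext_nonneg M.cut_pot_nonneg ab) auto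

lemma cut_eff_isCont: "0 < d \<Longrightarrow> d < 1 \<Longrightarrow> isCont (cut_eff d a b \<mu>) x"
  unfolding cut_eff_def[abs_def] by (intro continuous_intros cut_ext_isCont M.cut_pot_isCont ab)

lemma cut_eff_le_eff_pot: "0 < d \<Longrightarrow> d < 1 \<Longrightarrow> x \<in> {0..1} \<Longrightarrow> ennreal (cut_eff d a b \<mu> x) \<le> eff_pot a b \<mu> x"
  unfolding cut_eff_def eff_pot_def
  by (intro order_trans[OF ennreal_add_le] add_mono cut_ext_le_ext_pot ab)
     (auto simp: ennreal_mult' intro!: mult_left_mono M.cut_pot_le_log_pot)

lemma SUP_cut_eff: "x \<in> {0..1} \<Longrightarrow> (SUP j. ennreal (cut_eff (cut_seq j) a b \<mu> x)) = eff_pot a b \<mu> x"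
proof -
  assume x: "x \<in> {0..1}"
  have i: "incseq (\<lambda>j. cut_ext (cut_seq j) a b x)" "incseq (\<lambda>j. 2 * cut_pot (cut_seq j) \<mu> x)"
    unfolding incseq_def by (intro allI impI cut_ext_mono mult_left_mono M.cut_pot_mono ab cut_seq cut_seq_antimono x; simp)+
  have n: "0 \<le> cut_ext (cut_seq j) a b x" "0 \<le> 2 * cut_pot (cut_seq j) \<mu> x" for j
    using cut_ext_nonneg[OF ab cut_seq x] M.cut_pot_nonneg[OF cut_seq x] by auto
  have s2: "(SUP j. ennreal (2 * cut_pot (cut_seq j) \<mu> x)) = 2 * log_pot \<mu> x"
    using SUP_ennreal_cmult[of 2 "\<lambda>j. cut_pot (cut_seq j) \<mu> x"] M.cut_pot_nonneg[OF cut_seq x] by (simp add: M.SUP_cut_pot[OF x])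
  show ?thesis unfolding cut_eff_def eff_pot_def
    by (subst SUP_ennreal_add[OF i n]) (simp only: SUP_cut_ext[OF ab x] s2)
qed

text \<open>Dini's argument for the increasing continuous approximations of a lower semicontinuous function.\<close>

lemma cut_eff_gt_compact:
  assumes F: "compact F" "F \<subseteq> {0..1}" and c: "\<And>x. x \<in> F \<Longrightarrow> ennreal c < eff_pot a b \<mu> x"
  obtains \<delta> where "0 < \<delta>" "\<delta> < 1" "\<And>d x. 0 < d \<Longrightarrow> d \<le> \<delta> \<Longrightarrow> x \<in> F \<Longrightarrow> c < cut_eff d a b \<mu> x"
proof -
  define A where "A j = F \<inter> cut_eff (cut_seq j) a b \<mu> -` {..c}" for j
  have co: "continuous_on UNIV (cut_eff (cut_seq j) a b \<mu>)" for j
    by (intro continuous_at_imp_continuous_on ballI cut_eff_isCont cut_seq)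
  have cA: "compact (A j)" for j
    unfolding A_def using F(1) by (intro compact_Int_closed continuous_closed_vimage[OF _ cut_eff_isCont] cut_seq) auto
  have "\<exists>j. A j = {}"
  proof (rule ccontr)
    assume "\<not> ?thesis"
    moreover have "A n \<subseteq> A m" if "m \<le> n" for m n
    proof
      fix x assume x: "x \<in> A n"
      then have "cut_eff (cut_seq m) a b \<mu> x \<le> cut_eff (cut_seq n) a b \<mu> x"
        using F(2) by (intro cut_eff_mono cut_seq cut_seq_antimono that) (auto simp: A_def)
      then show "x \<in> A m" using x by (simp add: A_def)
    qed
    ultimately have "\<Inter> (range A) \<noteq> {}" using cA by (intro compact_nest) auto
    then obtain x where x: "\<And>j. x \<in> A j" by auto
    then have "x \<in> F" "\<And>j. cut_eff (cut_seq j) a b \<mu> x \<le> c" by (auto simp: A_def)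
    then have "(SUP j. ennreal (cut_eff (cut_seq j) a b \<mu> x)) \<le> ennreal c" by (intro SUP_least ennreal_leI)
    moreover have "x \<in> {0..1}" using \<open>x \<in> F\<close> F(2) by auto
    ultimately show False using c[OF \<open>x \<in> F\<close>] by (simp add: SUP_cut_eff leD)
  qed
  then obtain j where j: "A j = {}" by auto
  show thesis
  proof (rule that[of "cut_seq j", OF cut_seq])
    fix d x assume "0 < d" "d \<le> cut_seq j" "x \<in> F"
    then have "c < cut_eff (cut_seq j) a b \<mu> x" using j by (auto simp: A_def not_le[symmetric])
    also have "\<dots> \<le> cut_eff d a b \<mu> x" using \<open>x \<in> F\<close> F(2) \<open>0 < d\<close> \<open>d \<le> cut_seq j\<close> cut_seq by (intro cut_eff_mono) auto
    finally show "c < cut_eff d a b \<mu> x" .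
  qed
qed

lemma eff_pot_lsc: assumes "x \<in> {0..1}" "c < eff_pot a b \<mu> x"
  shows "eventually (\<lambda>y. c < eff_pot a b \<mu> y) (at x within {0..1})"
proof -
  from assms obtain j where j: "c < ennreal (cut_eff (cut_seq j) a b \<mu> x)"
    unfolding SUP_cut_eff[OF assms(1), symmetric] less_SUP_iff by auto
  have c: "isCont (cut_eff (cut_seq j) a b \<mu>) x" by (rule cut_eff_isCont[OF cut_seq])
  have "((\<lambda>y. ennreal (cut_eff (cut_seq j) a b \<mu> y)) \<longlongrightarrow> ennreal (cut_eff (cut_seq j) a b \<mu> x)) (at x within {0..1})"
    by (rule tendsto_ennrealI[OF tendsto_within_subset[OF c[unfolded isCont_def] subset_UNIV]])
  from order_tendstoD(1)[OF this j]
  have "eventually (\<lambda>y. c < ennreal (cut_eff (cut_seq j) a b \<mu> y)) (at x within {0..1})" .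
  moreover have "eventually (\<lambda>y. y \<in> {0..1}) (at x within {0..1})" by (simp add: eventually_at_filter)
  ultimately show ?thesis
    by eventually_elim (use cut_eff_le_eff_pot[OF cut_seq] in \<open>blast intro: less_le_trans\<close>)
qed

end

locale equilibrium =
  fixes a b :: real and \<mu> :: "real measure"
  assumes ab: "0 \<le> a" "0 \<le> b" and M: "prob01 \<mu>"
    and minimal: "\<And>\<nu>. prob01 \<nu> \<Longrightarrow> energy a b \<mu> \<le> energy a b \<nu>" and finite_energy: "energy a b \<mu> < \<infinity>"
begin

sublocale M: prob01 \<mu> by (rule M)

definition "e0 = enn2real (log_en \<mu> \<mu>)"
definition "v0 = enn2real (\<integral>\<^sup>+x. ext_pot a b x \<partial>\<mu>)"
text \<open>J0 is the minimal energy. D0 is the Euler--Lagrange constant, the integral of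
  \<open>eff_pot a b \<mu>\<close> against \<mu>.\<close>

definition "J0 = e0 + v0"
definition "D0 = 2 * e0 + v0"

lemma e0: "log_en \<mu> \<mu> = ennreal e0" "0 \<le> e0" and v0: "(\<integral>\<^sup>+x. ext_pot a b x \<partial>\<mu>) = ennreal v0" "0 \<le> v0"
  using finite_energy unfolding e0_def v0_def energy_def by (auto simp: less_top)

lemma J0: "energy a b \<mu> = ennreal J0" "0 \<le> J0"
  unfolding J0_def energy_def using e0 v0 by simp_all

lemma D0_nonneg: "0 \<le> D0" using e0 v0 by (simp add: D0_def)

lemma D0_le_eff_pot: "x \<in> {0..1} \<Longrightarrow> ennreal D0 \<le> eff_pot a b \<mu> x"
  using eff_pot_ge[OF ab M minimal finite_energy, of x] e0 v0 
  by (simp add: D0_def ennreal_mult ennreal_plus)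

text \<open>
  Since \<open>en_dist d\<close> increases as \<open>d\<close> decreases, the energy distance may be taken at a fixed scale \<open>d\<close>
  while the truncation \<open>d'\<close> is refined.
\<close>

lemma cut_energy_ge:
  assumes d: "0 < d" "d < 1" and \<epsilon>: "0 < \<epsilon>"
  obtains d' where "0 < d'" "d' \<le> d" "\<And>\<nu>. prob01 \<nu> \<Longrightarrow> J0 - \<epsilon> + en_dist d \<nu> \<mu> \<le> cut_energy d' a b \<nu>"
proof -
  have "\<exists>\<delta>>0. \<forall>d x. 0 < d \<longrightarrow> d \<le> \<delta> \<longrightarrow> x \<in> {0..1} \<longrightarrow> D0 - \<epsilon> < cut_eff d a b \<mu> x"
  proof (cases "D0 - \<epsilon> < 0")
    \<comment> \<open>\<open>ennreal\<close> would replace a negative level by 0, so this case is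
      settled by the nonnegativity of \<open>cut_eff\<close>.\<close>
    case True
    then show ?thesis
      by (intro exI[of _ "1/2"]) (auto intro!: less_le_trans[OF True] cut_eff_nonneg[OF ab M])
  next
    case False
    have "ennreal (D0 - \<epsilon>) < eff_pot a b \<mu> x" if "x \<in> {0..1}" for x
    proof -
      have "ennreal (D0 - \<epsilon>) < ennreal D0" using \<epsilon> D0_nonneg False by (intro ennreal_lessI) auto
      also have "\<dots> \<le> eff_pot a b \<mu> x" by (rule D0_le_eff_pot[OF that])
      finally show ?thesis .
    qed
    from cut_eff_gt_compact[OF ab M _ order_refl this] show ?thesis by (metis compact_Icc)
  qed
  then obtain \<delta> where \<delta>: "\<delta> > 0" "\<And>d x. 0 < d \<Longrightarrow> d \<le> \<delta> \<Longrightarrow> x \<in> {0..1} \<Longrightarrow> D0 - \<epsilon> < cut_eff d a b \<mu> x" by blast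
  define d' where "d' = min d \<delta>"
  have d': "0 < d'" "d' \<le> d" "d' < 1" "d' \<le> \<delta>" using d \<delta> by (auto simp: d'_def)
  have en0: "cut_en d' \<mu> \<mu> \<le> e0"
    using M.cut_en_le_log_en[OF M d'(1,3)] e0 by (simp add: ennreal_le_iff)
  show thesis
  proof (rule that[OF d'(1,2)])
    fix \<nu> assume N: "prob01 \<nu>"
    interpret N: prob01 \<nu> by (rule N)
    have "D0 - \<epsilon> = (\<integral>x. D0 - \<epsilon> \<partial>\<nu>)" by (simp only: lebesgue_integral_const N.prob_space scaleR_one)
    also have "\<dots> \<le> (\<integral>x. cut_eff d' a b \<mu> x \<partial>\<nu>)" unfolding cut_eff_def
      using \<delta>(2)[OF d'(1,4)]
      by (intro integral_mono_AE AE_I2 Bochner_Integration.integrable_add integrable_mult_right N.integrable_cut_ext N.integrable_cut_pot ab M d')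
         (auto simp: cut_eff_def intro: less_imp_le)
    also have "\<dots> = (\<integral>x. cut_ext d' a b x \<partial>\<nu>) + 2 * cut_en d' \<nu> \<mu>"
      unfolding cut_eff_def cut_en_def
      by (subst Bochner_Integration.integral_add) (auto intro!: integrable_mult_right N.integrable_cut_ext N.integrable_cut_pot ab M d')
    finally have "D0 - \<epsilon> \<le> (\<integral>x. cut_ext d' a b x \<partial>\<nu>) + 2 * cut_en d' \<nu> \<mu>" .
    moreover have "en_dist d \<nu> \<mu> \<le> en_dist d' \<nu> \<mu>" by (intro en_dist_mono d' d N M)
    \<comment> \<open>Completing the square: the truncated energy of \<nu> equals
      \<open>en_dist d' \<nu> \<mu>\<close> plus the \<nu>-integral of \<open>cut_eff\<close>, minus
      \<open>cut_en d' \<mu> \<mu>\<close>. The last two are bounded by D0 - \<epsilon> and e0, and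
      D0 - e0 = J0.\<close>
    ultimately show "J0 - \<epsilon> + en_dist d \<nu> \<mu> \<le> cut_energy d' a b \<nu>"
      using en0 unfolding cut_energy_def en_dist_def[of d'] J0_def D0_def by linarith
  qed
qed

text \<open>The quantitative bound of \<open>cut_energy_ge\<close> makes the energy distance of a
  second minimizer at most every \<epsilon>, hence zero. The scale 1/2 is an arbitrary fixed
  choice.\<close>

lemma minimizer_unique:
  assumes N: "prob01 \<nu>" and le: "energy a b \<nu> \<le> energy a b \<mu>"
  shows "\<nu> = \<mu>"
proof -
  have d: "(0::real) < 1/2" "(1/2::real) < 1" by auto
  have "en_dist (1/2) \<nu> \<mu> \<le> 0 + \<epsilon>" if eps: "\<epsilon> > 0" for \<epsilon>
  proof -
    obtain d' where d': "0 < d'" "d' \<le> 1/2" and "\<And>\<nu>. prob01 \<nu> \<Longrightarrow> J0 - \<epsilon> + en_dist (1/2) \<nu> \<mu> \<le> cut_energy d' a b \<nu>"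
      by (rule cut_energy_ge[OF d eps]) blast
    then have J: "J0 - \<epsilon> + en_dist (1/2) \<nu> \<mu> \<le> cut_energy d' a b \<nu>" using N by blast
    have "ennreal (cut_energy d' a b \<nu>) \<le> energy a b \<nu>"
      using d' by (intro prob01.cut_energy_le_energy[OF N ab]) auto
    also have "\<dots> \<le> ennreal J0" using le unfolding J0(1) .
    finally have "ennreal (cut_energy d' a b \<nu>) \<le> ennreal J0" .
    then have "cut_energy d' a b \<nu> \<le> J0" using J0 by (simp add: ennreal_le_iff)
    then show ?thesis using J by simp
  qed
  then have "en_dist (1/2) \<nu> \<mu> \<le> 0" by (rule field_le_epsilon)
  then show ?thesis using en_dist_nonneg[OF d N M] by (intro en_dist_eq_0_imp_eq[OF d N M]) auto
qed

end

section \<open>Smearing\<close>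

lemma abs_perturb_le:
  fixes A B e W :: real
  assumes "\<bar>B\<bar> \<le> e * 1" "\<bar>A\<bar> = W" "e < W"
  shows "\<bar>W - e\<bar> \<le> \<bar>A + B\<bar>"
  using assms by linarith

text \<open>
  A majorant of \<open>log_ker\<close> smeared at scale \<open>e\<close> that is dominated by \<open>log_ker + 9\<close> and still converges to
  \<open>log_ker\<close>, so that one application of dominated convergence handles all smeared integrals.
\<close>

definition smear_bd :: "real \<Rightarrow> real \<Rightarrow> ennreal" where
  "smear_bd e w = min (log_ker w + 9) (if e < \<bar>w\<bar> * (1 - e) then log_ker (\<bar>w\<bar> * (1 - e) - e) else \<infinity>)"

lemma smear_bd_measurable [measurable]: "smear_bd e \<in> borel_measurable borel"
  unfolding smear_bd_def[abs_def] by measurable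

lemma smear_bd_le: "smear_bd e w \<le> log_ker w + 9" by (simp add: smear_bd_def)

lemma smear_bd_lim:
  assumes "w \<noteq> 0" and e: "e \<longlonglongrightarrow> 0"
  shows "(\<lambda>j. smear_bd (e j) w) \<longlonglongrightarrow> log_ker w"
proof -
  have l: "(\<lambda>j. \<bar>w\<bar> * (1 - e j) - e j) \<longlonglongrightarrow> \<bar>w\<bar> * (1 - 0) - 0" by (intro tendsto_intros e)
  then have l': "(\<lambda>j. \<bar>w\<bar> * (1 - e j) - e j) \<longlonglongrightarrow> \<bar>w\<bar>" by simp
  have ev: "eventually (\<lambda>j. e j < \<bar>w\<bar> * (1 - e j)) sequentially"
    using order_tendstoD(1)[OF l', of 0] assms(1) by (auto elim: eventually_mono)
  have "(\<lambda>j. log_ker (\<bar>w\<bar> * (1 - e j) - e j)) \<longlonglongrightarrow> log_ker \<bar>w\<bar>"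
    using assms(1) by (intro isCont_tendsto_compose[OF log_ker_continuous l']) auto
  also have "log_ker \<bar>w\<bar> = log_ker w" by (simp add: log_ker_def)
  finally have "(\<lambda>j. min (log_ker w + 9) (log_ker (\<bar>w\<bar> * (1 - e j) - e j))) \<longlonglongrightarrow> min (log_ker w + 9) (log_ker w)"
    by (intro tendsto_min tendsto_const)
  also have "min (log_ker w + 9) (log_ker w) = log_ker w" by (simp add: min_absorb2)
  finally show ?thesis
    by (rule Lim_transform_eventually) (use ev in \<open>eventually_elim, simp add: smear_bd_def\<close>)
qed

lemma nn_unif01_le_const: "(\<And>u. u \<in> {0..1} \<Longrightarrow> f u \<le> c) \<Longrightarrow> (\<integral>\<^sup>+u. f u \<partial>unif01) \<le> c"
proof -
  assume f: "\<And>u. u \<in> {0..1} \<Longrightarrow> f u \<le> c"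
  have "(\<integral>\<^sup>+u. f u \<partial>unif01) \<le> (\<integral>\<^sup>+u. c \<partial>unif01)" by (intro nn_integral_mono f) (simp add: space_restrict_space)
  then show ?thesis by (simp only: emeasure_unif01_UNIV)
qed

lemma log_ker_half_scale: "0 < e \<Longrightarrow> e \<le> 1 / 2 \<Longrightarrow> log_ker ((1 - e) * w) \<le> log_ker w + 1"
proof -
  assume e: "0 < e" "e \<le> 1 / 2"
  have "log_ker (1 - e) \<le> log_ker (1 / 2)" using e by (intro log_ker_antimono) auto
  also have "\<dots> \<le> 1" using ln_2_less_1 by (auto simp: log_ker_def ln_div)
  finally have "log_ker (1 - e) \<le> 1" .
  have "log_ker ((1 - e) * w) \<le> log_ker (1 - e) + log_ker w" by (rule log_ker_mult)
  also have "\<dots> \<le> 1 + log_ker w" using \<open>log_ker (1 - e) \<le> 1\<close> by (intro add_right_mono)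
  finally show ?thesis by (simp add: add.commute)
qed

context
  fixes e :: real assumes e: "0 < e" "e \<le> 1 / 2"
begin

lemma smear_bd_lower:
  assumes "X \<le> log_ker w + 9" "e < \<bar>w\<bar> * (1 - e) \<Longrightarrow> X \<le> log_ker (\<bar>w\<bar> * (1 - e) - e)"
  shows "X \<le> smear_bd e w"
  using assms by (auto simp: smear_bd_def)

text \<open>Each smearing costs 4 and the contraction by 1 - e \<ge> 1/2 costs at most ln 2 < 1,
  which explains the 9. Away from the singularity the argument moves by at most e, which gives the
  sharper second bound.\<close>

lemma smear2_le_smear_bd: "(\<integral>\<^sup>+u'. (\<integral>\<^sup>+u. log_ker ((1 - e) * w + e * u' - e * u) \<partial>unif01) \<partial>unif01) \<le> smear_bd e w"
proof (rule smear_bd_lower)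
  have "(\<integral>\<^sup>+u'. (\<integral>\<^sup>+u. log_ker ((1 - e) * w + e * u' - e * u) \<partial>unif01) \<partial>unif01) \<le> (\<integral>\<^sup>+u'. log_ker ((1 - e) * w + e * u') + 4 \<partial>unif01)"
    using log_ker_smear[of _ "- e"] by (intro nn_integral_mono) simp
  also have "\<dots> = (\<integral>\<^sup>+u'. log_ker ((1 - e) * w + e * u') \<partial>unif01) + 4"
    by (subst nn_integral_add) (simp_all only: emeasure_unif01_UNIV, measurable)
  also have "\<dots> \<le> (log_ker ((1 - e) * w) + 4) + 4" by (intro add_right_mono log_ker_smear)
  also have "\<dots> \<le> (log_ker w + 1 + 4) + 4" by (intro add_right_mono log_ker_half_scale e)
  finally show "(\<integral>\<^sup>+u'. (\<integral>\<^sup>+u. log_ker ((1 - e) * w + e * u' - e * u) \<partial>unif01) \<partial>unif01) \<le> log_ker w + 9"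
    by (simp add: add.assoc)
  assume w: "e < \<bar>w\<bar> * (1 - e)"
  show "(\<integral>\<^sup>+u'. (\<integral>\<^sup>+u. log_ker ((1 - e) * w + e * u' - e * u) \<partial>unif01) \<partial>unif01) \<le> log_ker (\<bar>w\<bar> * (1 - e) - e)"
  proof (intro nn_unif01_le_const log_ker_antimono)
    fix u u' :: real assume u: "u' \<in> {0..1}" "u \<in> {0..1}"
    have "\<bar>e * (u' - u)\<bar> \<le> e * 1" using e u unfolding abs_mult by (intro mult_mono) auto
    moreover have "\<bar>(1 - e) * w\<bar> = \<bar>w\<bar> * (1 - e)" using e by (simp add: abs_mult)
    moreover have "(1 - e) * w + e * u' - e * u = (1 - e) * w + e * (u' - u)" by (simp add: algebra_simps)
    ultimately show "\<bar>\<bar>w\<bar> * (1 - e) - e\<bar> \<le> \<bar>(1 - e) * w + e * u' - e * u\<bar>"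
      using abs_perturb_le[OF _ _ w] by metis
  qed
qed

lemma smear_le_smear_bd: "(\<integral>\<^sup>+u. log_ker ((1 - e) * w + e * u) \<partial>unif01) \<le> smear_bd e w"
proof (rule smear_bd_lower)
  have "(\<integral>\<^sup>+u. log_ker ((1 - e) * w + e * u) \<partial>unif01) \<le> log_ker ((1 - e) * w) + 4" by (rule log_ker_smear)
  also have "\<dots> \<le> (log_ker w + 1) + 4" by (intro add_right_mono log_ker_half_scale e)
  also have "\<dots> \<le> log_ker w + 9" by (simp add: add.assoc)
  finally show "(\<integral>\<^sup>+u. log_ker ((1 - e) * w + e * u) \<partial>unif01) \<le> log_ker w + 9" .
  assume w: "e < \<bar>w\<bar> * (1 - e)"
  show "(\<integral>\<^sup>+u. log_ker ((1 - e) * w + e * u) \<partial>unif01) \<le> log_ker (\<bar>w\<bar> * (1 - e) - e)"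
  proof (intro nn_unif01_le_const log_ker_antimono)
    fix u :: real assume u: "u \<in> {0..1}"
    have "\<bar>e * u\<bar> \<le> e * 1" using e u unfolding abs_mult by (intro mult_mono) auto
    moreover have "\<bar>(1 - e) * w\<bar> = \<bar>w\<bar> * (1 - e)" using e by (simp add: abs_mult)
    ultimately show "\<bar>\<bar>w\<bar> * (1 - e) - e\<bar> \<le> \<bar>(1 - e) * w + e * u\<bar>"
      by (rule abs_perturb_le[OF _ _ w])
  qed
qed

lemma smear_le_gs': "x \<in> {0..1} \<Longrightarrow> (\<integral>\<^sup>+u. log_ker (1 - ((1 - e) * x + e * u)) \<partial>unif01) \<le> smear_bd e (1 - x)"
proof (rule smear_bd_lower)
  assume x: "x \<in> {0..1}"
  \<comment> \<open>Written this way the unsmeared argument is at least 1 - x, so antitonicity of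
    the kernel replaces the scaling estimate.\<close>
  have eq: "1 - ((1 - e) * x + e * u) = ((1 - x) + e * x) + - e * u" for u by (simp add: algebra_simps)
  have "(\<integral>\<^sup>+u. log_ker (1 - ((1 - e) * x + e * u)) \<partial>unif01) \<le> log_ker ((1 - x) + e * x) + 4" unfolding eq by (rule log_ker_smear)
  also have "\<dots> \<le> log_ker (1 - x) + 9"
    using e x by (intro add_mono log_ker_antimono) auto
  finally show "(\<integral>\<^sup>+u. log_ker (1 - ((1 - e) * x + e * u)) \<partial>unif01) \<le> log_ker (1 - x) + 9" .
  assume w: "e < \<bar>1 - x\<bar> * (1 - e)"
  show "(\<integral>\<^sup>+u. log_ker (1 - ((1 - e) * x + e * u)) \<partial>unif01) \<le> log_ker (\<bar>1 - x\<bar> * (1 - e) - e)"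
  proof (intro nn_unif01_le_const log_ker_antimono)
    fix u :: real assume u: "u \<in> {0..1}"
    have "\<bar>e * (1 - u)\<bar> \<le> e * 1" using e u unfolding abs_mult by (intro mult_mono) auto
    moreover have "\<bar>(1 - e) * (1 - x)\<bar> = \<bar>1 - x\<bar> * (1 - e)" using e by (simp add: abs_mult)
    moreover have "1 - ((1 - e) * x + e * u) = (1 - e) * (1 - x) + e * (1 - u)" by (simp add: algebra_simps)
    ultimately show "\<bar>\<bar>1 - x\<bar> * (1 - e) - e\<bar> \<le> \<bar>1 - ((1 - e) * x + e * u)\<bar>"
      using abs_perturb_le[OF _ _ w] by metis
  qed
qed

end

text \<open>The law of (1 - e) X + e U with U uniform and independent of X. The contraction keeps it
  inside [0,1], and its density is at most 1 / e. Such a law is needed because Jensen's inequality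
  for Z compares a product measure with Lebesgue measure, and \<mu> itself is not known to have a
  bounded density.\<close>

definition smear :: "real \<Rightarrow> real measure \<Rightarrow> real measure" where
  "smear e \<mu> = distr (\<mu> \<Otimes>\<^sub>M unif01) (restrict_space borel {0..1}) (\<lambda>(x, u). (1 - e) * x + e * u)"

context
  fixes e :: real and \<mu> :: "real measure"
  assumes e: "0 < e" "e \<le> 1 / 2" and M: "prob01 \<mu>"
begin

interpretation M: prob01 \<mu> by (rule M)
interpretation L: prob01 unif01 by (rule prob01_unif01)
interpretation P: pair_prob_space \<mu> unif01 ..

lemma smear_aux: "x \<in> {0..1} \<Longrightarrow> (1 - e) * x \<in> {0..1} \<and> (1 - e) * x + e \<in> {0..1}"
proof -
  assume x: "x \<in> {0..1}"
  have "(1 - e) * x \<le> (1 - e) * 1" "0 \<le> (1 - e) * x"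
    by (intro mult_left_mono mult_nonneg_nonneg; use e x in simp)+
  moreover have "(1 - e) * 1 = 1 - e" by simp
  ultimately have "0 \<le> (1 - e) * x" "(1 - e) * x \<le> 1" "0 \<le> (1 - e) * x + e" "(1 - e) * x + e \<le> 1"
    using e by linarith+
  then show ?thesis by simp
qed

lemma
  shows prob01_smear: "prob01 (smear e \<mu>)"
    and nn_integral_smear: "f \<in> borel_measurable borel \<Longrightarrow>
      (\<integral>\<^sup>+y. f y \<partial>smear e \<mu>) = (\<integral>\<^sup>+x. (\<integral>\<^sup>+u. f ((1 - e) * x + e * u) \<partial>unif01) \<partial>\<mu>)"
proof -
  have 1: "(\<lambda>(x, u). (1 - e) * x + e * u) \<in> borel_measurable (\<mu> \<Otimes>\<^sub>M unif01)" by measurable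
  have 2: "(case p of (x, u) \<Rightarrow> (1 - e) * x + e * u) \<in> {0..1}" if p: "p \<in> space (\<mu> \<Otimes>\<^sub>M unif01)" for p
  proof -
    obtain x u where [simp]: "p = (x, u)" by (cases p)
    have u: "x \<in> {0..1}" "0 \<le> u" "u \<le> 1" using p by (auto simp: space_pair_measure space_restrict_space)
    have "e * u \<le> e * 1" "0 \<le> e * u" by (intro mult_left_mono mult_nonneg_nonneg; use e u in simp)+
    then have "(1 - e) * x + e * u \<in> {0..1}"
      using smear_aux[OF u(1)] unfolding atLeastAtMost_iff by (intro conjI) linarith+
    then show ?thesis by simp
  qed
  note * = prob01_distr[OF P.prob_space_axioms 1 2]
  show "prob01 (smear e \<mu>)" unfolding smear_def by (rule *(1))
  assume f: "f \<in> borel_measurable borel"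
  then have "(\<integral>\<^sup>+y. f y \<partial>smear e \<mu>) = (\<integral>\<^sup>+p. f (case p of (x, u) \<Rightarrow> (1 - e) * x + e * u) \<partial>(\<mu> \<Otimes>\<^sub>M unif01))"
    unfolding smear_def by (subst nn_integral_distr[OF *(2)]) (auto intro: measurable_restrict_space1)
  also have "\<dots> = (\<integral>\<^sup>+x. (\<integral>\<^sup>+u. f ((1 - e) * x + e * u) \<partial>unif01) \<partial>\<mu>)"
    by (subst L.nn_integral_fst[symmetric]) (use f 1 in \<open>auto intro: measurable_compose\<close>)
  finally show "(\<integral>\<^sup>+y. f y \<partial>smear e \<mu>) = (\<integral>\<^sup>+x. (\<integral>\<^sup>+u. f ((1 - e) * x + e * u) \<partial>unif01) \<partial>\<mu>)" .
qed

lemma smear_density_le: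
  assumes f: "f \<in> borel_measurable borel"
  shows "ennreal e * (\<integral>\<^sup>+y. f y \<partial>smear e \<mu>) \<le> (\<integral>\<^sup>+y. f y \<partial>unif01)"
proof -
  have "(\<integral>\<^sup>+y. f y \<partial>smear e \<mu>) \<le> (\<integral>\<^sup>+x. ennreal (1 / e) * (\<integral>\<^sup>+y. f y \<partial>unif01) \<partial>\<mu>)"
    unfolding nn_integral_smear[OF f]
  proof (rule nn_integral_mono)
    fix x assume "x \<in> space \<mu>"
    then have x: "(1 - e) * x \<in> {0..1}" "(1 - e) * x + e \<in> {0..1}" using smear_aux[of x] by auto
    show "(\<integral>\<^sup>+u. f ((1 - e) * x + e * u) \<partial>unif01) \<le> ennreal (1 / e) * (\<integral>\<^sup>+y. f y \<partial>unif01)"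
      using unif_seg_density_le[OF x _ f] e by (simp add: nn_integral_unif_seg[OF x f])
  qed
  also have "\<dots> = ennreal (1 / e) * (\<integral>\<^sup>+y. f y \<partial>unif01)" by (simp only: M.nn_const)
  finally have "ennreal e * (\<integral>\<^sup>+y. f y \<partial>smear e \<mu>) \<le> ennreal e * (ennreal (1 / e) * (\<integral>\<^sup>+y. f y \<partial>unif01))"
    by (rule mult_left_mono) simp
  also have "\<dots> = (\<integral>\<^sup>+y. f y \<partial>unif01)"
    using e by (simp add: mult.assoc[symmetric] ennreal_mult[symmetric])
  finally show ?thesis .
qed

lemma energy_smear_le:
  "energy a b (smear e \<mu>) \<le> (\<integral>\<^sup>+x. (\<integral>\<^sup>+y. smear_bd e (x - y) + (ennreal a * smear_bd e x + ennreal b * smear_bd e (1 - x)) \<partial>\<mu>) \<partial>\<mu>)"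
proof -
  interpret LM: pair_sigma_finite unif01 \<mu> ..
  interpret S: prob01 "smear e \<mu>" by (rule prob01_smear)
  have lp: "log_pot (smear e \<mu>) z = (\<integral>\<^sup>+y. (\<integral>\<^sup>+u. log_ker (z - ((1 - e) * y + e * u)) \<partial>unif01) \<partial>\<mu>)" for z
    unfolding log_pot_def by (rule nn_integral_smear) measurable
  have "log_en (smear e \<mu>) (smear e \<mu>)
    = (\<integral>\<^sup>+x. (\<integral>\<^sup>+u'. (\<integral>\<^sup>+y. (\<integral>\<^sup>+u. log_ker ((1 - e) * x + e * u' - ((1 - e) * y + e * u)) \<partial>unif01) \<partial>\<mu>) \<partial>unif01) \<partial>\<mu>)"
    unfolding log_en_def nn_integral_smear[OF S.log_pot_measurable] lp ..
  also have "\<dots> = (\<integral>\<^sup>+x. (\<integral>\<^sup>+y. (\<integral>\<^sup>+u'. (\<integral>\<^sup>+u. log_ker ((1 - e) * x + e * u' - ((1 - e) * y + e * u)) \<partial>unif01) \<partial>unif01) \<partial>\<mu>) \<partial>\<mu>)"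
    by (rule nn_integral_cong, rule LM.Fubini'[symmetric]) measurable
  also have "\<dots> = (\<integral>\<^sup>+x. (\<integral>\<^sup>+y. (\<integral>\<^sup>+u'. (\<integral>\<^sup>+u. log_ker ((1 - e) * (x - y) + e * u' - e * u) \<partial>unif01) \<partial>unif01) \<partial>\<mu>) \<partial>\<mu>)"
    by (simp add: algebra_simps)
  also have "\<dots> \<le> (\<integral>\<^sup>+x. (\<integral>\<^sup>+y. smear_bd e (x - y) \<partial>\<mu>) \<partial>\<mu>)"
    by (intro nn_integral_mono smear2_le_smear_bd e)
  finally have l: "log_en (smear e \<mu>) (smear e \<mu>) \<le> (\<integral>\<^sup>+x. (\<integral>\<^sup>+y. smear_bd e (x - y) \<partial>\<mu>) \<partial>\<mu>)" .
  have "(\<integral>\<^sup>+x. ext_pot a b x \<partial>smear e \<mu>) = (\<integral>\<^sup>+x. (\<integral>\<^sup>+u. ext_pot a b ((1 - e) * x + e * u) \<partial>unif01) \<partial>\<mu>)"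
    by (rule nn_integral_smear) measurable
  also have "\<dots> \<le> (\<integral>\<^sup>+x. ennreal a * smear_bd e x + ennreal b * smear_bd e (1 - x) \<partial>\<mu>)"
  proof (rule nn_integral_mono)
    fix x assume "x \<in> space \<mu>"
    then have x: "x \<in> {0..1}" by simp
    have "(\<integral>\<^sup>+u. ext_pot a b ((1 - e) * x + e * u) \<partial>unif01)
      = ennreal a * (\<integral>\<^sup>+u. log_ker ((1 - e) * x + e * u) \<partial>unif01) + ennreal b * (\<integral>\<^sup>+u. log_ker (1 - ((1 - e) * x + e * u)) \<partial>unif01)"
      unfolding ext_pot_def by (subst nn_integral_add) (auto simp: nn_integral_cmult)
    also have "\<dots> \<le> ennreal a * smear_bd e x + ennreal b * smear_bd e (1 - x)"
      by (intro add_mono mult_left_mono smear_le_smear_bd smear_le_gs' e x) auto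
    finally show "(\<integral>\<^sup>+u. ext_pot a b ((1 - e) * x + e * u) \<partial>unif01) \<le> ennreal a * smear_bd e x + ennreal b * smear_bd e (1 - x)" .
  qed
  finally have "energy a b (smear e \<mu>) \<le> (\<integral>\<^sup>+x. (\<integral>\<^sup>+y. smear_bd e (x - y) \<partial>\<mu>) \<partial>\<mu>) + (\<integral>\<^sup>+x. ennreal a * smear_bd e x + ennreal b * smear_bd e (1 - x) \<partial>\<mu>)"
    unfolding energy_def by (intro add_mono l)
  also have "\<dots> = (\<integral>\<^sup>+x. (\<integral>\<^sup>+y. smear_bd e (x - y) \<partial>\<mu>) + (ennreal a * smear_bd e x + ennreal b * smear_bd e (1 - x)) \<partial>\<mu>)"
    by (subst nn_integral_add) auto
  also have "\<dots> = (\<integral>\<^sup>+x. (\<integral>\<^sup>+y. smear_bd e (x - y) + (ennreal a * smear_bd e x + ennreal b * smear_bd e (1 - x)) \<partial>\<mu>) \<partial>\<mu>)"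
    by (intro nn_integral_cong, subst nn_integral_add) auto
  finally show ?thesis .
qed

end

text \<open>Finite energy is used twice: it makes the majorant with the added 9s integrable, and it
  makes the pairs at which a term of the integrand is infinite a null set, which is where pointwise
  convergence could fail.\<close>

lemma energy_smear_lim:
  assumes M: "prob01 \<mu>" and fin: "energy a b \<mu> < \<infinity>"
  shows "(\<lambda>j. \<integral>\<^sup>+x. (\<integral>\<^sup>+y. smear_bd (cut_seq j) (x - y) + (ennreal a * smear_bd (cut_seq j) x + ennreal b * smear_bd (cut_seq j) (1 - x)) \<partial>\<mu>) \<partial>\<mu>)
     \<longlonglongrightarrow> energy a b \<mu>"
proof -
  interpret M: prob01 \<mu> by (rule M)
  let ?F = "\<lambda>g (x, y). g (x - y) + (ennreal a * g x + ennreal b * g (1 - x))"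
  have it: "(\<integral>\<^sup>+p. ?F g p \<partial>(\<mu> \<Otimes>\<^sub>M \<mu>)) = (\<integral>\<^sup>+x. (\<integral>\<^sup>+y. g (x - y) + (ennreal a * g x + ennreal b * g (1 - x)) \<partial>\<mu>) \<partial>\<mu>)"
    if [measurable]: "g \<in> borel_measurable borel" for g
    by (subst M.nn_integral_fst[symmetric]) auto
  have J: "(\<integral>\<^sup>+p. ?F log_ker p \<partial>(\<mu> \<Otimes>\<^sub>M \<mu>)) = energy a b \<mu>"
    unfolding it[OF log_ker_measurable] energy_def log_en_def log_pot_def ext_pot_def
    by (subst nn_integral_add[symmetric]) (auto intro!: nn_integral_cong simp: nn_integral_add)
  interpret P: pair_prob_space \<mu> \<mu> ..
  have "(\<integral>\<^sup>+p. ?F log_ker p + (9 + (ennreal a * 9 + ennreal b * 9)) \<partial>(\<mu> \<Otimes>\<^sub>M \<mu>)) = energy a b \<mu> + (9 + (ennreal a * 9 + ennreal b * 9))"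
    by (subst nn_integral_add) (auto simp: J P.emeasure_space_1)
  then have wfin: "(\<integral>\<^sup>+p. ?F log_ker p + (9 + (ennreal a * 9 + ennreal b * 9)) \<partial>(\<mu> \<Otimes>\<^sub>M \<mu>)) < \<infinity>"
    using fin by (simp add: ennreal_mult_less_top ennreal_numeral_less_top)
  have "(\<lambda>j. \<integral>\<^sup>+p. ?F (smear_bd (cut_seq j)) p \<partial>(\<mu> \<Otimes>\<^sub>M \<mu>)) \<longlonglongrightarrow> (\<integral>\<^sup>+p. ?F log_ker p \<partial>(\<mu> \<Otimes>\<^sub>M \<mu>))"
  proof (rule nn_integral_dominated_convergence[OF _ _ _ _ wfin])
    show "AE p in \<mu> \<Otimes>\<^sub>M \<mu>. ?F (smear_bd (cut_seq j)) p \<le> ?F log_ker p + (9 + (ennreal a * 9 + ennreal b * 9))" for j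
    proof (intro AE_I2, clarify)
      fix x y
      have "smear_bd (cut_seq j) (x - y) + (ennreal a * smear_bd (cut_seq j) x + ennreal b * smear_bd (cut_seq j) (1 - x))
        \<le> (log_ker (x - y) + 9) + (ennreal a * (log_ker x + 9) + ennreal b * (log_ker (1 - x) + 9))"
        by (intro add_mono mult_left_mono smear_bd_le) auto
      then show "smear_bd (cut_seq j) (x - y) + (ennreal a * smear_bd (cut_seq j) x + ennreal b * smear_bd (cut_seq j) (1 - x))
        \<le> log_ker (x - y) + (ennreal a * log_ker x + ennreal b * log_ker (1 - x)) + (9 + (ennreal a * 9 + ennreal b * 9))"
        by (simp only: distrib_left add_ac)
    qed
    have "AE p in \<mu> \<Otimes>\<^sub>M \<mu>. ?F log_ker p \<noteq> \<infinity>"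
      using fin J by (intro nn_integral_PInf_AE) auto
    then show "AE p in \<mu> \<Otimes>\<^sub>M \<mu>. (\<lambda>j. ?F (smear_bd (cut_seq j)) p) \<longlonglongrightarrow> ?F log_ker p"
    proof eventually_elim
      case (elim p)
      obtain x y where p: "p = (x, y)" by (cases p)
      have xy: "x - y \<noteq> 0" using elim p by (auto simp: log_ker_def)
      have t: "(\<lambda>j. ennreal c * smear_bd (cut_seq j) z) \<longlonglongrightarrow> ennreal c * log_ker z" if "ennreal c * log_ker z \<noteq> \<infinity>" for c z
      proof (cases "c \<le> 0")
        case False
        then have "z \<noteq> 0" using that by (auto simp: log_ker_def ennreal_mult_top)
        then show ?thesis by (intro ennreal_tendsto_cmult smear_bd_lim cut_seq_lim) auto
      qed (simp add: ennreal_neg)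
      show ?case unfolding p using elim p
        by (auto intro!: tendsto_add t smear_bd_lim cut_seq_lim xy)
    qed
  qed measurable
  then show ?thesis by (simp only: it[OF smear_bd_measurable] J)
qed

section \<open>Configurations and their energy\<close>

definition exp_neg :: "ennreal \<Rightarrow> ennreal" where
  "exp_neg h = (if h = \<infinity> then 0 else ennreal (exp (- enn2real h)))"

lemma exp_neg_ennreal: "0 \<le> r \<Longrightarrow> exp_neg (ennreal r) = ennreal (exp (- r))"
  by (simp add: exp_neg_def)

lemma exp_neg_antimono: "g \<le> h \<Longrightarrow> exp_neg h \<le> exp_neg g"
  by (cases g; cases h) (auto simp: exp_neg_def intro!: ennreal_leI dest: order_trans simp: top_unique)

lemma exp_neg_le_1: "exp_neg h \<le> 1"
  by (cases h) (auto simp: exp_neg_def)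

lemma exp_neg_add: "exp_neg (g + h) = exp_neg g * exp_neg h"
  by (cases g; cases h) (auto simp: exp_neg_def exp_diff exp_minus divide_inverse ennreal_mult simp flip: ennreal_plus)

lemma exp_neg_le: "ennreal r \<le> h \<Longrightarrow> exp_neg h \<le> ennreal (exp (- r))"
proof (cases "0 \<le> r")
  case True
  assume "ennreal r \<le> h"
  from exp_neg_antimono[OF this] show ?thesis using True by (simp add: exp_neg_ennreal)
next
  case False
  have "exp_neg h \<le> ennreal 1" using exp_neg_le_1 by simp
  also have "\<dots> \<le> ennreal (exp (- r))" using False by (intro ennreal_leI) simp
  finally show ?thesis .
qed

lemma exp_neg_ge: "h \<le> ennreal r \<Longrightarrow> 0 \<le> r \<Longrightarrow> ennreal (exp (- r)) \<le> exp_neg h"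
  using exp_neg_antimono[of h "ennreal r"] by (simp add: exp_neg_ennreal)

lemma exp_neg_measurable [measurable]: "exp_neg \<in> borel_measurable borel"
  unfolding exp_neg_def[abs_def] by measurable

text \<open>Jensen's inequality for \<open>exp\<close>, via the tangent line \<open>exp (- h) \<ge> exp (- c) * (1 + c - h)\<close>.\<close>

lemma (in prob_space) exp_neg_jensen:
  assumes h [measurable]: "h \<in> borel_measurable M"
  shows "exp_neg (\<integral>\<^sup>+x. h x \<partial>M) \<le> (\<integral>\<^sup>+x. exp_neg (h x) \<partial>M)"
proof (cases "(\<integral>\<^sup>+x. h x \<partial>M) = \<infinity>")
  case False
  then obtain c where c: "(\<integral>\<^sup>+x. h x \<partial>M) = ennreal c" "0 \<le> c" by (cases "\<integral>\<^sup>+x. h x \<partial>M") auto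
  have pt: "ennreal (exp (- c) * (1 + c)) \<le> exp_neg y + ennreal (exp (- c)) * y" for y
  proof (cases y)
    case (real r)
    have "exp (- c) * (1 + (c - r)) \<le> exp (- c) * exp (c - r)" by (intro mult_left_mono) auto
    also have "\<dots> = exp (- r)" by (simp add: exp_add[symmetric])
    finally have "exp (- c) * (1 + c) \<le> exp (- r) + exp (- c) * r" by (simp add: algebra_simps)
    then show ?thesis using real by (simp add: exp_neg_ennreal ennreal_mult[symmetric] flip: ennreal_plus) 
  qed (simp add: ennreal_mult_top)
  have "ennreal (exp (- c) * (1 + c)) = (\<integral>\<^sup>+x. ennreal (exp (- c) * (1 + c)) \<partial>M)" by (simp add: emeasure_space_1)
  also have "\<dots> \<le> (\<integral>\<^sup>+x. exp_neg (h x) + ennreal (exp (- c)) * h x \<partial>M)" by (intro nn_integral_mono pt)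
  also have "\<dots> = (\<integral>\<^sup>+x. exp_neg (h x) \<partial>M) + ennreal (exp (- c) * c)"
    using c by (subst nn_integral_add) (auto simp: nn_integral_cmult ennreal_mult)
  finally have *: "ennreal (exp (- c) + exp (- c) * c) \<le> (\<integral>\<^sup>+x. exp_neg (h x) \<partial>M) + ennreal (exp (- c) * c)"
    by (simp add: algebra_simps)
  have "ennreal (exp (- c)) + ennreal (exp (- c) * c) \<le> (\<integral>\<^sup>+x. exp_neg (h x) \<partial>M) + ennreal (exp (- c) * c)"
    using * c(2) by (subst (asm) ennreal_plus) auto
  then have "ennreal (exp (- c)) \<le> (\<integral>\<^sup>+x. exp_neg (h x) \<partial>M)"
    by (subst (asm) (1 2) add.commute) (simp only: ennreal_add_left_cancel_le, simp)
  then show ?thesis using c by (simp add: exp_neg_ennreal)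
qed (simp add: exp_neg_def)

type_synonym config = "nat \<Rightarrow> real"

abbreviation cube :: "nat set \<Rightarrow> config measure" where
  "cube I \<equiv> \<Pi>\<^sub>M i\<in>I. unif01"

text \<open>Minus the logarithm of the Jacobi weight. Summing over ordered pairs absorbs the factor
  2 of the interaction. The particles carry labels from an arbitrary set, so that removing one of
  them is a set difference without relabelling.\<close>

definition hamilt :: "real \<Rightarrow> real \<Rightarrow> nat set \<Rightarrow> config \<Rightarrow> ennreal" where
  "hamilt k l I x = (\<Sum>i\<in>I. ext_pot k l (x i)) + (\<Sum>i\<in>I. \<Sum>j\<in>I - {i}. log_ker (x i - x j))"

definition part_fun :: "real \<Rightarrow> real \<Rightarrow> nat set \<Rightarrow> ennreal" where
  "part_fun k l I = (\<integral>\<^sup>+x. exp_neg (hamilt k l I x) \<partial>cube I)"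

definition empirical :: "nat set \<Rightarrow> config \<Rightarrow> real measure" where
  "empirical I x = distr (uniform_count_measure I) (restrict_space borel {0..1}) x"

interpretation L: prob01 unif01 by (rule prob01_unif01)
interpretation LP: product_sigma_finite "\<lambda>_. unif01" by unfold_locales

lemma prob_space_cube: "prob_space (cube I)"
  by (rule prob_space_PiM) (rule L.prob_space_axioms)

lemma comp_unif01_measurable [measurable]: "i \<in> I \<Longrightarrow> (\<lambda>x. x i) \<in> borel_measurable (cube I)"
  using measurable_compose[OF measurable_component_singleton[of i I "\<lambda>_. unif01"] L.id_measurable] .

lemma space_cubeD: "x \<in> space (cube I) \<Longrightarrow> i \<in> I \<Longrightarrow> x i \<in> {0..1}"
  by (auto simp: space_PiM space_restrict_space)

lemma hamilt_measurable [measurable]: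
  "(\<lambda>x. hamilt k l I x) \<in> borel_measurable (cube I)"
  unfolding hamilt_def by measurable

context
  fixes I :: "nat set" and x :: config
  assumes I: "finite I" "I \<noteq> {}" and x: "\<And>i. i \<in> I \<Longrightarrow> x i \<in> {0..1}"
begin

lemma
  shows prob01_empirical: "prob01 (empirical I x)"
    and x_measurable_empirical: "x \<in> measurable (uniform_count_measure I) (restrict_space borel {0..1})"
proof -
  have 1: "x \<in> borel_measurable (uniform_count_measure I)"
    by (simp add: measurable_def space_uniform_count_measure sets_uniform_count_measure)
  have 2: "x i \<in> {0..1}" if "i \<in> space (uniform_count_measure I)" for i
    using that x by (simp add: space_uniform_count_measure)
  note * = prob01_distr[OF prob_space_uniform_count_measure[OF I] 1 2]
  show "prob01 (empirical I x)" unfolding empirical_def by (rule *(1))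
  show "x \<in> measurable (uniform_count_measure I) (restrict_space borel {0..1})" by (rule *(2))
qed

lemma integral_empirical:
  assumes "f \<in> borel_measurable borel"
  shows "(\<integral>y. f y \<partial>empirical I x) = (\<Sum>i\<in>I. f (x i)) / real (card I)"
  unfolding empirical_def integral_distr[OF x_measurable_empirical measurable_restrict_space1[OF assms]]
  by (rule integral_uniform_count_measure[OF I(1)])

lemma cut_pot_empirical: "cut_pot d (empirical I x) y = (\<Sum>i\<in>I. cut_ker d (y - x i)) / real (card I)"
  unfolding cut_pot_def by (rule integral_empirical) measurable

lemma cut_en_empirical: "prob01 \<nu> \<Longrightarrow> cut_en d (empirical I x) \<nu> = (\<Sum>i\<in>I. cut_pot d \<nu> (x i)) / real (card I)"
  unfolding cut_en_def by (rule integral_empirical) (rule prob01.cut_pot_measurable)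

lemma cut_en_empirical_empirical: "cut_en d (empirical I x) (empirical I x) = (\<Sum>i\<in>I. \<Sum>j\<in>I. cut_ker d (x i - x j)) / (real (card I))\<^sup>2"
  by (simp add: cut_en_empirical[OF prob01_empirical] cut_pot_empirical sum_divide_distrib[symmetric] power2_eq_square)

text \<open>The only loss in comparing the energy of the configuration with that of its empirical measure
  is the diagonal \<open>i = j\<close>, where the truncated kernel equals \<open>- ln d\<close>.\<close>

lemma hamilt_ge:
  assumes d: "0 < d" "d < 1" and kl: "0 \<le> k" "0 \<le> l"
  defines "m \<equiv> real (card I)"
  shows "ennreal (m\<^sup>2 * cut_energy d (k / m) (l / m) (empirical I x) + m * ln d) \<le> hamilt k l I x"
proof -
  have m: "m > 0" using I by (simp add: m_def card_gt_0_iff)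
  have v: "m\<^sup>2 * (\<integral>y. cut_ext d (k / m) (l / m) y \<partial>empirical I x) = (\<Sum>i\<in>I. cut_ext d k l (x i))"
  proof -
    have "m * cut_ext d (k / m) (l / m) y = cut_ext d k l y" for y using m by (simp add: cut_ext_def algebra_simps)
    then have "m * (\<Sum>i\<in>I. cut_ext d (k / m) (l / m) (x i)) = (\<Sum>i\<in>I. cut_ext d k l (x i))"
      by (simp add: sum_distrib_left)
    then show ?thesis using m by (simp add: integral_empirical m_def[symmetric] power2_eq_square)
  qed
  have "(\<Sum>i\<in>I. \<Sum>j\<in>I. cut_ker d (x i - x j)) = (\<Sum>i\<in>I. cut_ker d 0 + (\<Sum>j\<in>I - {i}. cut_ker d (x i - x j)))"
  proof (intro sum.cong refl)
    fix i assume i: "i \<in> I"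
    show "(\<Sum>j\<in>I. cut_ker d (x i - x j)) = cut_ker d 0 + (\<Sum>j\<in>I - {i}. cut_ker d (x i - x j))"
      using sum.remove[OF I(1) i, of "\<lambda>j. cut_ker d (x i - x j)"] by simp
  qed
  also have "\<dots> = - m * ln d + (\<Sum>i\<in>I. \<Sum>j\<in>I - {i}. cut_ker d (x i - x j))"
    by (simp only: sum.distrib cut_ker_0[OF d]) (simp add: m_def)
  finally have "m\<^sup>2 * cut_energy d (k / m) (l / m) (empirical I x) + m * ln d
     = (\<Sum>i\<in>I. cut_ext d k l (x i)) + (\<Sum>i\<in>I. \<Sum>j\<in>I - {i}. cut_ker d (x i - x j))"
    unfolding cut_energy_def distrib_left v using m by (simp add: cut_en_empirical_empirical m_def[symmetric])
  also have "ennreal \<dots> = (\<Sum>i\<in>I. ennreal (cut_ext d k l (x i))) + (\<Sum>i\<in>I. \<Sum>j\<in>I - {i}. ennreal (cut_ker d (x i - x j)))"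
  proof -
    have c: "0 \<le> cut_ker d (x i - x j)" if "i \<in> I" "j \<in> I - {i}" for i j
      using x[of i] x[of j] that by (intro cut_ker_nonneg[OF d]) auto
    have vv: "0 \<le> cut_ext d k l (x i)" if "i \<in> I" for i using x[OF that] by (rule cut_ext_nonneg[OF kl d])
    have "(\<Sum>i\<in>I. \<Sum>j\<in>I - {i}. ennreal (cut_ker d (x i - x j))) = (\<Sum>i\<in>I. ennreal (\<Sum>j\<in>I - {i}. cut_ker d (x i - x j)))"
      by (intro sum.cong refl sum_ennreal c)
    also have "\<dots> = ennreal (\<Sum>i\<in>I. \<Sum>j\<in>I - {i}. cut_ker d (x i - x j))"
      by (intro sum_ennreal sum_nonneg c)
    finally have 1: "(\<Sum>i\<in>I. \<Sum>j\<in>I - {i}. ennreal (cut_ker d (x i - x j))) = ennreal (\<Sum>i\<in>I. \<Sum>j\<in>I - {i}. cut_ker d (x i - x j))" .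
    have 2: "(\<Sum>i\<in>I. ennreal (cut_ext d k l (x i))) = ennreal (\<Sum>i\<in>I. cut_ext d k l (x i))"
      by (intro sum_ennreal vv)
    show ?thesis unfolding 1 2 by (intro ennreal_plus sum_nonneg c vv)
  qed
  also have "\<dots> \<le> hamilt k l I x"
    unfolding hamilt_def
  proof (intro add_mono sum_mono)
    show "ennreal (cut_ext d k l (x i)) \<le> ext_pot k l (x i)" if "i \<in> I" for i using x[OF that] by (rule cut_ext_le_ext_pot[OF kl d])
    show "ennreal (cut_ker d (x i - x j)) \<le> log_ker (x i - x j)" if "i \<in> I" "j \<in> I - {i}" for i j
      using x[of i] x[of j] that by (intro cut_ker_le_log_ker[OF d]) auto
  qed
  finally show ?thesis .
qed

end

lemma en_dist_empirical_measurable: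
  assumes I: "finite I" "I \<noteq> {}" and M: "prob01 \<mu>"
  shows "(\<lambda>x. en_dist d (empirical I x) \<mu>) \<in> borel_measurable (cube I)"
proof -
  interpret M: prob01 \<mu> by (rule M)
  have "(\<lambda>x. (\<Sum>i\<in>I. \<Sum>j\<in>I. cut_ker d (x i - x j)) / (real (card I))\<^sup>2
      - 2 * ((\<Sum>i\<in>I. cut_pot d \<mu> (x i)) / real (card I)) + cut_en d \<mu> \<mu>) \<in> borel_measurable (cube I)"
    by measurable
  also have "?this \<longleftrightarrow> ?thesis"
    unfolding en_dist_def
  proof (rule measurable_cong)
    fix x assume "x \<in> space (cube I)"
    note x = space_cubeD[OF this]
    show "(\<Sum>i\<in>I. \<Sum>j\<in>I. cut_ker d (x i - x j)) / (real (card I))\<^sup>2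
      - 2 * ((\<Sum>i\<in>I. cut_pot d \<mu> (x i)) / real (card I)) + cut_en d \<mu> \<mu>
      = cut_en d (empirical I x) (empirical I x) - 2 * cut_en d (empirical I x) \<mu> + cut_en d \<mu> \<mu>"
      by (simp only: cut_en_empirical_empirical[OF I x] cut_en_empirical[OF I x M])
  qed
  finally show ?thesis .
qed

text \<open>The ratios k / m and l / m only converge to a and b. The truncated kernel is bounded by
  - ln d, so the price of replacing them is linear in the differences.\<close>

lemma cut_energy_perturb:
  assumes M: "prob01 \<nu>" and d: "0 < d" "d < 1"
  shows "cut_energy d a b \<nu> - (\<bar>a' - a\<bar> + \<bar>b' - b\<bar>) * (- ln d) \<le> cut_energy d a' b' \<nu>"
proof -
  interpret prob01 \<nu> by (rule M)
  have iv: "integrable \<nu> (cut_ext d a b)" for a b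
  proof (rule integrable_bdd[where B="\<bar>a\<bar> * (- ln d) + \<bar>b\<bar> * (- ln d)"])
    fix y
    have "\<bar>cut_ext d a b y\<bar> \<le> \<bar>a\<bar> * \<bar>cut_ker d y\<bar> + \<bar>b\<bar> * \<bar>cut_ker d (1 - y)\<bar>" unfolding cut_ext_def abs_mult[symmetric] by linarith
    also have "\<dots> \<le> \<bar>a\<bar> * (- ln d) + \<bar>b\<bar> * (- ln d)" by (intro add_mono mult_left_mono cut_ker_abs_le d) auto
    finally show "\<bar>cut_ext d a b y\<bar> \<le> \<bar>a\<bar> * (- ln d) + \<bar>b\<bar> * (- ln d)" .
  qed (intro borel_measurable_mu cut_ext_measurable)
  have "(\<integral>y. cut_ext d a b y - (\<bar>a' - a\<bar> + \<bar>b' - b\<bar>) * (- ln d) \<partial>\<nu>) \<le> (\<integral>y. cut_ext d a' b' y \<partial>\<nu>)"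
  proof (intro integral_mono_AE Bochner_Integration.integrable_diff iv AE_I2)
    fix y
    have "\<bar>(a' - a) * cut_ker d y\<bar> \<le> \<bar>a' - a\<bar> * (- ln d)" "\<bar>(b' - b) * cut_ker d (1 - y)\<bar> \<le> \<bar>b' - b\<bar> * (- ln d)"
      unfolding abs_mult by (intro mult_left_mono cut_ker_abs_le d; simp)+
    then show "cut_ext d a b y - (\<bar>a' - a\<bar> + \<bar>b' - b\<bar>) * (- ln d) \<le> cut_ext d a' b' y"
      unfolding cut_ext_def by (simp add: algebra_simps)
  qed simp
  also have "(\<integral>y. cut_ext d a b y - (\<bar>a' - a\<bar> + \<bar>b' - b\<bar>) * (- ln d) \<partial>\<nu>) = (\<integral>y. cut_ext d a b y \<partial>\<nu>) - (\<bar>a' - a\<bar> + \<bar>b' - b\<bar>) * (- ln d)"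
    by (subst Bochner_Integration.integral_diff[OF iv]) (auto simp: prob_space[simplified])
  finally show ?thesis unfolding cut_energy_def by linarith
qed

text \<open>The bound \<open>c \<nu> \<le> unif01\<close> is raised to the product measure by
  induction, integrating one coordinate at a time; each coordinate contributes a factor c.\<close>

lemma PiM_density_le:
  fixes I :: "nat set"
  assumes N: "prob01 \<nu>" and c: "0 \<le> c"
    and dens: "\<And>f. f \<in> borel_measurable borel \<Longrightarrow> ennreal c * (\<integral>\<^sup>+y. f y \<partial>\<nu>) \<le> (\<integral>\<^sup>+y. f y \<partial>unif01)"
    and I: "finite I"
  shows "f \<in> borel_measurable (cube I) \<Longrightarrow>
    ennreal (c ^ card I) * (\<integral>\<^sup>+x. f x \<partial>(\<Pi>\<^sub>M i\<in>I. \<nu>)) \<le> (\<integral>\<^sup>+x. f x \<partial>cube I)"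
  using I
proof (induction I arbitrary: f rule: finite_induct)
  case empty
  then show ?case by (simp add: PiM_empty)
next
  case (insert i I)
  interpret N: prob01 \<nu> by (rule N)
  interpret NP: product_sigma_finite "\<lambda>_. \<nu>" by unfold_locales
  have sN: "sets \<nu> = sets unif01" by (simp add: N.sets_eq L.sets_eq)
  have sP: "sets (\<Pi>\<^sub>M i\<in>J. \<nu>) = sets (cube J)" for J :: "nat set" by (intro sets_PiM_cong refl sN)
  note [measurable] = insert.prems
  have fN: "f \<in> borel_measurable (\<Pi>\<^sub>M i\<in>insert i I. \<nu>)"
    using insert.prems measurable_cong_sets[OF sP[of "insert i I"] refl[of "sets (borel :: ennreal measure)"]] by blast
  \<comment> \<open>The density hypothesis concerns functions on the line. Sections of f are
    measurable only on [0,1] and are extended by zero.\<close>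
  have dens': "ennreal c * (\<integral>\<^sup>+y. g y \<partial>\<nu>) \<le> (\<integral>\<^sup>+y. g y \<partial>unif01)" if g: "g \<in> borel_measurable unif01" for g
  proof -
    have "g \<in> borel_measurable (restrict_space borel {0..1})" using g by (simp add: measurable_cong_sets[OF L.sets_eq refl])
    then have "(\<lambda>y. g y * indicator {0..1} y) \<in> borel_measurable borel"
      by (subst (asm) borel_measurable_restrict_space_iff_ennreal) auto
    from dens[OF this] have "ennreal c * (\<integral>\<^sup>+y. g y * indicator {0..1} y \<partial>\<nu>) \<le> (\<integral>\<^sup>+y. g y * indicator {0..1} y \<partial>unif01)" .
    moreover have "(\<integral>\<^sup>+y. g y * indicator {0..1} y \<partial>\<nu>) = (\<integral>\<^sup>+y. g y \<partial>\<nu>)" "(\<integral>\<^sup>+y. g y * indicator {0..1} y \<partial>unif01) = (\<integral>\<^sup>+y. g y \<partial>unif01)"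
      by (intro nn_integral_cong; simp)+
    ultimately show ?thesis by simp
  qed
  have meas: "(\<lambda>y. f (x(i := y))) \<in> borel_measurable unif01" if "x \<in> space (cube I)" for x
    using measurable_compose[OF measurable_component_update[OF that insert.hyps(2)] insert.prems] .
  have F: "(\<lambda>x. \<integral>\<^sup>+y. f (x(i := y)) \<partial>unif01) \<in> borel_measurable (cube I)"
    by measurable
  have F': "(\<lambda>x. \<integral>\<^sup>+y. f (x(i := y)) \<partial>\<nu>) \<in> borel_measurable (\<Pi>\<^sub>M i\<in>I. \<nu>)"
  proof -
    note [measurable] = fN
    show ?thesis by measurable
  qed
  have spI: "space (\<Pi>\<^sub>M i\<in>I. \<nu>) = space (cube I)" by (rule sets_eq_imp_space_eq[OF sP])
  have "ennreal (c ^ card (insert i I)) * (\<integral>\<^sup>+x. f x \<partial>(\<Pi>\<^sub>M i\<in>insert i I. \<nu>))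
    = ennreal (c ^ card I) * (ennreal c * (\<integral>\<^sup>+x. (\<integral>\<^sup>+y. f (x(i := y)) \<partial>\<nu>) \<partial>(\<Pi>\<^sub>M i\<in>I. \<nu>)))"
    using insert.hyps c by (subst NP.product_nn_integral_insert[OF insert.hyps fN]) (simp add: ennreal_mult mult_ac)
  also have "ennreal c * (\<integral>\<^sup>+x. (\<integral>\<^sup>+y. f (x(i := y)) \<partial>\<nu>) \<partial>(\<Pi>\<^sub>M i\<in>I. \<nu>))
    = (\<integral>\<^sup>+x. ennreal c * (\<integral>\<^sup>+y. f (x(i := y)) \<partial>\<nu>) \<partial>(\<Pi>\<^sub>M i\<in>I. \<nu>))"
    by (rule nn_integral_cmult[OF F', symmetric])
  also have "\<dots> \<le> (\<integral>\<^sup>+x. (\<integral>\<^sup>+y. f (x(i := y)) \<partial>unif01) \<partial>(\<Pi>\<^sub>M i\<in>I. \<nu>))"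
    by (intro nn_integral_mono dens' meas) (simp add: spI)
  also have "ennreal (c ^ card I) * \<dots> \<le> (\<integral>\<^sup>+x. (\<integral>\<^sup>+y. f (x(i := y)) \<partial>unif01) \<partial>cube I)"
    by (rule insert.IH[OF F])
  also have "\<dots> = (\<integral>\<^sup>+x. f x \<partial>(cube (insert i I)))"
    by (rule LP.product_nn_integral_insert[OF insert.hyps insert.prems, symmetric])
  finally show ?case by (simp add: mult_left_mono)
qed

text \<open>Under independent coordinates every ordered pair contributes
  \<open>log_en \<nu> \<nu>\<close>. The number m (m - 1) of pairs is rounded up to m^2.\<close>

lemma nn_integral_hamilt_le:
  assumes N: "prob01 \<nu>" and I: "finite I"
  shows "(\<integral>\<^sup>+x. hamilt k l I x \<partial>(\<Pi>\<^sub>M i\<in>I. \<nu>)) \<le> of_nat (card I) * (\<integral>\<^sup>+y. ext_pot k l y \<partial>\<nu>) + of_nat (card I) * (of_nat (card I) * log_en \<nu> \<nu>)"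
proof -
  interpret N: prob01 \<nu> by (rule N)
  interpret NP: product_sigma_finite "\<lambda>_. \<nu>" by unfold_locales
  have cm [measurable]: "i \<in> J \<Longrightarrow> (\<lambda>x. x i) \<in> borel_measurable (\<Pi>\<^sub>M i\<in>J. \<nu>)" for i and J :: "nat set"
    using measurable_compose[OF measurable_component_singleton[of i J "\<lambda>_. \<nu>"] N.id_measurable] .
  have one: "(\<integral>\<^sup>+x. f (x i) \<partial>(\<Pi>\<^sub>M i\<in>J. \<nu>)) = (\<integral>\<^sup>+y. f y \<partial>\<nu>)"
    if "i \<in> J" "f \<in> borel_measurable borel" for i J f
  proof -
    have "(\<integral>\<^sup>+y. f y \<partial>\<nu>) = (\<integral>\<^sup>+y. f y \<partial>distr (\<Pi>\<^sub>M i\<in>J. \<nu>) \<nu> (\<lambda>x. x i))"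
      using distr_PiM_component[of J "\<lambda>_. \<nu>" i] that(1) N.prob_space_axioms by simp
    also have "\<dots> = (\<integral>\<^sup>+x. f (x i) \<partial>(\<Pi>\<^sub>M i\<in>J. \<nu>))"
      by (rule nn_integral_distr) (use that N.borel_measurable_mu in auto)
    finally show ?thesis by simp
  qed
  have two: "(\<integral>\<^sup>+x. log_ker (x i - x j) \<partial>(\<Pi>\<^sub>M i\<in>I. \<nu>)) = log_en \<nu> \<nu>" if ij: "i \<in> I" "j \<in> I - {i}" for i j
  proof -
    have I': "finite (I - {i})" "i \<notin> I - {i}" "insert i (I - {i}) = I" using I ij by auto
    have "(\<lambda>x. log_ker (x i - x j)) \<in> borel_measurable (\<Pi>\<^sub>M i\<in>insert i (I - {i}). \<nu>)"
      unfolding I'(3) using ij by (intro measurable_compose[OF _ log_ker_measurable] borel_measurable_diff cm) auto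
    from NP.product_nn_integral_insert[OF I'(1,2) this]
    have "(\<integral>\<^sup>+x. log_ker (x i - x j) \<partial>(\<Pi>\<^sub>M i\<in>I. \<nu>)) = (\<integral>\<^sup>+x. (\<integral>\<^sup>+y. log_ker (y - x j) \<partial>\<nu>) \<partial>(\<Pi>\<^sub>M i\<in>I - {i}. \<nu>))"
      unfolding I'(3) using ij by simp
    also have "\<dots> = (\<integral>\<^sup>+x. log_pot \<nu> (x j) \<partial>(\<Pi>\<^sub>M i\<in>I - {i}. \<nu>))"
      unfolding log_pot_def by (intro nn_integral_cong log_ker_commute)
    also have "\<dots> = log_en \<nu> \<nu>" unfolding log_en_def by (rule one[OF ij(2) N.log_pot_measurable])
    finally show ?thesis .
  qed
  have "(\<integral>\<^sup>+x. hamilt k l I x \<partial>(\<Pi>\<^sub>M i\<in>I. \<nu>))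
    = (\<Sum>i\<in>I. \<integral>\<^sup>+x. ext_pot k l (x i) \<partial>(\<Pi>\<^sub>M i\<in>I. \<nu>)) + (\<Sum>i\<in>I. \<Sum>j\<in>I - {i}. \<integral>\<^sup>+x. log_ker (x i - x j) \<partial>(\<Pi>\<^sub>M i\<in>I. \<nu>))"
  proof -
    have m1: "(\<lambda>x. ext_pot k l (x i)) \<in> borel_measurable (\<Pi>\<^sub>M i\<in>I. \<nu>)" if "i \<in> I" for i
      by (rule measurable_compose[OF cm[OF that] ext_pot_measurable])
    have m2: "(\<lambda>x. log_ker (x i - x j)) \<in> borel_measurable (\<Pi>\<^sub>M i\<in>I. \<nu>)" if "i \<in> I" "j \<in> I - {i}" for i j
      using that by (intro measurable_compose[OF _ log_ker_measurable] borel_measurable_diff cm) auto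
    have "(\<integral>\<^sup>+x. hamilt k l I x \<partial>(\<Pi>\<^sub>M i\<in>I. \<nu>)) = (\<integral>\<^sup>+x. (\<Sum>i\<in>I. ext_pot k l (x i)) \<partial>(\<Pi>\<^sub>M i\<in>I. \<nu>))
       + (\<integral>\<^sup>+x. (\<Sum>i\<in>I. \<Sum>j\<in>I - {i}. log_ker (x i - x j)) \<partial>(\<Pi>\<^sub>M i\<in>I. \<nu>))"
      unfolding hamilt_def by (intro nn_integral_add borel_measurable_sum m1 m2)
    also have "(\<integral>\<^sup>+x. (\<Sum>i\<in>I. ext_pot k l (x i)) \<partial>(\<Pi>\<^sub>M i\<in>I. \<nu>)) = (\<Sum>i\<in>I. \<integral>\<^sup>+x. ext_pot k l (x i) \<partial>(\<Pi>\<^sub>M i\<in>I. \<nu>))"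
      by (intro nn_integral_sum m1)
    also have "(\<integral>\<^sup>+x. (\<Sum>i\<in>I. \<Sum>j\<in>I - {i}. log_ker (x i - x j)) \<partial>(\<Pi>\<^sub>M i\<in>I. \<nu>))
       = (\<Sum>i\<in>I. \<integral>\<^sup>+x. (\<Sum>j\<in>I - {i}. log_ker (x i - x j)) \<partial>(\<Pi>\<^sub>M i\<in>I. \<nu>))"
      by (intro nn_integral_sum borel_measurable_sum m2)
    also have "\<dots> = (\<Sum>i\<in>I. \<Sum>j\<in>I - {i}. \<integral>\<^sup>+x. log_ker (x i - x j) \<partial>(\<Pi>\<^sub>M i\<in>I. \<nu>))"
      by (intro sum.cong refl nn_integral_sum m2)
    finally show ?thesis .
  qed
  also have "(\<Sum>i\<in>I. \<integral>\<^sup>+x. ext_pot k l (x i) \<partial>(\<Pi>\<^sub>M i\<in>I. \<nu>)) = of_nat (card I) * (\<integral>\<^sup>+y. ext_pot k l y \<partial>\<nu>)"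
    by (simp add: one)
  also have "(\<Sum>i\<in>I. \<Sum>j\<in>I - {i}. \<integral>\<^sup>+x. log_ker (x i - x j) \<partial>(\<Pi>\<^sub>M i\<in>I. \<nu>)) \<le> (\<Sum>i\<in>I. \<Sum>j\<in>I. log_en \<nu> \<nu>)"
  proof (rule sum_mono)
    fix i assume i: "i \<in> I"
    have "(\<Sum>j\<in>I - {i}. \<integral>\<^sup>+x. log_ker (x i - x j) \<partial>(\<Pi>\<^sub>M i\<in>I. \<nu>)) = (\<Sum>j\<in>I - {i}. log_en \<nu> \<nu>)"
      by (intro sum.cong refl two i)
    also have "\<dots> \<le> (\<Sum>j\<in>I. log_en \<nu> \<nu>)" by (intro sum_mono2 I) auto
    finally show "(\<Sum>j\<in>I - {i}. \<integral>\<^sup>+x. log_ker (x i - x j) \<partial>(\<Pi>\<^sub>M i\<in>I. \<nu>)) \<le> (\<Sum>j\<in>I. log_en \<nu> \<nu>)" .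
  qed
  finally show ?thesis by (simp add: add_left_mono)
qed

section \<open>Partition functions and concentration\<close>

type_synonym ensemble_params = "nat set \<times> real \<times> real"

abbreviation pnum :: "ensemble_params \<Rightarrow> real" where "pnum p \<equiv> real (card (fst p))"
abbreviation pleft :: "ensemble_params \<Rightarrow> real" where "pleft p \<equiv> fst (snd p)"
abbreviation pright :: "ensemble_params \<Rightarrow> real" where "pright p \<equiv> snd (snd p)"

text \<open>The regime of many particles, labelled by a finite set, with exponents \<open>k \<sim> a m\<close> and \<open>l \<sim> b m\<close>.\<close>

definition jacobi_regime :: "real \<Rightarrow> real \<Rightarrow> ensemble_params filter" where
  "jacobi_regime a b = inf (filtercomap pnum at_top) (inf (filtercomap (\<lambda>p. pleft p / pnum p) (nhds a))
     (inf (filtercomap (\<lambda>p. pright p / pnum p) (nhds b)) (principal {p. finite (fst p) \<and> 0 \<le> pleft p \<and> 0 \<le> pright p})))"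

lemma jacobi_regime_card: "filterlim pnum at_top (jacobi_regime a b)"
  unfolding jacobi_regime_def by (rule filterlim_mono[OF filterlim_filtercomap order_refl inf_le1])

lemma jacobi_regime_k: "((\<lambda>p. pleft p / pnum p) \<longlongrightarrow> a) (jacobi_regime a b)"
  unfolding jacobi_regime_def by (rule filterlim_mono[OF filterlim_filtercomap order_refl le_infI2[OF inf_le1]])

lemma jacobi_regime_l: "((\<lambda>p. pright p / pnum p) \<longlongrightarrow> b) (jacobi_regime a b)"
  unfolding jacobi_regime_def by (rule filterlim_mono[OF filterlim_filtercomap order_refl le_infI2[OF le_infI2[OF inf_le1]]])

lemma jacobi_regime_inv: "((\<lambda>p. c / pnum p) \<longlongrightarrow> 0) (jacobi_regime a b)"
  by (rule tendsto_divide_0[OF tendsto_const filterlim_at_top_imp_at_infinity[OF jacobi_regime_card]])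

lemma jacobi_regime_ok: "\<forall>\<^sub>F p in jacobi_regime a b. finite (fst p) \<and> fst p \<noteq> {} \<and> 0 \<le> pleft p \<and> 0 \<le> pright p \<and> 1 \<le> pnum p"
proof -
  have "\<forall>\<^sub>F p in jacobi_regime a b. p \<in> {p. finite (fst p) \<and> 0 \<le> pleft p \<and> 0 \<le> pright p}"
    unfolding jacobi_regime_def by (rule filter_leD[OF le_infI2[OF le_infI2[OF inf_le2]]]) (simp add: eventually_principal)
  moreover have "\<forall>\<^sub>F p in jacobi_regime a b. 1 \<le> pnum p"
    using jacobi_regime_card[of a b] unfolding filterlim_at_top by blast
  ultimately show ?thesis by eventually_elim auto
qed

lemma filterlim_jacobi_regime:
  assumes "filterlim (\<lambda>x. pnum (f x)) at_top F" "((\<lambda>x. pleft (f x) / pnum (f x)) \<longlongrightarrow> a) F"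
    "((\<lambda>x. pright (f x) / pnum (f x)) \<longlongrightarrow> b) F" "\<forall>\<^sub>F x in F. finite (fst (f x)) \<and> 0 \<le> pleft (f x) \<and> 0 \<le> pright (f x)"
  shows "filterlim f (jacobi_regime a b) F"
  unfolding jacobi_regime_def using assms
  by (simp add: filterlim_inf filterlim_filtercomap_iff filterlim_principal comp_def)

lemma log_ker_finite_of_density:
  assumes N: "prob01 \<nu>" and c: "0 < c"
    and dens: "\<And>f. f \<in> borel_measurable borel \<Longrightarrow> ennreal c * (\<integral>\<^sup>+y. f y \<partial>\<nu>) \<le> (\<integral>\<^sup>+y. f y \<partial>unif01)"
  shows "log_pot \<nu> z \<le> ennreal (2 / c)" "(\<integral>\<^sup>+y. log_ker y \<partial>\<nu>) < \<infinity>" "(\<integral>\<^sup>+y. log_ker (1 - y) \<partial>\<nu>) < \<infinity>"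
proof -
  have lp: "log_pot \<nu> z \<le> ennreal (2 / c)" for z
  proof -
    have "ennreal c * log_pot \<nu> z \<le> log_pot unif01 z" unfolding log_pot_def by (rule dens) measurable
    also have "\<dots> \<le> 2" using log_pot_unif_seg_le[of 0 1 z] by (simp add: unif_seg_0_1)
    finally have "ennreal (1 / c) * (ennreal c * log_pot \<nu> z) \<le> ennreal (1 / c) * 2" by (rule mult_left_mono) simp
    also have "ennreal (1 / c) * (ennreal c * log_pot \<nu> z) = log_pot \<nu> z"
      using c by (simp add: mult.assoc[symmetric] ennreal_mult[symmetric])
    also have "ennreal (1 / c) * 2 = ennreal (2 / c)" using c by (simp add: ennreal_mult''[symmetric] flip: ennreal_numeral)
    finally show ?thesis .
  qed
  then show "log_pot \<nu> z \<le> ennreal (2 / c)" .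
  show "(\<integral>\<^sup>+y. log_ker y \<partial>\<nu>) < \<infinity>" "(\<integral>\<^sup>+y. log_ker (1 - y) \<partial>\<nu>) < \<infinity>"
    using lp[of 0] lp[of 1] by (auto simp: log_pot_def less_top[symmetric] top_unique)
qed

text \<open>Pass from Lebesgue measure to the product of \<nu> at the price c^m, then apply Jensen's
  inequality: the average of exp(- H) is at least exp of minus the average of H.\<close>

lemma part_fun_ge_of_density:
  assumes N: "prob01 \<nu>" and c: "0 < c"
    and dens: "\<And>f. f \<in> borel_measurable borel \<Longrightarrow> ennreal c * (\<integral>\<^sup>+y. f y \<partial>\<nu>) \<le> (\<integral>\<^sup>+y. f y \<partial>unif01)"
    and A: "(\<integral>\<^sup>+y. log_ker y \<partial>\<nu>) = ennreal A" "0 \<le> A" and B: "(\<integral>\<^sup>+y. log_ker (1 - y) \<partial>\<nu>) = ennreal B" "0 \<le> B"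
    and E: "log_en \<nu> \<nu> = ennreal E" "0 \<le> E"
    and I: "finite I" and kl: "0 \<le> k" "0 \<le> l"
  defines "m \<equiv> real (card I)"
  shows "ennreal (exp (m * ln c - m * (k * A + l * B) - m * (m * E))) \<le> part_fun k l I"
proof -
  interpret N: prob01 \<nu> by (rule N)
  interpret P: prob_space "\<Pi>\<^sub>M i\<in>I. \<nu>" by (rule prob_space_PiM) (rule N.prob_space_axioms)
  have sP: "sets (\<Pi>\<^sub>M i\<in>I. \<nu>) = sets (cube I)"
    by (intro sets_PiM_cong refl) (simp add: N.sets_eq prob01.sets_eq[OF prob01_unif01])
  have hm: "hamilt k l I \<in> borel_measurable (cube I)" using hamilt_measurable[of k l I] by simp
  then have hN: "hamilt k l I \<in> borel_measurable (\<Pi>\<^sub>M i\<in>I. \<nu>)"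
    using measurable_cong_sets[OF sP refl[of "sets (borel :: ennreal measure)"]] by blast
  have v: "(\<integral>\<^sup>+y. ext_pot k l y \<partial>\<nu>) = ennreal (k * A + l * B)"
    unfolding N.energy_eq_nn[OF kl] A(1) B(1) using A(2) B(2) kl by (simp add: ennreal_mult ennreal_plus)
  have nn: "0 \<le> m * (k * A + l * B) + m * (m * E)" using A(2) B(2) E(2) kl by (simp add: m_def)
  have "(\<integral>\<^sup>+x. hamilt k l I x \<partial>(\<Pi>\<^sub>M i\<in>I. \<nu>)) \<le> of_nat (card I) * ennreal (k * A + l * B) + of_nat (card I) * (of_nat (card I) * ennreal E)"
    using nn_integral_hamilt_le[OF N I, of k l] unfolding v E(1) .
  also have "\<dots> = ennreal (m * (k * A + l * B) + m * (m * E))"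
    using A(2) B(2) E(2) kl by (simp add: m_def ennreal_mult ennreal_plus flip: ennreal_of_nat_eq_real_of_nat)
  finally have "ennreal (exp (- (m * (k * A + l * B) + m * (m * E)))) \<le> exp_neg (\<integral>\<^sup>+x. hamilt k l I x \<partial>(\<Pi>\<^sub>M i\<in>I. \<nu>))"
    using nn by (rule exp_neg_ge)
  also have "\<dots> \<le> (\<integral>\<^sup>+x. exp_neg (hamilt k l I x) \<partial>(\<Pi>\<^sub>M i\<in>I. \<nu>))" by (rule P.exp_neg_jensen[OF hN])
  finally have "ennreal (c ^ card I) * ennreal (exp (- (m * (k * A + l * B) + m * (m * E)))) \<le> ennreal (c ^ card I) * (\<integral>\<^sup>+x. exp_neg (hamilt k l I x) \<partial>(\<Pi>\<^sub>M i\<in>I. \<nu>))"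
    by (rule mult_left_mono) simp
  also have "\<dots> \<le> part_fun k l I" unfolding part_fun_def
    by (rule PiM_density_le[OF N less_imp_le[OF c] dens I]) (auto intro: measurable_compose[OF hm])
  also have "ennreal (c ^ card I) * ennreal (exp (- (m * (k * A + l * B) + m * (m * E)))) = ennreal (exp (m * ln c - m * (k * A + l * B) - m * (m * E)))"
  proof -
    have "c ^ card I = exp (m * ln c)" using c by (simp add: m_def exp_of_nat_mult)
    then show ?thesis by (simp add: ennreal_mult[symmetric] exp_add[symmetric] algebra_simps)
  qed
  finally show ?thesis .
qed

lemma part_fun_le_1: "part_fun k l I \<le> 1"
proof -
  interpret P: prob_space "cube I" by (rule prob_space_cube)
  have "part_fun k l I \<le> (\<integral>\<^sup>+x. 1 \<partial>cube I)" unfolding part_fun_def by (intro nn_integral_mono exp_neg_le_1)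
  then show ?thesis by (simp add: P.emeasure_space_1)
qed

context equilibrium begin

text \<open>Smearing the minimizer at a small scale costs little energy and produces a bounded
  density, as required by \<open>part_fun_ge_of_density\<close>.\<close>

lemma smear_approx:
  assumes "0 < \<epsilon>"
  obtains c \<nu> where "0 < c" "prob01 \<nu>" "energy a b \<nu> < ennreal (J0 + \<epsilon>)"
    "\<And>f. f \<in> borel_measurable borel \<Longrightarrow> ennreal c * (\<integral>\<^sup>+y. f y \<partial>\<nu>) \<le> (\<integral>\<^sup>+y. f y \<partial>unif01)"
proof -
  have "energy a b \<mu> < ennreal (J0 + \<epsilon>)" unfolding J0(1) using assms J0(2) by (intro ennreal_lessI) auto
  from order_tendstoD(2)[OF energy_smear_lim[OF M finite_energy] this]
  obtain j where j: "(\<integral>\<^sup>+x. (\<integral>\<^sup>+y. smear_bd (cut_seq j) (x - y) + (ennreal a * smear_bd (cut_seq j) x + ennreal b * smear_bd (cut_seq j) (1 - x)) \<partial>\<mu>) \<partial>\<mu>) < ennreal (J0 + \<epsilon>)"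
    by (auto simp: eventually_sequentially)
  have e: "0 < cut_seq j" "cut_seq j \<le> 1 / 2" by (auto simp: cut_seq_def field_simps)
  show thesis
  proof (rule that[OF e(1) prob01_smear[OF e M]])
    show "energy a b (smear (cut_seq j) \<mu>) < ennreal (J0 + \<epsilon>)" using energy_smear_le[OF e M] j by (rule le_less_trans)
  qed (rule smear_density_le[OF e M])
qed

text \<open>The price m ln c of changing the reference measure is of order m and vanishes after
  division by m^2, however small c is; so \<nu> may be chosen first, depending on \<epsilon>
  only.\<close>

lemma part_fun_lower:
  assumes "0 < \<epsilon>"
  shows "\<forall>\<^sub>F p in jacobi_regime a b. ennreal (exp (- ((pnum p)\<^sup>2 * (J0 + \<epsilon>)))) \<le> part_fun (pleft p) (pright p) (fst p)"
proof -
  obtain c \<nu> where c: "0 < c" and N: "prob01 \<nu>" and J: "energy a b \<nu> < ennreal (J0 + \<epsilon>)"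
    and dens: "\<And>f. f \<in> borel_measurable borel \<Longrightarrow> ennreal c * (\<integral>\<^sup>+y. f y \<partial>\<nu>) \<le> (\<integral>\<^sup>+y. f y \<partial>unif01)"
    by (rule smear_approx[OF assms]) blast
  note fin = log_ker_finite_of_density[OF N c dens]
  obtain A where A: "(\<integral>\<^sup>+y. log_ker y \<partial>\<nu>) = ennreal A" "0 \<le> A" using fin(2) by (cases "\<integral>\<^sup>+y. log_ker y \<partial>\<nu>") auto
  obtain B where B: "(\<integral>\<^sup>+y. log_ker (1 - y) \<partial>\<nu>) = ennreal B" "0 \<le> B" using fin(3) by (cases "\<integral>\<^sup>+y. log_ker (1 - y) \<partial>\<nu>") auto
  obtain E where E: "log_en \<nu> \<nu> = ennreal E" "0 \<le> E" using J unfolding energy_def by (cases "log_en \<nu> \<nu>") auto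
  have "energy a b \<nu> = ennreal (E + (a * A + b * B))"
    using A(2) B(2) E(2) ab unfolding energy_def prob01.energy_eq_nn[OF N ab] A(1) B(1) E(1)
    by (simp add: ennreal_mult ennreal_plus)
  then have "ennreal (E + (a * A + b * B)) < ennreal (J0 + \<epsilon>)" using J by (simp only:)
  then have lt: "a * A + b * B + E - 0 < J0 + \<epsilon>" using A(2) B(2) E(2) ab by (simp add: ennreal_less_iff del: ennreal_plus)
  have "((\<lambda>p. pleft p / pnum p * A + pright p / pnum p * B + E - ln c / pnum p) \<longlongrightarrow> a * A + b * B + E - 0) (jacobi_regime a b)"
    by (intro tendsto_intros jacobi_regime_k jacobi_regime_l jacobi_regime_inv)
  from order_tendstoD(2)[OF this lt] jacobi_regime_ok[of a b] show ?thesis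
  proof eventually_elim
    case (elim p)
    define m where "m = pnum p"
    have m: "1 \<le> m" using elim by (simp add: m_def)
    have "m\<^sup>2 * (pleft p / m * A + pright p / m * B + E - ln c / m) \<le> m\<^sup>2 * (J0 + \<epsilon>)"
      using elim unfolding m_def by (intro mult_left_mono) auto
    also have "m\<^sup>2 * (pleft p / m * A + pright p / m * B + E - ln c / m) = - (m * ln c - m * (pleft p * A + pright p * B) - m * (m * E))"
      using m by (simp add: field_simps power2_eq_square)
    finally have "ennreal (exp (- (m\<^sup>2 * (J0 + \<epsilon>)))) \<le> ennreal (exp (m * ln c - m * (pleft p * A + pright p * B) - m * (m * E)))"
      by (intro ennreal_leI) simp
    also have "\<dots> \<le> part_fun (pleft p) (pright p) (fst p)"
      unfolding m_def using elim by (intro part_fun_ge_of_density[OF N c dens A B E]) auto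
    finally show ?case by (simp add: m_def)
  qed
qed

definition param_err :: "real \<Rightarrow> ensemble_params \<Rightarrow> real" where
  "param_err d p = (\<bar>pleft p / pnum p - a\<bar> + \<bar>pright p / pnum p - b\<bar>) * (- ln d)"

lemma param_err_lim: "((\<lambda>p. param_err d p) \<longlongrightarrow> 0) (jacobi_regime a b)"
proof -
  have "((\<lambda>p. param_err d p) \<longlongrightarrow> (\<bar>a - a\<bar> + \<bar>b - b\<bar>) * (- ln d)) (jacobi_regime a b)"
    unfolding param_err_def by (intro tendsto_intros jacobi_regime_k jacobi_regime_l)
  then show ?thesis by simp
qed

text \<open>One pointwise estimate serves two purposes: F = 0 bounds the partition function, and F =
  \<open>en_dist\<close> gives concentration. The terms \<open>param_err d p\<close> and
  \<open>pnum p * ln d\<close> account for the perturbed exponents and the diagonal.\<close>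

lemma exp_neg_hamilt_le:
  assumes d: "0 < d" "d < 1"
    and J: "\<And>\<nu>. prob01 \<nu> \<Longrightarrow> J0 - \<epsilon> + F \<nu> \<le> cut_energy d a b \<nu>"
    and p: "finite (fst p)" "fst p \<noteq> {}" "0 \<le> pleft p" "0 \<le> pright p"
    and x: "x \<in> space (cube (fst p))"
  shows "exp_neg (hamilt (pleft p) (pright p) (fst p) x) \<le> ennreal (exp (- ((pnum p)\<^sup>2 * (J0 - \<epsilon> + F (empirical (fst p) x) - param_err d p) + pnum p * ln d)))"
proof (rule exp_neg_le)
  note x01 = space_cubeD[OF x]
  have E: "prob01 (empirical (fst p) x)" using p(1,2) x01 by (rule prob01_empirical)
  have "J0 - \<epsilon> + F (empirical (fst p) x) - param_err d p \<le> cut_energy d (pleft p / pnum p) (pright p / pnum p) (empirical (fst p) x)"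
    using J[OF E] cut_energy_perturb[OF E d, where a=a and b=b and a'="pleft p / pnum p" and b'="pright p / pnum p"] unfolding param_err_def by linarith
  then have "(pnum p)\<^sup>2 * (J0 - \<epsilon> + F (empirical (fst p) x) - param_err d p) + pnum p * ln d
     \<le> (pnum p)\<^sup>2 * cut_energy d (pleft p / pnum p) (pright p / pnum p) (empirical (fst p) x) + pnum p * ln d"
    by (intro add_right_mono mult_left_mono) auto
  then have "ennreal ((pnum p)\<^sup>2 * (J0 - \<epsilon> + F (empirical (fst p) x) - param_err d p) + pnum p * ln d)
     \<le> ennreal ((pnum p)\<^sup>2 * cut_energy d (pleft p / pnum p) (pright p / pnum p) (empirical (fst p) x) + pnum p * ln d)"
    by (rule ennreal_leI)
  also have "\<dots> \<le> hamilt (pleft p) (pright p) (fst p) x" by (rule hamilt_ge[OF p(1,2) x01 d p(3,4)])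
  finally show "ennreal ((pnum p)\<^sup>2 * (J0 - \<epsilon> + F (empirical (fst p) x) - param_err d p) + pnum p * ln d) \<le> hamilt (pleft p) (pright p) (fst p) x" .
qed

lemma nn_integral_cube_le: "(\<And>x. x \<in> space (cube I) \<Longrightarrow> f x \<le> c) \<Longrightarrow> (\<integral>\<^sup>+x. f x \<partial>cube I) \<le> c"
proof -
  assume f: "\<And>x. x \<in> space (cube I) \<Longrightarrow> f x \<le> c"
  interpret P: prob_space "cube I" by (rule prob_space_cube)
  have "(\<integral>\<^sup>+x. f x \<partial>cube I) \<le> (\<integral>\<^sup>+x. c \<partial>cube I)" by (intro nn_integral_mono f)
  also have "\<dots> = c" by (simp add: P.emeasure_space_1)
  finally show ?thesis .
qed

lemma part_fun_upper:
  assumes \<epsilon>: "0 < \<epsilon>"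
  shows "\<forall>\<^sub>F p in jacobi_regime a b. part_fun (pleft p) (pright p) (fst p) \<le> ennreal (exp (- ((pnum p)\<^sup>2 * (J0 - \<epsilon>))))"
proof -
  have h: "(0::real) < 1 / 2" "(1 / 2 :: real) < 1" "0 < \<epsilon> / 2" using \<epsilon> by auto
  obtain d where d: "0 < d" "d \<le> 1 / 2" and J: "\<And>\<nu>. prob01 \<nu> \<Longrightarrow> J0 - \<epsilon> / 2 + en_dist (1 / 2) \<nu> \<mu> \<le> cut_energy d a b \<nu>"
    by (rule cut_energy_ge[OF h]) blast
  have d1: "d < 1" using d by simp
  have J': "J0 - \<epsilon> / 2 + 0 \<le> cut_energy d a b \<nu>" if "prob01 \<nu>" for \<nu>
    using J[OF that] en_dist_nonneg[OF h(1,2) that M] by linarith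
  have "((\<lambda>p. \<epsilon> / 2 - param_err d p + ln d / pnum p) \<longlongrightarrow> \<epsilon> / 2 - 0 + 0) (jacobi_regime a b)"
    by (intro tendsto_intros param_err_lim jacobi_regime_inv)
  then have "\<forall>\<^sub>F p in jacobi_regime a b. 0 < \<epsilon> / 2 - param_err d p + ln d / pnum p"
    by (rule order_tendstoD(1)) (use \<epsilon> in simp)
  with jacobi_regime_ok[of a b] show ?thesis
  proof eventually_elim
    case (elim p)
    show ?case unfolding part_fun_def
    proof (rule nn_integral_cube_le)
      fix x assume x: "x \<in> space (cube (fst p))"
      have "0 \<le> (pnum p)\<^sup>2 * (\<epsilon> / 2 - param_err d p + ln d / pnum p)" using elim by (intro mult_nonneg_nonneg) auto
      also have "\<dots> = (pnum p)\<^sup>2 * (J0 - \<epsilon> / 2 + 0 - param_err d p) + pnum p * ln d - (pnum p)\<^sup>2 * (J0 - \<epsilon>)"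
        using elim by (simp add: field_simps power2_eq_square)
      finally have "ennreal (exp (- ((pnum p)\<^sup>2 * (J0 - \<epsilon> / 2 + 0 - param_err d p) + pnum p * ln d))) \<le> ennreal (exp (- ((pnum p)\<^sup>2 * (J0 - \<epsilon>))))"
        by (intro ennreal_leI) simp
      then show "exp_neg (hamilt (pleft p) (pright p) (fst p) x) \<le> ennreal (exp (- ((pnum p)\<^sup>2 * (J0 - \<epsilon>))))"
        using exp_neg_hamilt_le[OF d(1) d1 J', of p x] elim x by (meson order_trans)
    qed
  qed
qed

text \<open>Far configurations pay an excess of order m^2 over the minimal energy, while the lower
  bound for the partition function misses it by an arbitrarily small multiple of m^2. The net gain
  absorbs C m for every C.\<close>

lemma concentration:
  assumes d: "0 < d" "d < 1" and \<eta>: "0 < \<eta>"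
  shows "\<forall>\<^sub>F p in jacobi_regime a b. (\<integral>\<^sup>+x. exp_neg (hamilt (pleft p) (pright p) (fst p) x) * indicator {x. \<eta> < en_dist d (empirical (fst p) x) \<mu>} x \<partial>(cube (fst p)))
     \<le> ennreal (exp (- (C * pnum p))) * part_fun (pleft p) (pright p) (fst p)"
proof -
  have h: "0 < \<eta> / 4" using \<eta> by auto
  obtain d' where d': "0 < d'" "d' \<le> d" and J: "\<And>\<nu>. prob01 \<nu> \<Longrightarrow> J0 - \<eta> / 4 + en_dist d \<nu> \<mu> \<le> cut_energy d' a b \<nu>"
    by (rule cut_energy_ge[OF d h]) blast
  have d1: "d' < 1" using d d' by simp
  \<comment> \<open>The gain \<eta>, reduced by \<eta> / 4 in the energy bound and by \<eta> / 4 in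
    the lower bound for Z, leaves \<eta> / 2; all other terms vanish after division by m^2.\<close>
  have "((\<lambda>p. \<eta> / 2 - param_err d' p + (ln d' - C) / pnum p) \<longlongrightarrow> \<eta> / 2 - 0 + 0) (jacobi_regime a b)"
    by (intro tendsto_intros param_err_lim jacobi_regime_inv)
  then have "\<forall>\<^sub>F p in jacobi_regime a b. 0 < \<eta> / 2 - param_err d' p + (ln d' - C) / pnum p"
    by (rule order_tendstoD(1)) (use \<eta> in simp)
  with jacobi_regime_ok[of a b] part_fun_lower[OF h] show ?thesis
  proof eventually_elim
    case (elim p)
    let ?J = "(pnum p)\<^sup>2 * (J0 - \<eta> / 4 + \<eta> - param_err d' p) + pnum p * ln d'"
    have "(\<integral>\<^sup>+x. exp_neg (hamilt (pleft p) (pright p) (fst p) x) * indicator {x. \<eta> < en_dist d (empirical (fst p) x) \<mu>} x \<partial>(cube (fst p)))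
       \<le> ennreal (exp (- ?J))"
    proof (rule nn_integral_cube_le)
      fix x assume x: "x \<in> space (cube (fst p))"
      show "exp_neg (hamilt (pleft p) (pright p) (fst p) x) * indicator {x. \<eta> < en_dist d (empirical (fst p) x) \<mu>} x \<le> ennreal (exp (- ?J))"
      proof (cases "\<eta> < en_dist d (empirical (fst p) x) \<mu>")
        case True
        have "exp_neg (hamilt (pleft p) (pright p) (fst p) x) \<le> ennreal (exp (- ((pnum p)\<^sup>2 * (J0 - \<eta> / 4 + en_dist d (empirical (fst p) x) \<mu> - param_err d' p) + pnum p * ln d')))"
          using elim x by (intro exp_neg_hamilt_le[OF d'(1) d1 J]) auto
        also have "\<dots> \<le> ennreal (exp (- ?J))"
        proof -
          have "(pnum p)\<^sup>2 * (J0 - \<eta> / 4 + \<eta> - param_err d' p) \<le> (pnum p)\<^sup>2 * (J0 - \<eta> / 4 + en_dist d (empirical (fst p) x) \<mu> - param_err d' p)"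
            using True by (intro mult_left_mono) auto
          then show ?thesis by (intro ennreal_leI) simp
        qed
        finally show ?thesis using True by simp
      qed simp
    qed
    also have "\<dots> \<le> ennreal (exp (- (C * pnum p)) * exp (- ((pnum p)\<^sup>2 * (J0 + \<eta> / 4))))"
    proof (rule ennreal_leI)
      have "0 \<le> (pnum p)\<^sup>2 * (\<eta> / 2 - param_err d' p + (ln d' - C) / pnum p)" using elim by (intro mult_nonneg_nonneg) auto
      also have "\<dots> = ?J - C * pnum p - (pnum p)\<^sup>2 * (J0 + \<eta> / 4)"
        using elim by (simp add: field_simps power2_eq_square)
      finally show "exp (- ?J) \<le> exp (- (C * pnum p)) * exp (- ((pnum p)\<^sup>2 * (J0 + \<eta> / 4)))"
        by (simp add: exp_add[symmetric])
    qed
    also have "\<dots> = ennreal (exp (- (C * pnum p))) * ennreal (exp (- ((pnum p)\<^sup>2 * (J0 + \<eta> / 4))))"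
      by (rule ennreal_mult) auto
    also have "\<dots> \<le> ennreal (exp (- (C * pnum p))) * part_fun (pleft p) (pright p) (fst p)"
      using elim by (intro mult_left_mono) auto
    finally show ?case .
  qed
qed

end

section \<open>Inserting one particle\<close>

lemma diff_le_of_abs_le:
  fixes A :: real
  shows "\<bar>A\<bar> \<le> A' \<Longrightarrow> \<bar>B\<bar> \<le> B' \<Longrightarrow> V' = V + A + B \<Longrightarrow> K = A' + B' \<Longrightarrow> V - K \<le> V'"
  by linarith

definition insert_en :: "real \<Rightarrow> real \<Rightarrow> nat set \<Rightarrow> real \<Rightarrow> config \<Rightarrow> ennreal" where
  "insert_en k l I y x = ext_pot k l y + 2 * (\<Sum>j\<in>I. log_ker (y - x j))"

definition insert_wt :: "real \<Rightarrow> real \<Rightarrow> nat set \<Rightarrow> real \<Rightarrow> ennreal" where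
  "insert_wt k l I y = (\<integral>\<^sup>+x. exp_neg (insert_en k l I y x) * exp_neg (hamilt k l I x) \<partial>cube I)"

lemma hamilt_insert:
  assumes "finite I" "i \<notin> I"
  shows "hamilt k l (insert i I) (x(i := y)) = insert_en k l I y x + hamilt k l I x"
proof -
  have ne: "j \<noteq> i" if "j \<in> I" for j using that assms(2) by auto
  have "(\<Sum>j\<in>insert i I. ext_pot k l ((x(i := y)) j)) = ext_pot k l y + (\<Sum>j\<in>I. ext_pot k l (x j))"
    using assms by (simp add: ne cong: sum.cong)
  moreover have "(\<Sum>p\<in>insert i I. \<Sum>q\<in>insert i I - {p}. log_ker ((x(i := y)) p - (x(i := y)) q))
    = (\<Sum>q\<in>I. log_ker (y - x q)) + (\<Sum>p\<in>I. log_ker (x p - y) + (\<Sum>q\<in>I - {p}. log_ker (x p - x q)))"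
  proof -
    have "(\<Sum>q\<in>insert i I - {i}. log_ker ((x(i := y)) i - (x(i := y)) q)) = (\<Sum>q\<in>I. log_ker (y - x q))"
      using assms by (intro sum.cong) auto
    moreover have "(\<Sum>q\<in>insert i I - {p}. log_ker ((x(i := y)) p - (x(i := y)) q)) = log_ker (x p - y) + (\<Sum>q\<in>I - {p}. log_ker (x p - x q))"
      if p: "p \<in> I" for p
    proof -
      have "insert i I - {p} = insert i (I - {p})" using ne[OF p] by auto
      then have "(\<Sum>q\<in>insert i I - {p}. log_ker ((x(i := y)) p - (x(i := y)) q))
        = log_ker (x p - y) + (\<Sum>q\<in>I - {p}. log_ker ((x(i := y)) p - (x(i := y)) q))"
        using assms ne[OF p] by simp
      also have "(\<Sum>q\<in>I - {p}. log_ker ((x(i := y)) p - (x(i := y)) q)) = (\<Sum>q\<in>I - {p}. log_ker (x p - x q))"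
        using ne[OF p] ne by (intro sum.cong) auto
      finally show ?thesis .
    qed
    ultimately show ?thesis using assms by simp
  qed
  moreover have "(\<Sum>p\<in>I. log_ker (x p - y)) = (\<Sum>p\<in>I. log_ker (y - x p))" by (intro sum.cong refl log_ker_commute)
  ultimately show ?thesis unfolding hamilt_def insert_en_def by (simp add: sum.distrib mult_2 add_ac)
qed

lemma insert_en_measurable [measurable]:
  "(\<lambda>(y, x). insert_en k l I y x) \<in> borel_measurable (borel \<Otimes>\<^sub>M (cube I))"
  unfolding insert_en_def by measurable

lemma hamilt_measurable' [measurable]: "hamilt k l I \<in> borel_measurable (cube I)"
  using hamilt_measurable[of k l I] by simp

lemma insert_wt_measurable [measurable]: "insert_wt k l I \<in> borel_measurable borel"
proof -
  interpret P: prob_space "cube I" by (rule prob_space_cube)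
  show ?thesis unfolding insert_wt_def[abs_def] by measurable
qed

text \<open>Integrating out one particle expresses the intensity of the ensemble on \<open>insert i I\<close> through
  the ensemble on \<open>I\<close>, with the same \<open>k\<close> and \<open>l\<close>.\<close>

lemma one_particle:
  assumes I: "finite I" "i \<notin> I" and X: "X \<in> sets borel"
  shows "(\<integral>\<^sup>+x. exp_neg (hamilt k l (insert i I) x) * indicator X (x i) \<partial>(cube (insert i I)))
    = (\<integral>\<^sup>+y. insert_wt k l I y * indicator X y \<partial>unif01)"
proof -
  note [measurable] = X
  have "(\<lambda>x. x i) \<in> borel_measurable (cube (insert i I))" by (rule comp_unif01_measurable) simp
  then have [measurable]: "(\<lambda>x. indicator X (x i) :: ennreal) \<in> borel_measurable (cube (insert i I))"
    by (rule measurable_compose) simp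
  have m: "(\<lambda>x. exp_neg (hamilt k l (insert i I) x) * indicator X (x i)) \<in> borel_measurable (cube (insert i I))"
    by measurable
  have gm: "(\<lambda>x. exp_neg (insert_en k l I y x) * exp_neg (hamilt k l I x)) \<in> borel_measurable (cube I)" for y
    by measurable
  show ?thesis
    unfolding LP.product_nn_integral_insert_rev[OF I m] insert_wt_def
    by (intro nn_integral_cong) (simp add: hamilt_insert[OF I] exp_neg_add nn_integral_multc[OF gm])
qed

lemma part_fun_insert:
  assumes I: "finite I" "i \<notin> I"
  shows "part_fun k l (insert i I) = (\<integral>\<^sup>+y. insert_wt k l I y \<partial>unif01)"
  using one_particle[OF I, of UNIV k l] by (simp add: part_fun_def)

text \<open>The truncation error. It is cut off outside [-1,1], where \<open>cut_ker\<close> is not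
  a minorant of the kernel and where differences of points of [0,1] do not lie.\<close>

definition ker_rest :: "real \<Rightarrow> real \<Rightarrow> ennreal" where
  "ker_rest d w = (if \<bar>w\<bar> \<le> 1 then log_ker w - ennreal (cut_ker d w) else 0)"

lemma ker_rest_measurable [measurable]: "ker_rest d \<in> borel_measurable borel"
  unfolding ker_rest_def[abs_def] by measurable

lemma ker_rest_int_lim: "(\<lambda>j. \<integral>\<^sup>+w. ker_rest (cut_seq j) w \<partial>lborel) \<longlonglongrightarrow> 0"
proof -
  have "(\<lambda>j. \<integral>\<^sup>+w. ker_rest (cut_seq j) w \<partial>lborel) \<longlonglongrightarrow> (\<integral>\<^sup>+w. 0 \<partial>(lborel :: real measure))"
  proof (rule nn_integral_dominated_convergence[where w=log_ker and u="\<lambda>j w. ker_rest (cut_seq j) w" and u'="\<lambda>w. 0"])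
    show "AE w in lborel. ker_rest (cut_seq j) w \<le> log_ker w" for j
      by (intro AE_I2) (auto simp: ker_rest_def diff_le_self_ennreal)
    show "(\<integral>\<^sup>+w. log_ker w \<partial>lborel) < \<infinity>" by (simp add: nn_integral_log_ker)
    show "AE w in lborel. (\<lambda>j. ker_rest (cut_seq j) w) \<longlonglongrightarrow> 0"
      using AE_lborel_singleton[of 0]
    proof eventually_elim
      case (elim w)
      show ?case
      proof (cases "\<bar>w\<bar> \<le> 1")
        case True
        have nn: "0 \<le> - ln \<bar>w\<bar>" using True elim by simp
        have "(\<lambda>j. ennreal (cut_ker (cut_seq j) w)) \<longlonglongrightarrow> (SUP j. ennreal (cut_ker (cut_seq j) w))"
          using incseq_cut_ker[OF True] by (intro LIMSEQ_SUP) (auto simp: incseq_def intro!: ennreal_leI)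
        then have "(\<lambda>j. ennreal (cut_ker (cut_seq j) w)) \<longlonglongrightarrow> ennreal (- ln \<bar>w\<bar>)"
          using SUP_cut_ker[OF True] elim by (simp add: log_ker_def)
        then have "(\<lambda>j. cut_ker (cut_seq j) w) \<longlonglongrightarrow> - ln \<bar>w\<bar>"
          by (rule tendsto_ennrealD) (use nn cut_ker_nonneg[OF cut_seq True] in auto)
        then have "(\<lambda>j. - ln \<bar>w\<bar> - cut_ker (cut_seq j) w) \<longlonglongrightarrow> - ln \<bar>w\<bar> - - ln \<bar>w\<bar>" by (intro tendsto_intros)
        then have "(\<lambda>j. ennreal (- ln \<bar>w\<bar> - cut_ker (cut_seq j) w)) \<longlonglongrightarrow> ennreal 0" by (intro tendsto_ennrealI) simp
        moreover have "ker_rest (cut_seq j) w = ennreal (- ln \<bar>w\<bar> - cut_ker (cut_seq j) w)" for j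
          using True elim cut_ker_nonneg[OF cut_seq True] by (simp add: ker_rest_def log_ker_def ennreal_minus)
        ultimately show ?thesis by simp
      qed (simp add: ker_rest_def)
    qed
  qed auto
  then show ?thesis by simp
qed

text \<open>For a law of density at most 1 / c the truncation error of the potential is at most 1 /
  c times the Lebesgue integral of \<open>ker_rest\<close>, for all z at once. Uniformity matters
  because the potential will be evaluated at the uncontrolled positions of the other
  particles.\<close>

lemma log_pot_le_cut_pot_unif:
  assumes N: "prob01 \<nu>" and c: "0 < c"
    and dens: "\<And>f. f \<in> borel_measurable borel \<Longrightarrow> ennreal c * (\<integral>\<^sup>+y. f y \<partial>\<nu>) \<le> (\<integral>\<^sup>+y. f y \<partial>unif01)"
    and \<tau>: "0 < \<tau>"
  obtains d where "0 < d" "d < 1" "\<And>z. z \<in> {0..1} \<Longrightarrow> log_pot \<nu> z \<le> ennreal (cut_pot d \<nu> z + \<tau>)"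
proof -
  interpret N: prob01 \<nu> by (rule N)
  have "0 < ennreal (c * \<tau>)" using c \<tau> by simp
  from order_tendstoD(2)[OF ker_rest_int_lim this]
  obtain j where j: "(\<integral>\<^sup>+w. ker_rest (cut_seq j) w \<partial>lborel) < ennreal (c * \<tau>)" by (auto simp: eventually_sequentially)
  show thesis
  proof (rule that[OF cut_seq[of j]])
    fix z :: real assume z: "z \<in> {0..1}"
    have "ennreal c * (\<integral>\<^sup>+y. ker_rest (cut_seq j) (z - y) \<partial>\<nu>) \<le> (\<integral>\<^sup>+y. ker_rest (cut_seq j) (z - y) \<partial>unif01)"
      by (rule dens) measurable
    also have "\<dots> = (\<integral>\<^sup>+y. ker_rest (cut_seq j) (z + (-1) * y) \<partial>unif01)" by simp
    also have "\<dots> \<le> ennreal (1 / \<bar>-1\<bar>) * (\<integral>\<^sup>+w. ker_rest (cut_seq j) w \<partial>lborel)"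
      by (rule nn_integral_unif01_affine_le) auto
    also have "\<dots> \<le> ennreal (c * \<tau>)" using j by simp
    finally have "ennreal (1 / c) * (ennreal c * (\<integral>\<^sup>+y. ker_rest (cut_seq j) (z - y) \<partial>\<nu>)) \<le> ennreal (1 / c) * ennreal (c * \<tau>)"
      by (rule mult_left_mono) simp
    then have r: "(\<integral>\<^sup>+y. ker_rest (cut_seq j) (z - y) \<partial>\<nu>) \<le> ennreal \<tau>"
      using c \<tau> by (simp add: mult.assoc[symmetric] ennreal_mult[symmetric])
    have "log_pot \<nu> z \<le> (\<integral>\<^sup>+y. ennreal (cut_ker (cut_seq j) (z - y)) + ker_rest (cut_seq j) (z - y) \<partial>\<nu>)"
      unfolding log_pot_def
    proof (rule nn_integral_mono)
      fix y assume "y \<in> space \<nu>"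
      then have "\<bar>z - y\<bar> \<le> 1" using z by auto
      then show "log_ker (z - y) \<le> ennreal (cut_ker (cut_seq j) (z - y)) + ker_rest (cut_seq j) (z - y)"
        using cut_ker_le_log_ker[OF cut_seq, of "z - y" j] by (simp add: ker_rest_def add_diff_inverse_ennreal)
    qed
    also have "\<dots> = ennreal (cut_pot (cut_seq j) \<nu> z) + (\<integral>\<^sup>+y. ker_rest (cut_seq j) (z - y) \<partial>\<nu>)"
      unfolding N.cut_pot_ennreal[OF cut_seq z] by (rule nn_integral_add; intro N.borel_measurable_mu; measurable)
    also have "\<dots> \<le> ennreal (cut_pot (cut_seq j) \<nu> z) + ennreal \<tau>" by (intro add_left_mono r)
    also have "\<dots> = ennreal (cut_pot (cut_seq j) \<nu> z + \<tau>)"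
      using N.cut_pot_nonneg[OF cut_seq z] \<tau> by (subst ennreal_plus) auto
    finally show "log_pot \<nu> z \<le> ennreal (cut_pot (cut_seq j) \<nu> z + \<tau>)" .
  qed
qed

section \<open>Upper bound for the weight of an inserted particle\<close>

context equilibrium begin

text \<open>Truncation only lowers the insertion cost. If the empirical measure is close to \<mu> in
  energy distance, its truncated potential is uniformly close to that of \<mu>, which exceeds the
  level c on F. On the other configurations the insertion factor is bounded by 1 and concentration
  takes over.\<close>

lemma insert_wt_upper:
  assumes F: "closed F" "F \<subseteq> {0..1}" and c: "\<And>y. y \<in> F \<Longrightarrow> ennreal c < eff_pot a b \<mu> y"
  shows "\<forall>\<^sub>F p in jacobi_regime a b. \<forall>y\<in>F. insert_wt (pleft p) (pright p) (fst p) y \<le> ennreal (exp (- (c * pnum p))) * part_fun (pleft p) (pright p) (fst p)"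
proof (cases "F = {}")
  case False
  have cF: "compact F" using F by (metis compact_Icc compact_Int_closed inf.absorb_iff2)
  have "\<exists>d. 0 < d \<and> d < 1 \<and> (\<forall>y\<in>F. c < cut_eff d a b \<mu> y)"
  proof (rule cut_eff_gt_compact[OF ab M cF F(2)])
    show "ennreal c < eff_pot a b \<mu> y" if "y \<in> F" for y using that by (rule c)
    fix \<delta> assume "0 < \<delta>" "\<delta> < 1" "\<And>d y. 0 < d \<Longrightarrow> d \<le> \<delta> \<Longrightarrow> y \<in> F \<Longrightarrow> c < cut_eff d a b \<mu> y"
    then show ?thesis by (intro exI[of _ \<delta>]) simp
  qed
  then obtain d where d: "0 < d" "d < 1" and gt: "\<And>y. y \<in> F \<Longrightarrow> c < cut_eff d a b \<mu> y" by blast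
  have "continuous_on F (cut_eff d a b \<mu>)" by (intro continuous_at_imp_continuous_on ballI cut_eff_isCont[OF ab M d])
  from continuous_attains_inf[OF cF False this]
  obtain y0 where y0: "y0 \<in> F" "\<And>y. y \<in> F \<Longrightarrow> cut_eff d a b \<mu> y0 \<le> cut_eff d a b \<mu> y" by auto
  define \<tau> where "\<tau> = cut_eff d a b \<mu> y0 - c"
  have \<tau>: "0 < \<tau>" "\<And>y. y \<in> F \<Longrightarrow> c + \<tau> \<le> cut_eff d a b \<mu> y" using gt[OF y0(1)] y0(2) by (auto simp: \<tau>_def)
  have ld: "ln d < 0" using d by simp
  \<comment> \<open>Chosen so that Cauchy--Schwarz bounds the change of the potential by \<tau> / 8.
    Doubled, and added to the \<tau> / 4 allowed for the exponents, this spends half of the gap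
    \<tau>.\<close>
  define \<eta> where "\<eta> = (\<tau> / 8)\<^sup>2 / (- 2 * ln d)"
  have \<eta>: "0 < \<eta>" unfolding \<eta>_def using \<tau>(1) ld by (intro divide_pos_pos zero_less_power) auto
  have sq: "sqrt (- 2 * ln d * E) \<le> \<tau> / 8" if "E \<le> \<eta>" for E
  proof (rule real_le_lsqrt)
    have "- 2 * ln d * E \<le> - 2 * ln d * \<eta>" using that ld by (intro mult_left_mono) auto
    also have "\<dots> = (\<tau> / 8)\<^sup>2" using ld by (simp add: \<eta>_def)
    finally show "- 2 * ln d * E \<le> (\<tau> / 8)\<^sup>2" .
  qed (use \<tau>(1) in simp)
  have "\<forall>\<^sub>F p in jacobi_regime a b. param_err d p < \<tau> / 4" using \<tau>(1) by (intro order_tendstoD(2)[OF param_err_lim]) simp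
  \<comment> \<open>This many particles let the other half of the gap absorb the factor 2 that
    arises from adding good and bad configurations.\<close>
  moreover have "\<forall>\<^sub>F p in jacobi_regime a b. 2 * ln 2 / \<tau> \<le> pnum p" using jacobi_regime_card[of a b] unfolding filterlim_at_top by blast
  ultimately show ?thesis using jacobi_regime_ok[of a b] concentration[OF d \<eta>, of "c + \<tau> / 2"]
  proof eventually_elim
    case (elim p)
    obtain I k l where p: "p = (I, k, l)" by (cases p)
    define m where "m = real (card I)"
    have I: "finite I" "I \<noteq> {}" "0 \<le> k" "0 \<le> l" "1 \<le> m" using elim by (auto simp: p m_def)
    let ?e = "ennreal (exp (- ((c + \<tau> / 2) * m)))"
    define B where "B = {x. \<eta> < en_dist d (empirical I x) \<mu>}"
    have Bm: "(\<lambda>x. indicator B x :: ennreal) \<in> borel_measurable (cube I)"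
    proof -
      have "{x \<in> space (cube I). \<eta> < en_dist d (empirical I x) \<mu>} \<in> sets (cube I)"
        using en_dist_empirical_measurable[OF I(1,2) M] by measurable
      then show ?thesis by (subst borel_measurable_indicator_iff) (simp add: B_def Int_def conj_commute)
    qed
    show ?case
    proof
      fix y assume y: "y \<in> F"
      then have y01: "y \<in> {0..1}" using F(2) by auto
      have good: "exp_neg (insert_en k l I y x) \<le> ?e + indicator B x" if x: "x \<in> space (cube I)" for x
      proof (cases "x \<in> B")
        case True then show ?thesis using exp_neg_le_1[of "insert_en k l I y x"] by (simp add: add_increasing)
      next
        case False
        note x01 = space_cubeD[OF x]
        have E: "prob01 (empirical I x)" using I(1,2) x01 by (rule prob01_empirical)
        have "\<bar>cut_pot d (empirical I x) y - cut_pot d \<mu> y\<bar> \<le> \<tau> / 8"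
          using cut_pot_diff_le[OF d E M, of y] sq[of "en_dist d (empirical I x) \<mu>"] False by (auto simp: B_def)
        then have pt: "cut_pot d \<mu> y - \<tau> / 8 \<le> cut_pot d (empirical I x) y" by linarith
        have vv: "cut_ext d a b y - param_err d p \<le> cut_ext d (k / m) (l / m) y"
        proof -
          have "\<bar>(k / m - a) * cut_ker d y\<bar> \<le> \<bar>k / m - a\<bar> * (- ln d)" "\<bar>(l / m - b) * cut_ker d (1 - y)\<bar> \<le> \<bar>l / m - b\<bar> * (- ln d)"
            unfolding abs_mult by (intro mult_left_mono cut_ker_abs_le d; simp)+
          moreover have "cut_ext d (k / m) (l / m) y = cut_ext d a b y + (k / m - a) * cut_ker d y + (l / m - b) * cut_ker d (1 - y)"
            by (simp add: cut_ext_def left_diff_distrib)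
          moreover have "param_err d p = \<bar>k / m - a\<bar> * (- ln d) + \<bar>l / m - b\<bar> * (- ln d)"
            unfolding param_err_def p m_def fst_conv snd_conv by (rule distrib_right)
          ultimately show ?thesis by (rule diff_le_of_abs_le)
        qed
        have "c + \<tau> / 2 \<le> cut_ext d (k / m) (l / m) y + 2 * cut_pot d (empirical I x) y"
          using \<tau>(2)[OF y] pt vv elim(1) unfolding cut_eff_def by linarith
        then have "(c + \<tau> / 2) * m \<le> (cut_ext d (k / m) (l / m) y + 2 * cut_pot d (empirical I x) y) * m"
          using I(5) by (intro mult_right_mono) auto
        also have "\<dots> = cut_ext d k l y + 2 * (\<Sum>j\<in>I. cut_ker d (y - x j))"
        proof -
          have "cut_pot d (empirical I x) y = (\<Sum>j\<in>I. cut_ker d (y - x j)) / m"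
            unfolding m_def using I(1,2) x01 by (rule cut_pot_empirical)
          moreover have "cut_ext d (k / m) (l / m) y * m = cut_ext d k l y" using I(5) by (simp add: cut_ext_def field_simps)
          ultimately show ?thesis using I(5) by (simp add: distrib_right)
        qed
        finally have "ennreal ((c + \<tau> / 2) * m) \<le> ennreal (cut_ext d k l y + 2 * (\<Sum>j\<in>I. cut_ker d (y - x j)))"
          by (rule ennreal_leI)
        also have "\<dots> \<le> ennreal (cut_ext d k l y) + ennreal (2 * (\<Sum>j\<in>I. cut_ker d (y - x j)))" by (rule ennreal_add_le)
        also have "ennreal (2 * (\<Sum>j\<in>I. cut_ker d (y - x j))) = 2 * ennreal (\<Sum>j\<in>I. cut_ker d (y - x j))"
          by (subst ennreal_mult') auto
        also have "ennreal (\<Sum>j\<in>I. cut_ker d (y - x j)) = (\<Sum>j\<in>I. ennreal (cut_ker d (y - x j)))"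
        proof (rule sum_ennreal[symmetric])
          fix j assume "j \<in> I"
          then show "0 \<le> cut_ker d (y - x j)" using x01[of j] y01 by (intro cut_ker_nonneg[OF d]) auto
        qed
        also have "ennreal (cut_ext d k l y) + 2 * (\<Sum>j\<in>I. ennreal (cut_ker d (y - x j))) \<le> insert_en k l I y x"
          unfolding insert_en_def
        proof (intro add_mono mult_left_mono sum_mono cut_ext_le_ext_pot[OF I(3,4) d y01])
          fix j assume "j \<in> I"
          then show "ennreal (cut_ker d (y - x j)) \<le> log_ker (y - x j)" using x01[of j] y01 by (intro cut_ker_le_log_ker[OF d]) auto
        qed simp
        finally have "exp_neg (insert_en k l I y x) \<le> ?e" by (rule exp_neg_le)
        then show ?thesis using False by simp
      qed
      have "insert_wt k l I y \<le> (\<integral>\<^sup>+x. ?e * exp_neg (hamilt k l I x) + exp_neg (hamilt k l I x) * indicator B x \<partial>cube I)"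
        unfolding insert_wt_def
      proof (rule nn_integral_mono)
        fix x assume "x \<in> space (cube I)"
        from mult_right_mono[OF good[OF this] zero_le[of "exp_neg (hamilt k l I x)"]]
        show "exp_neg (insert_en k l I y x) * exp_neg (hamilt k l I x) \<le> ?e * exp_neg (hamilt k l I x) + exp_neg (hamilt k l I x) * indicator B x"
          by (simp only: distrib_right mult.commute[of "indicator B x"])
      qed
      also have "\<dots> = ?e * part_fun k l I + (\<integral>\<^sup>+x. exp_neg (hamilt k l I x) * indicator B x \<partial>cube I)"
        unfolding part_fun_def by (subst nn_integral_add) (use Bm in \<open>auto simp: nn_integral_cmult\<close>)
      also have "\<dots> \<le> ?e * part_fun k l I + ?e * part_fun k l I"
        using elim by (intro add_left_mono) (simp add: p B_def m_def)
      also have "\<dots> = (?e + ?e) * part_fun k l I" by (simp add: distrib_right)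
      also have "\<dots> \<le> ennreal (exp (- (c * m))) * part_fun k l I"
      proof (rule mult_right_mono)
        have "ln 2 \<le> \<tau> / 2 * m" using elim \<tau>(1) by (simp add: p m_def field_simps)
        then have "exp (ln 2) \<le> exp (\<tau> / 2 * m)" by (simp only: exp_le_cancel_iff)
        then have "2 * exp (- ((c + \<tau> / 2) * m)) \<le> exp (\<tau> / 2 * m) * exp (- ((c + \<tau> / 2) * m))"
          by (intro mult_right_mono) simp_all
        also have "\<dots> = exp (- (c * m))" by (simp add: exp_add[symmetric] algebra_simps)
        finally show "?e + ?e \<le> ennreal (exp (- (c * m)))" by (simp flip: ennreal_plus add: ennreal_leI)
      qed simp
      finally show "insert_wt (pleft p) (pright p) (fst p) y \<le> ennreal (exp (- (c * pnum p))) * part_fun (pleft p) (pright p) (fst p)"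
        by (simp add: p m_def)
    qed
  qed
qed simp

end

section \<open>Lower bound for the weight of an inserted particle, and the normalization\<close>

context equilibrium begin

lemma nn_integral_eff_pot:
  assumes N: "prob01 \<nu>"
  shows "(\<integral>\<^sup>+y. eff_pot a b \<mu> y \<partial>\<nu>) = (\<integral>\<^sup>+y. ext_pot a b y \<partial>\<nu>) + 2 * log_en \<nu> \<mu>"
proof -
  interpret N: prob01 \<nu> by (rule N)
  have l: "log_pot \<mu> \<in> borel_measurable \<nu>" and v: "ext_pot a b \<in> borel_measurable \<nu>"
    by (intro N.borel_measurable_mu M.log_pot_measurable ext_pot_measurable)+
  show ?thesis unfolding eff_pot_def log_en_def
    by (subst nn_integral_add[OF v borel_measurable_times_ennreal[OF measurable_const l]])
       (simp_all add: nn_integral_cmult[OF l])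
qed

text \<open>Jensen's inequality is applied in the position y of the new particle, averaged over a
  segment inside X. The average cost involves the other particles only through the sum of the
  potentials of \<nu> at their positions, and \<nu> has a bounded density, so singularities do no
  harm.\<close>

lemma insert_wt_lower:
  assumes x0: "x0 \<in> {0..1}" "x0 + r \<in> {0..1}" "r \<noteq> 0"
    and X: "X \<in> sets borel" "\<And>u. u \<in> {0..1} \<Longrightarrow> x0 + r * u \<in> X"
    and c: "(\<integral>\<^sup>+y. eff_pot a b \<mu> y \<partial>unif_seg x0 r) < ennreal c"
  shows "\<forall>\<^sub>F p in jacobi_regime a b. ennreal (exp (- (c * pnum p))) * part_fun (pleft p) (pright p) (fst p)
     \<le> (\<integral>\<^sup>+y. insert_wt (pleft p) (pright p) (fst p) y * indicator X y \<partial>unif01)"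
proof -
  define \<nu> where "\<nu> = unif_seg x0 r"
  define c0 where "c0 = \<bar>r\<bar>"
  have N: "prob01 \<nu>" unfolding \<nu>_def by (rule prob01_unif_seg[OF x0(1,2)])
  interpret N: prob01 \<nu> by (rule N)
  have c0: "0 < c0" using x0 by (simp add: c0_def)
  have dens: "ennreal c0 * (\<integral>\<^sup>+y. f y \<partial>\<nu>) \<le> (\<integral>\<^sup>+y. f y \<partial>unif01)" if "f \<in> borel_measurable borel" for f
  proof -
    have "ennreal c0 * (\<integral>\<^sup>+y. f y \<partial>\<nu>) \<le> ennreal c0 * (ennreal (1 / c0) * (\<integral>\<^sup>+y. f y \<partial>unif01))"
      unfolding \<nu>_def c0_def by (intro mult_left_mono unif_seg_density_le x0 that) simp
    also have "\<dots> = (\<integral>\<^sup>+y. f y \<partial>unif01)" using c0 by (simp add: mult.assoc[symmetric] ennreal_mult[symmetric])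
    finally show ?thesis .
  qed
  note fin = log_ker_finite_of_density[OF N c0 dens]
  obtain A where A: "(\<integral>\<^sup>+y. log_ker y \<partial>\<nu>) = ennreal A" "0 \<le> A" using fin(2) by (cases "\<integral>\<^sup>+y. log_ker y \<partial>\<nu>") auto
  obtain B where B: "(\<integral>\<^sup>+y. log_ker (1 - y) \<partial>\<nu>) = ennreal B" "0 \<le> B" using fin(3) by (cases "\<integral>\<^sup>+y. log_ker (1 - y) \<partial>\<nu>") auto
  have eff_pot_eq: "(\<integral>\<^sup>+y. eff_pot a b \<mu> y \<partial>\<nu>) = (\<integral>\<^sup>+y. ext_pot a b y \<partial>\<nu>) + 2 * log_en \<nu> \<mu>"
    by (rule nn_integral_eff_pot[OF N])
  have "log_en \<nu> \<mu> \<noteq> \<infinity>" using c eff_pot_eq unfolding \<nu>_def by (auto simp: ennreal_mult_top)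
  then obtain U where U: "log_en \<nu> \<mu> = ennreal U" "0 \<le> U" by (cases "log_en \<nu> \<mu>") auto
  have "(\<integral>\<^sup>+y. eff_pot a b \<mu> y \<partial>\<nu>) = ennreal (a * A + b * B + 2 * U)"
    unfolding eff_pot_eq N.energy_eq_nn[OF ab] A(1) B(1) U(1) using A(2) B(2) U(2) ab by (simp add: ennreal_mult ennreal_plus)
  then have "ennreal (a * A + b * B + 2 * U) < ennreal c" using c unfolding \<nu>_def by (simp only:)
  then have lt: "a * A + b * B + 2 * U < c" using A(2) B(2) U(2) ab by (simp add: ennreal_less_iff del: ennreal_plus)
  define g where "g = c - (a * A + b * B + 2 * U)"
  have g: "0 < g" using lt by (simp add: g_def)
  \<comment> \<open>Each potential loses \<tau> by truncation and \<tau> by replacing the empirical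
    measure with \<mu>; doubled this is g / 4. With g / 4 for the exponents, half of the gap g
    remains.\<close>
  define \<tau> where "\<tau> = g / 16"
  have \<tau>: "0 < \<tau>" using g by (simp add: \<tau>_def)
  obtain d where d: "0 < d" "d < 1" and unif: "\<And>z. z \<in> {0..1} \<Longrightarrow> log_pot \<nu> z \<le> ennreal (cut_pot d \<nu> z + \<tau>)"
    by (rule log_pot_le_cut_pot_unif[OF N c0 dens \<tau>], assumption) blast
  have ld: "ln d < 0" using d by simp
  define \<eta> where "\<eta> = \<tau>\<^sup>2 / (- 2 * ln d)"
  have \<eta>: "0 < \<eta>" unfolding \<eta>_def using \<tau> ld by (intro divide_pos_pos zero_less_power) auto
  have sq: "sqrt (- 2 * ln d * E) \<le> \<tau>" if "E \<le> \<eta>" for E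
  proof (rule real_le_lsqrt)
    have "- 2 * ln d * E \<le> - 2 * ln d * \<eta>" using that ld by (intro mult_left_mono) auto
    also have "\<dots> = \<tau>\<^sup>2" using ld by (simp add: \<eta>_def)
    finally show "- 2 * ln d * E \<le> \<tau>\<^sup>2" .
  qed (use \<tau> in simp)
  have enU: "cut_en d \<nu> \<mu> \<le> U"
    using N.cut_en_le_log_en[OF M d] U by (simp add: ennreal_le_iff)
  have lim: "((\<lambda>p. pleft p / pnum p * A + pright p / pnum p * B) \<longlongrightarrow> a * A + b * B) (jacobi_regime a b)"
    by (intro tendsto_intros jacobi_regime_k jacobi_regime_l)
  have "\<forall>\<^sub>F p in jacobi_regime a b. pleft p / pnum p * A + pright p / pnum p * B < a * A + b * B + g / 4"
    by (rule order_tendstoD(2)[OF lim]) (use g in simp)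
  \<comment> \<open>The remaining g / 2 per particle then absorbs the constant factor c0 / 2, from
    the density of \<nu> and from keeping only half of the partition function.\<close>
  moreover have "\<forall>\<^sub>F p in jacobi_regime a b. 2 * ln (2 / c0) / g \<le> pnum p" using jacobi_regime_card[of a b] unfolding filterlim_at_top by blast
  ultimately show ?thesis using jacobi_regime_ok[of a b] concentration[OF d \<eta>, of 1]
  proof eventually_elim
    case (elim p)
    obtain I k l where p: "p = (I, k, l)" by (cases p)
    define m where "m = real (card I)"
    have I: "finite I" "I \<noteq> {}" "0 \<le> k" "0 \<le> l" "1 \<le> m" using elim by (auto simp: p m_def)
    define Bd where "Bd = {x. \<eta> < en_dist d (empirical I x) \<mu>}"
    let ?P = "cube I"
    have Bset: "{x \<in> space ?P. \<eta> < en_dist d (empirical I x) \<mu>} \<in> sets ?P"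
      using en_dist_empirical_measurable[OF I(1,2) M] by measurable
    have Bm: "(\<lambda>x. indicator Bd x :: ennreal) \<in> borel_measurable ?P"
      using Bset by (subst borel_measurable_indicator_iff) (simp add: Bd_def Int_def conj_commute)
    have Gm: "(\<lambda>x. indicator (- Bd) x :: ennreal) \<in> borel_measurable ?P"
    proof (subst borel_measurable_indicator_iff)
      have "- Bd \<inter> space ?P = space ?P - {x \<in> space ?P. \<eta> < en_dist d (empirical I x) \<mu>}" by (auto simp: Bd_def)
      then show "- Bd \<inter> space ?P \<in> sets ?P" using Bset by (simp only: sets.compl_sets)
    qed
    interpret P: prob_space ?P by (rule prob_space_cube)
    interpret NP: pair_sigma_finite \<nu> ?P ..
    define e where "e = ennreal (exp (- ((c - g / 2) * m)))"
    obtain z where z: "part_fun k l I = ennreal z" "0 \<le> z" using part_fun_le_1[of k l I] by (cases "part_fun k l I") (auto simp: top_unique)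
    have good: "e * indicator (- Bd) x \<le> (\<integral>\<^sup>+y. exp_neg (insert_en k l I y x) \<partial>\<nu>)" if x: "x \<in> space ?P" for x
    proof (cases "x \<in> Bd")
      case False
      note x01 = space_cubeD[OF x]
      have E: "prob01 (empirical I x)" using I(1,2) x01 by (rule prob01_empirical)
      interpret E: prob01 "empirical I x" by (rule E)
      have Ee: "en_dist d (empirical I x) \<mu> \<le> \<eta>" using False by (simp add: Bd_def)
      \<comment> \<open>By symmetry of the mutual energy, the average over the configuration of the
        potential of \<nu> becomes the \<nu>-average of the empirical potential, which is uniformly
        close to that of \<mu>.\<close>
      have "(\<Sum>j\<in>I. cut_pot d \<nu> (x j)) / m = cut_en d (empirical I x) \<nu>"
        unfolding m_def using I(1,2) x01 N by (rule cut_en_empirical[symmetric])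
      also have "\<dots> = cut_en d \<nu> (empirical I x)" by (rule E.cut_en_commute[OF N d])
      also have "\<dots> \<le> (\<integral>y. cut_pot d \<mu> y + \<tau> \<partial>\<nu>)"
        unfolding cut_en_def
      proof (intro integral_mono_AE Bochner_Integration.integrable_add N.integrable_cut_pot E M d AE_I2 N.integrable_const)
        fix y
        show "cut_pot d (empirical I x) y \<le> cut_pot d \<mu> y + \<tau>" using cut_pot_diff_le[OF d E M, of y] sq[OF Ee] by linarith
      qed
      also have "\<dots> = cut_en d \<nu> \<mu> + \<tau>"
        unfolding cut_en_def by (subst Bochner_Integration.integral_add[OF N.integrable_cut_pot[OF M d] N.integrable_const])
          (simp only: lebesgue_integral_const N.prob_space scaleR_one)
      finally have s: "(\<Sum>j\<in>I. cut_pot d \<nu> (x j)) \<le> (U + \<tau>) * m" using enU I(5) by (simp add: divide_le_eq order_trans[OF _ mult_right_mono])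
      have pn: "0 \<le> cut_pot d \<nu> (x j)" if "j \<in> I" for j using x01[OF that] by (rule N.cut_pot_nonneg[OF d])
      have "(\<Sum>j\<in>I. log_pot \<nu> (x j)) \<le> (\<Sum>j\<in>I. ennreal (cut_pot d \<nu> (x j) + \<tau>))" by (intro sum_mono unif x01)
      also have "\<dots> = ennreal (\<Sum>j\<in>I. cut_pot d \<nu> (x j) + \<tau>)" using pn \<tau> by (intro sum_ennreal) simp
      also have "\<dots> \<le> ennreal ((U + 2 * \<tau>) * m)"
        using s by (intro ennreal_leI) (simp add: sum.distrib m_def algebra_simps)
      finally have s2: "(\<Sum>j\<in>I. log_pot \<nu> (x j)) \<le> ennreal ((U + 2 * \<tau>) * m)" .
      have gm: "(\<lambda>y. insert_en k l I y x) \<in> borel_measurable borel" unfolding insert_en_def by measurable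
      have "(\<integral>\<^sup>+y. insert_en k l I y x \<partial>\<nu>) = (\<integral>\<^sup>+y. ext_pot k l y \<partial>\<nu>) + 2 * (\<Sum>j\<in>I. log_pot \<nu> (x j))"
      proof -
        have "(\<integral>\<^sup>+y. insert_en k l I y x \<partial>\<nu>) = (\<integral>\<^sup>+y. ext_pot k l y \<partial>\<nu>) + (\<integral>\<^sup>+y. 2 * (\<Sum>j\<in>I. log_ker (y - x j)) \<partial>\<nu>)"
          unfolding insert_en_def by (rule nn_integral_add; intro N.borel_measurable_mu; measurable)
        also have "(\<integral>\<^sup>+y. 2 * (\<Sum>j\<in>I. log_ker (y - x j)) \<partial>\<nu>) = 2 * (\<integral>\<^sup>+y. (\<Sum>j\<in>I. log_ker (y - x j)) \<partial>\<nu>)"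
          by (rule nn_integral_cmult; intro N.borel_measurable_mu; measurable)
        also have "(\<integral>\<^sup>+y. (\<Sum>j\<in>I. log_ker (y - x j)) \<partial>\<nu>) = (\<Sum>j\<in>I. \<integral>\<^sup>+y. log_ker (y - x j) \<partial>\<nu>)"
          by (rule nn_integral_sum; intro N.borel_measurable_mu; measurable)
        also have "(\<Sum>j\<in>I. \<integral>\<^sup>+y. log_ker (y - x j) \<partial>\<nu>) = (\<Sum>j\<in>I. log_pot \<nu> (x j))"
          unfolding log_pot_def by (intro sum.cong refl nn_integral_cong log_ker_commute)
        finally show ?thesis .
      qed
      also have "\<dots> \<le> ennreal (k * A + l * B) + 2 * ennreal ((U + 2 * \<tau>) * m)"
        unfolding N.energy_eq_nn[OF I(3,4)] A(1) B(1) using A(2) B(2) I(3,4) s2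
        by (intro add_mono mult_left_mono) (simp_all add: ennreal_mult ennreal_plus)
      also have "\<dots> = ennreal (k * A + l * B + 2 * ((U + 2 * \<tau>) * m))"
        using A(2) B(2) I(3-5) U(2) \<tau> by (simp add: ennreal_mult ennreal_plus)
      finally have "ennreal (exp (- (k * A + l * B + 2 * ((U + 2 * \<tau>) * m)))) \<le> exp_neg (\<integral>\<^sup>+y. insert_en k l I y x \<partial>\<nu>)"
        using A(2) B(2) I(3-5) U(2) \<tau> by (intro exp_neg_ge) auto
      also have "\<dots> \<le> (\<integral>\<^sup>+y. exp_neg (insert_en k l I y x) \<partial>\<nu>)"
        by (rule N.exp_neg_jensen[OF N.borel_measurable_mu[OF gm]])
      finally have *: "ennreal (exp (- (k * A + l * B + 2 * ((U + 2 * \<tau>) * m)))) \<le> (\<integral>\<^sup>+y. exp_neg (insert_en k l I y x) \<partial>\<nu>)" .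
      have "(k / m * A + l / m * B + 2 * (U + 2 * \<tau>)) * m \<le> (c - g / 2) * m"
        using elim(1) I(5) unfolding \<tau>_def g_def p m_def by (intro mult_right_mono) (simp_all add: field_simps)
      also have "(k / m * A + l / m * B + 2 * (U + 2 * \<tau>)) * m = k * A + l * B + 2 * ((U + 2 * \<tau>) * m)"
        using I(5) by (simp add: field_simps)
      finally have "e \<le> ennreal (exp (- (k * A + l * B + 2 * ((U + 2 * \<tau>) * m))))"
        unfolding e_def by (intro ennreal_leI) simp
      then show ?thesis using * False by (simp add: order_trans)
    qed simp
    define G where "G = (\<integral>\<^sup>+x. exp_neg (hamilt k l I x) * indicator (- Bd) x \<partial>?P)"
    \<comment> \<open>Concentration was invoked with C = 1: bad configurations carry at most a
      fraction exp(- m) \<le> 1/2 of the partition function, as m \<ge> 1.\<close>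
    have half: "ennreal (z / 2) \<le> G"
    proof -
      have "(\<integral>\<^sup>+x. exp_neg (hamilt k l I x) * indicator Bd x \<partial>?P) \<le> ennreal (exp (- m)) * ennreal z"
        using elim(4) by (simp add: p Bd_def m_def z)
      also have "\<dots> = ennreal (exp (- m) * z)" using z(2) by (simp add: ennreal_mult)
      also have "\<dots> \<le> ennreal (z / 2)"
      proof (rule ennreal_leI)
        have "2 \<le> exp m" using exp_ge_add_one_self[of m] I(5) by linarith
        then have "exp (- m) \<le> 1 / 2" by (simp add: exp_minus field_simps)
        then have "exp (- m) * z \<le> 1 / 2 * z" using z(2) by (rule mult_right_mono)
        then show "exp (- m) * z \<le> z / 2" by simp
      qed
      finally have bad: "(\<integral>\<^sup>+x. exp_neg (hamilt k l I x) * indicator Bd x \<partial>?P) \<le> ennreal (z / 2)" .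
      have "ennreal z = (\<integral>\<^sup>+x. exp_neg (hamilt k l I x) * indicator Bd x + exp_neg (hamilt k l I x) * indicator (- Bd) x \<partial>?P)"
        unfolding z(1)[symmetric] part_fun_def by (intro nn_integral_cong) (simp add: indicator_def)
      also have "\<dots> = (\<integral>\<^sup>+x. exp_neg (hamilt k l I x) * indicator Bd x \<partial>?P) + G"
        unfolding G_def using Bm Gm by (intro nn_integral_add) auto
      also have "\<dots> \<le> ennreal (z / 2) + G" by (intro add_right_mono bad)
      also have "ennreal z = ennreal (z / 2) + ennreal (z / 2)" using z(2) by (simp flip: ennreal_plus)
      finally show ?thesis by (simp add: ennreal_add_left_cancel_le)
    qed
    have nu: "(\<integral>\<^sup>+y. insert_wt k l I y \<partial>\<nu>) = (\<integral>\<^sup>+y. insert_wt k l I y * indicator X y \<partial>\<nu>)"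
    proof -
      have m1: "(\<lambda>y. insert_wt k l I y * indicator X y) \<in> borel_measurable borel" using X(1) by measurable
      show ?thesis unfolding \<nu>_def nn_integral_unif_seg[OF x0(1,2) m1] nn_integral_unif_seg[OF x0(1,2) insert_wt_measurable]
        by (intro nn_integral_cong) (simp add: X(2) space_restrict_space)
    qed
    have "e * G \<le> (\<integral>\<^sup>+x. (\<integral>\<^sup>+y. exp_neg (insert_en k l I y x) * exp_neg (hamilt k l I x) \<partial>\<nu>) \<partial>?P)"
    proof -
      have "e * G = (\<integral>\<^sup>+x. e * (exp_neg (hamilt k l I x) * indicator (- Bd) x) \<partial>?P)"
        unfolding G_def using Gm by (intro nn_integral_cmult[symmetric]) auto
      also have "\<dots> \<le> (\<integral>\<^sup>+x. (\<integral>\<^sup>+y. exp_neg (insert_en k l I y x) * exp_neg (hamilt k l I x) \<partial>\<nu>) \<partial>?P)"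
      proof (rule nn_integral_mono)
        fix x assume x: "x \<in> space ?P"
        have gm: "(\<lambda>y. exp_neg (insert_en k l I y x)) \<in> borel_measurable \<nu>"
          unfolding insert_en_def by (intro N.borel_measurable_mu) measurable
        show "e * (exp_neg (hamilt k l I x) * indicator (- Bd) x) \<le> (\<integral>\<^sup>+y. exp_neg (insert_en k l I y x) * exp_neg (hamilt k l I x) \<partial>\<nu>)"
          using mult_right_mono[OF good[OF x] zero_le[of "exp_neg (hamilt k l I x)"]]
          unfolding nn_integral_multc[OF gm] by (simp only: mult_ac)
      qed
      finally show ?thesis .
    qed
    also have "\<dots> = (\<integral>\<^sup>+y. insert_wt k l I y \<partial>\<nu>)"
    proof -
      have "(\<lambda>q. (fst q, snd q)) \<in> \<nu> \<Otimes>\<^sub>M ?P \<rightarrow>\<^sub>M borel \<Otimes>\<^sub>M ?P"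
        by (intro measurable_Pair measurable_compose[OF measurable_fst N.id_measurable] measurable_snd)
      from measurable_compose[OF this insert_en_measurable[of k l I]]
      have "(\<lambda>q. insert_en k l I (fst q) (snd q)) \<in> borel_measurable (\<nu> \<Otimes>\<^sub>M ?P)"
        unfolding case_prod_conv .
      then have "(\<lambda>q. exp_neg (insert_en k l I (fst q) (snd q)) * exp_neg (hamilt k l I (snd q))) \<in> borel_measurable (\<nu> \<Otimes>\<^sub>M ?P)"
        by (intro borel_measurable_times_ennreal measurable_compose[OF _ exp_neg_measurable]
          measurable_compose[OF measurable_snd hamilt_measurable'])
      then have "(\<lambda>(y, x). exp_neg (insert_en k l I y x) * exp_neg (hamilt k l I x)) \<in> borel_measurable (\<nu> \<Otimes>\<^sub>M ?P)"
        unfolding case_prod_unfold .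
      from NP.Fubini'[OF this] show ?thesis unfolding insert_wt_def .
    qed
    finally have eG: "e * G \<le> (\<integral>\<^sup>+y. insert_wt k l I y * indicator X y \<partial>\<nu>)" unfolding nu .
    have "ennreal (exp (- (c * m))) * ennreal z \<le> ennreal c0 * (e * ennreal (z / 2))"
    proof -
      have "ln (2 / c0) \<le> g / 2 * m" using elim(2) g by (simp add: p m_def field_simps)
      then have "exp (ln (2 / c0)) \<le> exp (g / 2 * m)" by (simp only: exp_le_cancel_iff)
      then have "2 / c0 \<le> exp (g / 2 * m)" using c0 by simp
      then have "1 \<le> c0 / 2 * exp (g / 2 * m)" using c0 by (simp add: field_simps)
      then have "exp (- (c * m)) * z * 1 \<le> exp (- (c * m)) * z * (c0 / 2 * exp (g / 2 * m))"
        using z(2) by (intro mult_left_mono) auto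
      also have "\<dots> = c0 * (exp (- ((c - g / 2) * m)) * (z / 2))"
      proof -
        have "exp (- (c * m)) * exp (g / 2 * m) = exp (- ((c - g / 2) * m))"
          by (simp add: exp_add[symmetric] algebra_simps)
        then show ?thesis by (simp add: algebra_simps)
      qed
      finally have "ennreal (exp (- (c * m)) * z) \<le> ennreal (c0 * (exp (- ((c - g / 2) * m)) * (z / 2)))"
        by (intro ennreal_leI) simp
      then show ?thesis
        by (simp only: e_def ennreal_mult'[OF less_imp_le[OF c0]] ennreal_mult'[OF exp_ge_zero])
    qed
    also have "\<dots> \<le> ennreal c0 * (\<integral>\<^sup>+y. insert_wt k l I y * indicator X y \<partial>\<nu>)"
      by (intro mult_left_mono order_trans[OF mult_left_mono[OF half] eG]) auto
    also have "\<dots> \<le> (\<integral>\<^sup>+y. insert_wt k l I y * indicator X y \<partial>unif01)"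
      by (intro dens borel_measurable_times_ennreal insert_wt_measurable borel_measurable_indicator X(1))
    finally show ?case by (simp add: p m_def z)
  qed
qed

lemma unif_seg_near:
  assumes x: "x \<in> {0..1}" "eff_pot a b \<mu> x < ennreal c" and U: "openin (top_of_set {0..1}) U" "x \<in> U"
  obtains r where "x + r \<in> {0..1}" "r \<noteq> 0" "\<And>u. u \<in> {0..1} \<Longrightarrow> x + r * u \<in> U"
    "(\<integral>\<^sup>+y. eff_pot a b \<mu> y \<partial>unif_seg x r) < ennreal c"
proof -
  from U obtain \<epsilon> where \<epsilon>: "0 < \<epsilon>" "\<And>y. y \<in> {0..1} \<Longrightarrow> dist y x < \<epsilon> \<Longrightarrow> y \<in> U"
    unfolding openin_euclidean_subtopology_iff by metis
  define \<sigma> :: real where "\<sigma> = (if x \<le> 1 / 2 then 1 else - 1)"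
  define r where "r j = \<sigma> * cut_seq j" for j
  have dq2: "cut_seq j \<le> 1 / 2" for j by (simp add: cut_seq_def field_simps)
  have r0: "r \<longlonglongrightarrow> 0" unfolding r_def using tendsto_mult_right_zero[OF cut_seq_lim] by simp
  have xr: "x + r j \<in> {0..1}" "r j \<noteq> 0" for j
    using dq2[of j] cut_seq[of j] x(1) by (auto simp: r_def \<sigma>_def)
  have "eff_pot a b \<mu> x < \<infinity>" using x(2) by (rule less_trans) simp
  from order_tendstoD(2)[OF eff_pot_unif_seg_lim[OF M this x(1) r0 xr(1)] x(2)]
  have "\<forall>\<^sub>F j in sequentially. (\<integral>\<^sup>+y. eff_pot a b \<mu> y \<partial>unif_seg x (r j)) < ennreal c" .
  moreover have "\<forall>\<^sub>F j in sequentially. \<bar>r j\<bar> < \<epsilon>"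
    using \<epsilon>(1) by (intro order_tendstoD(2)[OF tendsto_rabs_zero[OF r0]])
  ultimately have "\<forall>\<^sub>F j in sequentially. (\<integral>\<^sup>+y. eff_pot a b \<mu> y \<partial>unif_seg x (r j)) < ennreal c \<and> \<bar>r j\<bar> < \<epsilon>"
    by (rule eventually_conj)
  then obtain j where j: "(\<integral>\<^sup>+y. eff_pot a b \<mu> y \<partial>unif_seg x (r j)) < ennreal c" "\<bar>r j\<bar> < \<epsilon>"
    by (auto simp: eventually_sequentially)
  show thesis
  proof (rule that[OF xr _ j(1)])
    fix u :: real assume u: "u \<in> {0..1}"
    have "\<bar>r j * u\<bar> \<le> \<bar>r j\<bar> * 1" unfolding abs_mult using u by (intro mult_left_mono) auto
    then have d: "dist (x + r j * u) x < \<epsilon>" using j(2) by (simp add: dist_real_def)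
    have "x + r j * u \<in> closed_segment x (x + r j)"
      unfolding closed_segment_def using u by (intro CollectI exI[of _ u]) (auto simp: algebra_simps)
    also have "closed_segment x (x + r j) \<subseteq> {0..1}" using x(1) xr(1)[of j] by (simp add: closed_segment_subset)
    finally show "x + r j * u \<in> U" by (rule \<epsilon>(2)[OF _ d])
  qed
qed

text \<open>D0 is the average of \<open>eff_pot\<close> under \<mu>, so a level c > D0 cannot be a
  lower bound everywhere.\<close>

lemma eff_pot_attains_D0:
  assumes "D0 < c"
  shows "\<exists>x\<in>{0..1}. eff_pot a b \<mu> x < ennreal c"
proof (rule ccontr)
  assume "\<not> (\<exists>x\<in>{0..1}. eff_pot a b \<mu> x < ennreal c)"
  then have "ennreal c \<le> eff_pot a b \<mu> x" if "x \<in> {0..1}" for x using that by (auto simp: not_less)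
  then have "(\<integral>\<^sup>+x. ennreal c \<partial>\<mu>) \<le> (\<integral>\<^sup>+x. eff_pot a b \<mu> x \<partial>\<mu>)" by (intro nn_integral_mono) auto
  also have "\<dots> = (\<integral>\<^sup>+y. ext_pot a b y \<partial>\<mu>) + 2 * log_en \<mu> \<mu>"
    by (rule nn_integral_eff_pot[OF M])
  also have "\<dots> = ennreal D0" unfolding e0(1) v0(1) D0_def using e0 v0 by (simp add: ennreal_mult ennreal_plus add.commute)
  finally have "ennreal c \<le> ennreal D0" by (simp only: M.nn_const)
  then show False using assms D0_nonneg by (simp add: ennreal_le_iff)
qed

text \<open>The integral over [0,1] dominates the contribution of a segment near a point where
  \<open>eff_pot\<close> lies below c.\<close>

lemma part_fun_insert_lower:
  assumes "D0 < c"
  shows "\<forall>\<^sub>F p in jacobi_regime a b. ennreal (exp (- (c * pnum p))) * part_fun (pleft p) (pright p) (fst p) \<le> (\<integral>\<^sup>+y. insert_wt (pleft p) (pright p) (fst p) y \<partial>unif01)"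
proof -
  obtain x where x: "x \<in> {0..1}" "eff_pot a b \<mu> x < ennreal c" using eff_pot_attains_D0[OF assms] by blast
  obtain r where "x + r \<in> {0..1}" "r \<noteq> 0" "(\<integral>\<^sup>+y. eff_pot a b \<mu> y \<partial>unif_seg x r) < ennreal c"
    by (rule unif_seg_near[OF x openin_subtopology_self x(1)]) blast
  from insert_wt_lower[OF x(1) this(1,2) _ _ this(3), of UNIV] show ?thesis by simp
qed

lemma part_fun_insert_upper:
  assumes "c < D0"
  shows "\<forall>\<^sub>F p in jacobi_regime a b. (\<integral>\<^sup>+y. insert_wt (pleft p) (pright p) (fst p) y \<partial>unif01) \<le> ennreal (exp (- (c * pnum p))) * part_fun (pleft p) (pright p) (fst p)"
proof -
  have "\<forall>\<^sub>F p in jacobi_regime a b. \<forall>y\<in>{0..1}. insert_wt (pleft p) (pright p) (fst p) y \<le> ennreal (exp (- (c * pnum p))) * part_fun (pleft p) (pright p) (fst p)"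
  proof (cases "0 \<le> c")
    case True
    have "ennreal c < eff_pot a b \<mu> y" if "y \<in> {0..1}" for y
      using ennreal_lessI[OF _ assms] True assms D0_le_eff_pot[OF that] by (meson less_le_trans le_less_trans)
    then show ?thesis by (intro insert_wt_upper) auto
  \<comment> \<open>For negative c the hypothesis c < D0 does not supply the strict inequality in
    \<open>ennreal\<close>, where c becomes 0. The bound is then trivial: insertion factors are at
    most 1 and exp(- c m) is at least 1.\<close>
  next
    case False
    have "insert_wt (pleft p) (pright p) (fst p) y \<le> ennreal (exp (- (c * pnum p))) * part_fun (pleft p) (pright p) (fst p)" for p y
    proof -
      have "insert_wt (pleft p) (pright p) (fst p) y \<le> 1 * part_fun (pleft p) (pright p) (fst p)"
        unfolding insert_wt_def part_fun_def mult_1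
      proof (rule nn_integral_mono)
        fix x
        show "exp_neg (insert_en (pleft p) (pright p) (fst p) y x) * exp_neg (hamilt (pleft p) (pright p) (fst p) x) \<le> exp_neg (hamilt (pleft p) (pright p) (fst p) x)"
          using mult_right_mono[OF exp_neg_le_1[of "insert_en (pleft p) (pright p) (fst p) y x"] zero_le[of "exp_neg (hamilt (pleft p) (pright p) (fst p) x)"]]
          by (simp only: mult_1)
      qed
      also have "\<dots> \<le> ennreal (exp (- (c * pnum p))) * part_fun (pleft p) (pright p) (fst p)"
      proof (rule mult_right_mono)
        have "c * pnum p \<le> 0" using False by (intro mult_nonpos_nonneg) auto
        then have "ennreal 1 \<le> ennreal (exp (- (c * pnum p)))" by (intro ennreal_leI) simp
        then show "1 \<le> ennreal (exp (- (c * pnum p)))" by simp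
      qed simp
      finally show ?thesis .
    qed
    then show ?thesis by simp
  qed
  then show ?thesis by eventually_elim (intro nn_unif01_le_const; blast)
qed

end

section \<open>The Jacobi ensemble\<close>

lemma elog_eq_log_ker: "\<bar>w\<bar> \<le> 1 \<Longrightarrow> elog \<bar>w\<bar> = - enn2ereal (log_ker w)"
  by (cases "w = 0") (auto simp: elog_def log_ker_def)

lemma eintegral_neg:
  assumes "\<And>x. x \<in> space \<mu> \<Longrightarrow> f x = - enn2ereal (g x)"
  shows "eintegral \<mu> f = - enn2ereal (\<integral>\<^sup>+x. g x \<partial>\<mu>)"
proof -
  have z: "e2ennreal (- enn2ereal t) = 0" for t by (simp add: e2ennreal_neg)
  have "(\<integral>\<^sup>+x. e2ennreal (f x) \<partial>\<mu>) = (\<integral>\<^sup>+x. 0 \<partial>\<mu>)"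
    by (rule nn_integral_cong) (simp add: assms z)
  moreover have "(\<integral>\<^sup>+x. e2ennreal (- f x) \<partial>\<mu>) = (\<integral>\<^sup>+x. g x \<partial>\<mu>)"
    by (rule nn_integral_cong) (simp add: assms)
  ultimately show ?thesis by (simp add: eintegral_def zero_ennreal.rep_eq)
qed

lemma eintegral_pos:
  assumes "\<And>x. x \<in> space \<mu> \<Longrightarrow> f x = enn2ereal (g x)"
  shows "eintegral \<mu> f = enn2ereal (\<integral>\<^sup>+x. g x \<partial>\<mu>)"
proof -
  have z: "e2ennreal (- enn2ereal t) = 0" for t by (simp add: e2ennreal_neg)
  have "(\<integral>\<^sup>+x. e2ennreal (- f x) \<partial>\<mu>) = (\<integral>\<^sup>+x. 0 \<partial>\<mu>)"
    by (rule nn_integral_cong) (simp add: assms z)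
  moreover have "(\<integral>\<^sup>+x. e2ennreal (f x) \<partial>\<mu>) = (\<integral>\<^sup>+x. g x \<partial>\<mu>)"
    by (rule nn_integral_cong) (simp add: assms)
  ultimately show ?thesis by (simp add: eintegral_def zero_ennreal.rep_eq)
qed

lemma enn2ereal_cmult: "0 \<le> c \<Longrightarrow> enn2ereal (ennreal c * X) = ereal c * enn2ereal X"
  by (simp add: times_ennreal.rep_eq)

lemma enn2ereal_ext_pot:
  assumes "0 \<le> p" "0 \<le> q"
  shows "enn2ereal (ext_pot p q x) = ereal p * enn2ereal (log_ker x) + ereal q * enn2ereal (log_ker (1 - x))"
  using assms by (simp add: ext_pot_def plus_ennreal.rep_eq enn2ereal_cmult)

lemma elog_ext_pot:
  assumes "0 \<le> p" "0 \<le> q" "x \<in> {0..1}"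
  shows "ereal (- p) * elog x - ereal q * elog (1 - x) = enn2ereal (ext_pot p q x)"
    and "ereal p * elog x + ereal q * elog (1 - x) = - enn2ereal (ext_pot p q x)"
proof -
  have e: "elog x = - enn2ereal (log_ker x)" "elog (1 - x) = - enn2ereal (log_ker (1 - x))"
    using elog_eq_log_ker[of x] elog_eq_log_ker[of "1 - x"] assms(3) by auto
  define u v where "u = ereal p * enn2ereal (log_ker x)" and "v = ereal q * enn2ereal (log_ker (1 - x))"
  have uv: "0 \<le> u" "0 \<le> v" using assms by (simp_all add: u_def v_def)
  have m: "ereal (- p) * elog x = u" "ereal q * elog (1 - x) = - v" "ereal p * elog x = - u"
    unfolding u_def v_def e by (simp_all flip: uminus_ereal.simps(1))
  show "ereal (- p) * elog x - ereal q * elog (1 - x) = enn2ereal (ext_pot p q x)"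
    unfolding m enn2ereal_ext_pot[OF assms(1,2)] u_def[symmetric] v_def[symmetric] by (simp add: minus_ereal_def)
  show "ereal p * elog x + ereal q * elog (1 - x) = - enn2ereal (ext_pot p q x)"
    unfolding m enn2ereal_ext_pot[OF assms(1,2)] u_def[symmetric] v_def[symmetric]
    using uv by (cases u; cases v) auto
qed

lemma ext_pot_scale: "0 \<le> c \<Longrightarrow> 0 \<le> p \<Longrightarrow> 0 \<le> q \<Longrightarrow> ennreal c * ext_pot p q x = ext_pot (c * p) (c * q) x"
  by (simp add: ext_pot_def distrib_left ennreal_mult mult.assoc)

lemma eexp_neg: "eexp (- enn2ereal h) = exp_neg h"
  by (cases h) (auto simp: eexp_def exp_neg_def)

text \<open>With zero exponents \<open>hamilt\<close> is the ordered pair sum, so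
  \<open>hamilt_insert\<close> provides the induction step.\<close>

lemma sum_ordered_pairs:
  fixes x :: config
  shows "(\<Sum>i\<in>{1..n}. \<Sum>j\<in>{1..n} - {i}. log_ker (x i - x j)) = 2 * (\<Sum>j\<in>{1..n}. \<Sum>i\<in>{1..<j}. log_ker (x i - x j))"
proof (induction n)
  case (Suc n)
  have v0: "ext_pot 0 0 y = 0" for y by (simp add: ext_pot_def)
  have h: "hamilt 0 0 I x = (\<Sum>i\<in>I. \<Sum>j\<in>I - {i}. log_ker (x i - x j))" for I by (simp add: hamilt_def v0)
  have ins: "{1..Suc n} = insert (Suc n) {1..n}" by auto
  have "hamilt 0 0 {1..Suc n} x = hamilt 0 0 (insert (Suc n) {1..n}) (x(Suc n := x (Suc n)))" by (simp only: ins fun_upd_triv)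
  also have "\<dots> = insert_en 0 0 {1..n} (x (Suc n)) x + hamilt 0 0 {1..n} x" by (rule hamilt_insert) auto
  also have "insert_en 0 0 {1..n} (x (Suc n)) x = 2 * (\<Sum>i\<in>{1..n}. log_ker (x i - x (Suc n)))"
    unfolding insert_en_def v0 by (simp add: log_ker_commute[of "x (Suc n)"])
  also have "hamilt 0 0 {1..n} x = 2 * (\<Sum>j\<in>{1..n}. \<Sum>i\<in>{1..<j}. log_ker (x i - x j))" using Suc.IH h by simp
  also have "2 * (\<Sum>i\<in>{1..n}. log_ker (x i - x (Suc n))) + 2 * (\<Sum>j\<in>{1..n}. \<Sum>i\<in>{1..<j}. log_ker (x i - x j))
    = 2 * (\<Sum>j\<in>{1..Suc n}. \<Sum>i\<in>{1..<j}. log_ker (x i - x j))"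
    unfolding ins by (simp add: distrib_left atLeastLessThanSuc_atLeastAtMost)
  finally show ?case unfolding h .
qed simp

lemma jacobi_weight_eq:
  assumes n: "1 \<le> n" and kl: "0 \<le> k" "0 \<le> l" and x: "\<And>i. i \<in> {1..n} \<Longrightarrow> x i \<in> {0..1}"
  shows "jacobi_weight n k l x = exp_neg (hamilt k l {1..n} x)"
proof -
  let ?p = "k / (2 * real n)" and ?q = "l / (2 * real n)"
  have pq: "0 \<le> ?p" "0 \<le> ?q" using kl by auto
  have "(\<Sum>i\<in>{1..n}. jacobi_potential n k l (x i)) = (\<Sum>i\<in>{1..n}. enn2ereal (ext_pot ?p ?q (x i)))"
    unfolding jacobi_potential_def by (intro sum.cong refl elog_ext_pot pq x)
  also have "\<dots> = enn2ereal (\<Sum>i\<in>{1..n}. ext_pot ?p ?q (x i))" by (rule sum_enn2ereal) simp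
  finally have V: "(\<Sum>i\<in>{1..n}. jacobi_potential n k l (x i)) = enn2ereal (\<Sum>i\<in>{1..n}. ext_pot ?p ?q (x i))" .
  have "ereal (- (2 * real n)) * (\<Sum>i\<in>{1..n}. jacobi_potential n k l (x i))
     = - (ereal (2 * real n) * enn2ereal (\<Sum>i\<in>{1..n}. ext_pot ?p ?q (x i)))"
    unfolding V by (simp flip: uminus_ereal.simps(1))
  also have "\<dots> = - enn2ereal (ennreal (2 * real n) * (\<Sum>i\<in>{1..n}. ext_pot ?p ?q (x i)))"
    by (subst enn2ereal_cmult) auto
  also have "ennreal (2 * real n) * (\<Sum>i\<in>{1..n}. ext_pot ?p ?q (x i)) = (\<Sum>i\<in>{1..n}. ext_pot k l (x i))"
    unfolding sum_distrib_left using n pq by (intro sum.cong refl, subst ext_pot_scale) auto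
  finally have A: "ereal (- (2 * real n)) * (\<Sum>i\<in>{1..n}. jacobi_potential n k l (x i)) = - enn2ereal (\<Sum>i\<in>{1..n}. ext_pot k l (x i))" .
  \<comment> \<open>In \<open>ereal\<close> negation distributes over these sums because all terms
    have the same sign, so \<infinity> - \<infinity> cannot occur.\<close>
  have neg: "(\<Sum>i\<in>A. - enn2ereal (f i)) = - enn2ereal (\<Sum>i\<in>A. f i)" if "finite A" for A and f :: "nat \<Rightarrow> ennreal"
    using that
  proof (induction A rule: finite_induct)
    case (insert i A)
    have "- enn2ereal (f i) + - enn2ereal (sum f A) = - enn2ereal (f i + sum f A)"
      by (cases "f i"; cases "sum f A") (simp_all flip: ennreal_plus)
    then show ?case using insert by simp
  qed (simp add: zero_ennreal.rep_eq)
  have "(\<Sum>j\<in>{1..n}. \<Sum>i\<in>{1..<j}. elog \<bar>x i - x j\<bar>) = (\<Sum>j\<in>{1..n}. \<Sum>i\<in>{1..<j}. - enn2ereal (log_ker (x i - x j)))"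
  proof (intro sum.cong refl elog_eq_log_ker)
    fix i j assume "j \<in> {1..n}" "i \<in> {1..<j}"
    then show "\<bar>x i - x j\<bar> \<le> 1" using x[of i] x[of j] by auto
  qed
  also have "\<dots> = - enn2ereal (\<Sum>j\<in>{1..n}. \<Sum>i\<in>{1..<j}. log_ker (x i - x j))" by (simp add: neg)
  finally have "2 * (\<Sum>j\<in>{1..n}. \<Sum>i\<in>{1..<j}. elog \<bar>x i - x j\<bar>)
    = - (2 * enn2ereal (\<Sum>j\<in>{1..n}. \<Sum>i\<in>{1..<j}. log_ker (x i - x j)))" by simp
  also have "\<dots> = - enn2ereal (2 * (\<Sum>j\<in>{1..n}. \<Sum>i\<in>{1..<j}. log_ker (x i - x j)))" by (simp add: times_ennreal.rep_eq)
  also have "\<dots> = - enn2ereal (\<Sum>i\<in>{1..n}. \<Sum>j\<in>{1..n} - {i}. log_ker (x i - x j))" by (simp only: sum_ordered_pairs)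
  finally have B: "2 * (\<Sum>j\<in>{1..n}. \<Sum>i\<in>{1..<j}. elog \<bar>x i - x j\<bar>) = - enn2ereal (\<Sum>i\<in>{1..n}. \<Sum>j\<in>{1..n} - {i}. log_ker (x i - x j))" .
  have "- enn2ereal u + - enn2ereal w = - enn2ereal (u + w)" for u w
    by (cases u; cases w) (simp_all flip: ennreal_plus)
  then show ?thesis unfolding jacobi_weight_def A B hamilt_def by (simp only: eexp_neg)
qed

lemma jacobi_Z_eq:
  assumes "1 \<le> n" "0 \<le> k" "0 \<le> l"
  shows "jacobi_Z n k l = part_fun k l {1..n}"
  unfolding jacobi_Z_def part_fun_def by (intro nn_integral_cong jacobi_weight_eq assms space_cubeD)

section \<open>Unnormalized hitting probabilities\<close>

definition hit_wt :: "real \<Rightarrow> real \<Rightarrow> nat set \<Rightarrow> real set \<Rightarrow> ennreal" where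
  "hit_wt k l I X = (\<integral>\<^sup>+x. exp_neg (hamilt k l I x) * indicator {x. \<exists>i\<in>I. x i \<in> X} x \<partial>cube I)"

lemma hit_wt_set_measurable:
  assumes "finite I" and X: "X \<in> sets borel"
  shows "{x \<in> space (cube I). \<exists>i\<in>I. x i \<in> X} \<in> sets (cube I)"
proof -
  have "{x \<in> space (cube I). \<exists>i\<in>I. x i \<in> X} = (\<Union>i\<in>I. (\<lambda>x. x i) -` X \<inter> space (cube I))" by auto
  also have "\<dots> \<in> sets (cube I)"
    using assms by (intro sets.finite_UN measurable_sets[OF comp_unif01_measurable X]) auto
  finally show ?thesis .
qed

lemma jacobi_hit_eq:
  assumes n: "1 \<le> n" and kl: "0 \<le> k" "0 \<le> l" and X: "X \<in> sets borel" and Z: "part_fun k l {1..n} \<noteq> 0"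
  shows "jacobi_hit n k l X = enn2real (hit_wt k l {1..n} X / part_fun k l {1..n})"
proof -
  let ?P = "cube {1..n}" and ?Z = "part_fun k l {1..n}"
  let ?S = "{x. \<exists>i\<in>{1..n}. x i \<in> X}"
  have w: "jacobi_weight n k l x = exp_neg (hamilt k l {1..n} x)" if "x \<in> space ?P" for x
    using space_cubeD[OF that] by (rule jacobi_weight_eq[OF n kl])
  have m: "(\<lambda>x. exp_neg (hamilt k l {1..n} x) / ?Z) \<in> borel_measurable ?P" by measurable
  have dens_eq: "jacobi_ensemble n k l = density ?P (\<lambda>x. exp_neg (hamilt k l {1..n} x) / ?Z)"
  proof -
    have mw: "(\<lambda>x. jacobi_weight n k l x / jacobi_Z n k l) \<in> borel_measurable ?P"
      using m by (subst measurable_cong[of _ _ "\<lambda>x. exp_neg (hamilt k l {1..n} x) / ?Z"]) (simp_all add: w jacobi_Z_eq[OF n kl])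
    show ?thesis unfolding jacobi_ensemble_def
      by (rule density_cong[OF mw m]) (intro AE_I2, simp add: w jacobi_Z_eq[OF n kl])
  qed
  have sp: "space (jacobi_ensemble n k l) = space ?P" unfolding dens_eq by simp
  have S: "{x \<in> space ?P. x ` {1..n} \<inter> X \<noteq> {}} = {x \<in> space ?P. \<exists>i\<in>{1..n}. x i \<in> X}" by auto
  have "emeasure (jacobi_ensemble n k l) {x \<in> space ?P. \<exists>i\<in>{1..n}. x i \<in> X}
    = (\<integral>\<^sup>+x. exp_neg (hamilt k l {1..n} x) / ?Z * indicator {x \<in> space ?P. \<exists>i\<in>{1..n}. x i \<in> X} x \<partial>?P)"
    unfolding dens_eq by (rule emeasure_density[OF m hit_wt_set_measurable]) (use X in auto)
  also have "\<dots> = (\<integral>\<^sup>+x. exp_neg (hamilt k l {1..n} x) * indicator ?S x / ?Z \<partial>?P)"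
    by (intro nn_integral_cong) (auto simp: indicator_def)
  also have "\<dots> = hit_wt k l {1..n} X / ?Z"
  proof -
    have "(\<lambda>x. indicator ?S x :: ennreal) \<in> borel_measurable ?P"
      using hit_wt_set_measurable[OF _ X, of "{1..n}"] by (subst borel_measurable_indicator_iff) (simp add: Int_def conj_commute)
    then show ?thesis unfolding hit_wt_def by (intro nn_integral_divide) auto
  qed
  finally show ?thesis unfolding jacobi_hit_def sp S measure_def by simp
qed

text \<open>The union bound over the particles, with every other particle integrated out; each i
  leads to its own label set \<open>I - {i}\<close>.\<close>

lemma hit_wt_le_sum:
  assumes I: "finite I" and X: "X \<in> sets borel"
  shows "hit_wt k l I X \<le> (\<Sum>i\<in>I. \<integral>\<^sup>+y. insert_wt k l (I - {i}) y * indicator X y \<partial>unif01)"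
proof -
  let ?P = "cube I"
  have m: "(\<lambda>x. exp_neg (hamilt k l I x) * indicator X (x i)) \<in> borel_measurable ?P" if "i \<in> I" for i
    by (intro borel_measurable_times_ennreal measurable_compose[OF comp_unif01_measurable[OF that]] borel_measurable_indicator X) measurable
  have "hit_wt k l I X \<le> (\<integral>\<^sup>+x. (\<Sum>i\<in>I. exp_neg (hamilt k l I x) * indicator X (x i)) \<partial>?P)"
    unfolding hit_wt_def
  proof (rule nn_integral_mono)
    fix x
    show "exp_neg (hamilt k l I x) * indicator {x. \<exists>i\<in>I. x i \<in> X} x \<le> (\<Sum>i\<in>I. exp_neg (hamilt k l I x) * indicator X (x i))"
    proof (cases "\<exists>i\<in>I. x i \<in> X")
      case True
      then obtain i where i: "i \<in> I" "x i \<in> X" by auto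
      have "exp_neg (hamilt k l I x) * indicator X (x i) \<le> (\<Sum>i\<in>I. exp_neg (hamilt k l I x) * indicator X (x i))"
        using I i(1) by (intro member_le_sum) auto
      then show ?thesis using i True by simp
    qed simp
  qed
  also have "\<dots> = (\<Sum>i\<in>I. \<integral>\<^sup>+x. exp_neg (hamilt k l I x) * indicator X (x i) \<partial>?P)" by (intro nn_integral_sum m)
  also have "\<dots> = (\<Sum>i\<in>I. \<integral>\<^sup>+y. insert_wt k l (I - {i}) y * indicator X y \<partial>unif01)"
  proof (intro sum.cong refl)
    fix i assume "i \<in> I"
    then have "insert i (I - {i}) = I" by auto
    with one_particle[of "I - {i}" i X k l] I X
    show "(\<integral>\<^sup>+x. exp_neg (hamilt k l I x) * indicator X (x i) \<partial>?P) = (\<integral>\<^sup>+y. insert_wt k l (I - {i}) y * indicator X y \<partial>unif01)" by simp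
  qed
  finally show ?thesis .
qed

lemma hit_wt_ge:
  assumes I: "finite I" "i \<in> I" and X: "X \<in> sets borel"
  shows "(\<integral>\<^sup>+y. insert_wt k l (I - {i}) y * indicator X y \<partial>unif01) \<le> hit_wt k l I X"
proof -
  have "insert i (I - {i}) = I" using I by auto
  with one_particle[of "I - {i}" i X k l] I X
  have "(\<integral>\<^sup>+y. insert_wt k l (I - {i}) y * indicator X y \<partial>unif01) = (\<integral>\<^sup>+x. exp_neg (hamilt k l I x) * indicator X (x i) \<partial>cube I)" by simp
  also have "\<dots> \<le> hit_wt k l I X"
    unfolding hit_wt_def using I by (intro nn_integral_mono mult_left_mono) (auto simp: indicator_def)
  finally show ?thesis .
qed

lemma hit_wt_le_part_fun: "hit_wt k l I X \<le> part_fun k l I"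
  unfolding hit_wt_def part_fun_def by (intro nn_integral_mono) (auto simp: indicator_def)

text \<open>On [0,1] every integrand has constant sign, so both \<open>eintegral\<close> terms are
  negated nonnegative integrals. \<open>jacobi_B\<close> enters as an additive real number, so
  minimizing the rate is minimizing the energy even before its value is known.\<close>

lemma jacobi_rate_eq:
  assumes \<rho>: "0 < \<rho>" "0 \<le> \<kappa>" "0 \<le> lam" and M: "prob01 \<mu>"
  shows "jacobi_rate \<rho> \<kappa> lam \<mu> = ereal (\<rho>\<^sup>2) * enn2ereal (energy (\<kappa> / \<rho>) (lam / \<rho>) \<mu>) + ereal (\<rho>\<^sup>2 * jacobi_B (\<kappa> / \<rho>) (lam / \<rho>))"
proof -
  interpret M: prob01 \<mu> by (rule M)
  have sp: "space (\<mu> \<Otimes>\<^sub>M \<mu>) = {0..1} \<times> {0..1}" by (simp add: space_pair_measure)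
  have "eintegral (\<mu> \<Otimes>\<^sub>M \<mu>) (\<lambda>(x, y). elog \<bar>x - y\<bar>) = - enn2ereal (\<integral>\<^sup>+p. (case p of (x, y) \<Rightarrow> log_ker (x - y)) \<partial>(\<mu> \<Otimes>\<^sub>M \<mu>))"
    by (rule eintegral_neg) (auto simp: sp intro!: elog_eq_log_ker)
  also have "(\<integral>\<^sup>+p. (case p of (x, y) \<Rightarrow> log_ker (x - y)) \<partial>(\<mu> \<Otimes>\<^sub>M \<mu>)) = log_en \<mu> \<mu>"
  proof -
    have "(\<lambda>p. log_ker (fst p - snd p)) \<in> borel_measurable (\<mu> \<Otimes>\<^sub>M \<mu>)"
      by (intro measurable_compose[OF _ log_ker_measurable] borel_measurable_diff
        measurable_compose[OF measurable_fst M.id_measurable] measurable_compose[OF measurable_snd M.id_measurable])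
    from M.nn_integral_fst[OF this] show ?thesis
      unfolding log_en_def log_pot_def case_prod_unfold by simp
  qed
  finally have 1: "eintegral (\<mu> \<Otimes>\<^sub>M \<mu>) (\<lambda>(x, y). elog \<bar>x - y\<bar>) = - enn2ereal (log_en \<mu> \<mu>)" .
  have 2: "eintegral \<mu> (\<lambda>x. ereal \<kappa> * elog x + ereal lam * elog (1 - x)) = - enn2ereal (\<integral>\<^sup>+x. ext_pot \<kappa> lam x \<partial>\<mu>)"
    using \<rho> by (intro eintegral_neg elog_ext_pot(2)) auto
  let ?v = "\<integral>\<^sup>+x. ext_pot (\<kappa> / \<rho>) (lam / \<rho>) x \<partial>\<mu>"
  have "(\<integral>\<^sup>+x. ext_pot \<kappa> lam x \<partial>\<mu>) = (\<integral>\<^sup>+x. ennreal \<rho> * ext_pot (\<kappa> / \<rho>) (lam / \<rho>) x \<partial>\<mu>)"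
    using \<rho> by (intro nn_integral_cong) (simp add: ext_pot_scale)
  also have "\<dots> = ennreal \<rho> * ?v" by (intro nn_integral_cmult M.borel_measurable_mu ext_pot_measurable)
  finally have "ennreal \<rho> * (\<integral>\<^sup>+x. ext_pot \<kappa> lam x \<partial>\<mu>) = ennreal (\<rho>\<^sup>2) * ?v"
    using \<rho> by (simp add: mult.assoc[symmetric] ennreal_mult[symmetric] power2_eq_square)
  then have 3: "ereal \<rho> * enn2ereal (\<integral>\<^sup>+x. ext_pot \<kappa> lam x \<partial>\<mu>) = enn2ereal (ennreal (\<rho>\<^sup>2) * ?v)"
    using \<rho> by (simp flip: enn2ereal_cmult)
  have "- (ereal (\<rho>\<^sup>2) * - enn2ereal (log_en \<mu> \<mu>)) - ereal \<rho> * - enn2ereal (\<integral>\<^sup>+x. ext_pot \<kappa> lam x \<partial>\<mu>)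
     = ereal (\<rho>\<^sup>2) * enn2ereal (log_en \<mu> \<mu>) + ereal \<rho> * enn2ereal (\<integral>\<^sup>+x. ext_pot \<kappa> lam x \<partial>\<mu>)"
    by (simp add: minus_ereal_def)
  also have "\<dots> = enn2ereal (ennreal (\<rho>\<^sup>2) * log_en \<mu> \<mu> + ennreal (\<rho>\<^sup>2) * ?v)"
    unfolding 3 plus_ennreal.rep_eq by (simp add: enn2ereal_cmult)
  also have "\<dots> = ereal (\<rho>\<^sup>2) * enn2ereal (energy (\<kappa> / \<rho>) (lam / \<rho>) \<mu>)"
    unfolding energy_def distrib_left[symmetric] by (rule enn2ereal_cmult) simp
  finally show ?thesis unfolding jacobi_rate_def 1 2 by simp
qed

section \<open>The large deviation principle\<close>

lemma filterlim_eventually_eq: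
  "filterlim f F G \<Longrightarrow> eventually (\<lambda>x. f x = g x) G \<Longrightarrow> filterlim g F G"
  using filterlim_cong[OF refl refl, of f g G F] by simp

context
  fixes n :: "nat \<Rightarrow> nat" and k l :: "nat \<Rightarrow> real" and \<rho> \<kappa> lam :: real
  assumes sc: "jacobi_scaling n k l \<rho> \<kappa> lam"
begin

lemma scaling_facts:
  "0 < \<rho>" "0 \<le> \<kappa>" "0 \<le> lam" "\<And>N. 1 \<le> N \<Longrightarrow> 1 \<le> n N" "\<And>N. 1 \<le> N \<Longrightarrow> 0 \<le> k N" "\<And>N. 1 \<le> N \<Longrightarrow> 0 \<le> l N"
  "(\<lambda>N. real (n N) / real N) \<longlonglongrightarrow> \<rho>" "(\<lambda>N. k N / real N) \<longlonglongrightarrow> \<kappa>" "(\<lambda>N. l N / real N) \<longlonglongrightarrow> lam"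
  using sc unfolding jacobi_scaling_def by auto

lemma scaling_shift: "(\<lambda>N. (real (n N) - e) / real N) \<longlonglongrightarrow> \<rho>"
proof -
  have "(\<lambda>N. e / real N) \<longlonglongrightarrow> 0" by real_asymp
  from tendsto_diff[OF scaling_facts(7) this] show ?thesis by (simp add: diff_divide_distrib)
qed

lemma scaling_n_at_top: "filterlim (\<lambda>N. real (n N)) at_top sequentially"
proof -
  have "filterlim (\<lambda>N. real (n N) / real N * real N) at_top sequentially"
    by (rule filterlim_tendsto_pos_mult_at_top[OF scaling_facts(7,1) filterlim_real_sequentially])
  moreover have "\<forall>\<^sub>F N in sequentially. real (n N) / real N * real N = real (n N)"
    using eventually_gt_at_top[of 0] by eventually_elim simp
  ultimately show ?thesis by (rule filterlim_eventually_eq)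
qed

text \<open>Here e is the number of removed particles, 0 for the full ensemble and 1 after a
  removal. The exponents are kept, since their ratios to n and to n - 1 have the same
  limits.\<close>

lemma scaling_jacobi_regime:
  assumes I: "\<And>N. finite (I N)" "\<And>N. 1 \<le> N \<Longrightarrow> real (card (I N)) = real (n N) - e"
  shows "filterlim (\<lambda>N. (I N, k N, l N)) (jacobi_regime (\<kappa> / \<rho>) (lam / \<rho>)) sequentially"
proof (rule filterlim_jacobi_regime)
  have ev: "\<forall>\<^sub>F N in sequentially. 1 \<le> N" by (rule eventually_ge_at_top)
  have m: "(\<lambda>N. real (card (I N)) / real N) \<longlonglongrightarrow> \<rho>"
    by (rule Lim_transform_eventually[OF scaling_shift[of e]]) (use ev in \<open>eventually_elim, simp add: I(2)\<close>)
  have "filterlim (\<lambda>N. real (card (I N)) / real N * real N) at_top sequentially"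
    by (rule filterlim_tendsto_pos_mult_at_top[OF m scaling_facts(1) filterlim_real_sequentially])
  moreover have "\<forall>\<^sub>F N in sequentially. real (card (I N)) / real N * real N = pnum (I N, k N, l N)"
    using ev by eventually_elim simp
  ultimately show "filterlim (\<lambda>N. pnum (I N, k N, l N)) at_top sequentially"
    by (rule filterlim_eventually_eq)
  have q: "(\<lambda>N. f N / real (card (I N))) \<longlonglongrightarrow> c / \<rho>" if "(\<lambda>N. f N / real N) \<longlonglongrightarrow> c" for f c
  proof (rule Lim_transform_eventually)
    show "(\<lambda>N. (f N / real N) / (real (card (I N)) / real N)) \<longlonglongrightarrow> c / \<rho>"
      using scaling_facts(1) by (intro tendsto_divide that m) simp
    show "\<forall>\<^sub>F N in sequentially. (f N / real N) / (real (card (I N)) / real N) = f N / real (card (I N))"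
      using ev by eventually_elim simp
  qed
  show "(\<lambda>N. pleft (I N, k N, l N) / pnum (I N, k N, l N)) \<longlonglongrightarrow> \<kappa> / \<rho>" using q[OF scaling_facts(8)] by simp
  show "(\<lambda>N. pright (I N, k N, l N) / pnum (I N, k N, l N)) \<longlonglongrightarrow> lam / \<rho>" using q[OF scaling_facts(9)] by simp
  show "\<forall>\<^sub>F N in sequentially. finite (fst (I N, k N, l N)) \<and> 0 \<le> pleft (I N, k N, l N) \<and> 0 \<le> pright (I N, k N, l N)"
    using ev by eventually_elim (simp add: I scaling_facts)
qed

text \<open>For each N let w N be a label whose removal violates Q, if there is one. Q holds
  eventually along this single worst-case sequence, hence for all removals simultaneously.\<close>

lemma eventually_all_removals:
  assumes Q: "\<forall>\<^sub>F p in jacobi_regime (\<kappa> / \<rho>) (lam / \<rho>). Q p"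
  shows "\<forall>\<^sub>F N in sequentially. \<forall>i\<in>{1..n N}. Q ({1..n N} - {i}, k N, l N)"
proof -
  have "\<exists>i. (1 \<le> N \<longrightarrow> i \<in> {1..n N}) \<and>
      (Q ({1..n N} - {i}, k N, l N) \<longrightarrow> (\<forall>j\<in>{1..n N}. Q ({1..n N} - {j}, k N, l N)))" for N
  proof (cases "\<exists>i\<in>{1..n N}. \<not> Q ({1..n N} - {i}, k N, l N)")
    case False
    then show ?thesis using scaling_facts(4)[of N] by (intro exI[of _ 1]) auto
  qed blast
  then obtain w where w1: "\<And>N. 1 \<le> N \<Longrightarrow> w N \<in> {1..n N}"
    and w: "\<And>N. Q ({1..n N} - {w N}, k N, l N) \<Longrightarrow> \<forall>j\<in>{1..n N}. Q ({1..n N} - {j}, k N, l N)"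
    by metis
  have "filterlim (\<lambda>N. ({1..n N} - {w N}, k N, l N)) (jacobi_regime (\<kappa> / \<rho>) (lam / \<rho>)) sequentially"
  proof (rule scaling_jacobi_regime[where e=1])
    fix N :: nat assume "1 \<le> N"
    then show "real (card ({1..n N} - {w N})) = real (n N) - 1"
      using w1[of N] by (simp add: of_nat_diff)
  qed simp
  then have "\<forall>\<^sub>F N in sequentially. Q ({1..n N} - {w N}, k N, l N)"
    using Q by (rule eventually_compose_filterlim[rotated])
  then show ?thesis by eventually_elim (rule w)
qed

end

lemma elog_leI: "x \<le> exp y \<Longrightarrow> elog x \<le> ereal y"
proof (cases "x \<le> 0")
  case False
  assume "x \<le> exp y"
  then have "ln x \<le> ln (exp y)" using False by (intro ln_mono) auto
  then show ?thesis using False by (simp add: elog_def)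
qed (simp add: elog_def)

lemma elog_geI: "exp y \<le> x \<Longrightarrow> ereal y \<le> elog x"
proof -
  assume x: "exp y \<le> x"
  then have pos: "0 < x" using exp_gt_zero[of y] by linarith
  have "ln (exp y) \<le> ln x" using x by (intro ln_mono) auto
  then show ?thesis using pos by (simp add: elog_def)
qed

section \<open>Identification of the constants and of the rate function\<close>

context equilibrium begin

lemma lnZ_lim: "((\<lambda>p. ln (enn2real (part_fun (pleft p) (pright p) (fst p))) / (pnum p)\<^sup>2) \<longlongrightarrow> - J0) (jacobi_regime a b)"
proof (rule tendstoI)
  fix e :: real assume "0 < e"
  then have e: "0 < e / 2" by simp
  show "\<forall>\<^sub>F p in jacobi_regime a b. dist (ln (enn2real (part_fun (pleft p) (pright p) (fst p))) / (pnum p)\<^sup>2) (- J0) < e"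
    using part_fun_lower[OF e] part_fun_upper[OF e] jacobi_regime_ok[of a b]
  proof eventually_elim
    case (elim p)
    define m where "m = (pnum p)\<^sup>2"
    have m: "0 < m" using elim(3) by (simp add: m_def)
    obtain z where z: "part_fun (pleft p) (pright p) (fst p) = ennreal z" "0 \<le> z"
      using part_fun_le_1[of "pleft p" "pright p" "fst p"] by (cases "part_fun (pleft p) (pright p) (fst p)") (auto simp: top_unique)
    have b: "exp (- (m * (J0 + e / 2))) \<le> z" "z \<le> exp (- (m * (J0 - e / 2)))"
      using elim(1,2) z by (simp_all add: m_def ennreal_le_iff)
    have zp: "0 < z" using b(1) exp_gt_zero[of "- (m * (J0 + e / 2))"] by linarith
    have "- (m * (J0 + e / 2)) \<le> ln z" "ln z \<le> - (m * (J0 - e / 2))"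
      using ln_mono[OF b(1) exp_gt_zero] ln_mono[OF b(2) zp] by (simp_all only: ln_exp)
    then have "- (J0 + e / 2) \<le> ln z / m" "ln z / m \<le> - (J0 - e / 2)" using m by (simp_all add: field_simps)
    then show ?case using \<open>0 < e\<close> z unfolding m_def by (simp add: dist_real_def abs_less_iff)
  qed
qed

lemma jacobi_Z_lim:
  assumes sc: "jacobi_scaling n k l \<rho> \<kappa> lam" and ab_eq: "\<kappa> / \<rho> = a" "lam / \<rho> = b"
  shows "(\<lambda>N. ln (enn2real (jacobi_Z (n N) (k N) (l N))) / (real N)\<^sup>2) \<longlonglongrightarrow> \<rho>\<^sup>2 * - J0"
proof (rule Lim_transform_eventually)
  have fl: "filterlim (\<lambda>N. ({1..n N}, k N, l N)) (jacobi_regime a b) sequentially"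
    using scaling_jacobi_regime[OF sc, of "\<lambda>N. {1..n N}" 0] by (simp add: ab_eq)
  show "(\<lambda>N. (real (n N) / real N)\<^sup>2 * (ln (enn2real (part_fun (k N) (l N) {1..n N})) / (real (n N))\<^sup>2)) \<longlonglongrightarrow> \<rho>\<^sup>2 * - J0"
    using filterlim_compose[OF lnZ_lim fl] by (intro tendsto_mult tendsto_power scaling_facts(7)[OF sc]) simp
  show "\<forall>\<^sub>F N in sequentially. (real (n N) / real N)\<^sup>2 * (ln (enn2real (part_fun (k N) (l N) {1..n N})) / (real (n N))\<^sup>2)
      = ln (enn2real (jacobi_Z (n N) (k N) (l N))) / (real N)\<^sup>2"
    using eventually_ge_at_top[of 1]
  proof eventually_elim
    case (elim N)
    note f = scaling_facts(4,5,6)[OF sc elim]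
    show ?case using f(1) by (simp add: jacobi_Z_eq[OF f] power_divide)
  qed
qed

text \<open>The description must single out one number: \<open>jacobi_Z_lim\<close> shows that - J0
  qualifies, and the admissible sequence n = N, k = a N, l = b N with \<rho> = 1 forces every
  candidate to agree with it.\<close>

lemma jacobi_B_eq: "jacobi_B a b = - J0"
  unfolding jacobi_B_def
proof (rule the_equality)
  show "\<forall>n k l \<rho> \<kappa> lam. jacobi_scaling n k l \<rho> \<kappa> lam \<and> \<kappa> / \<rho> = a \<and> lam / \<rho> = b \<longrightarrow>
    (\<lambda>N. ln (enn2real (jacobi_Z (n N) (k N) (l N))) / (real N)\<^sup>2) \<longlonglongrightarrow> \<rho>\<^sup>2 * - J0"
    using jacobi_Z_lim by blast
next
  fix B
  assume B: "\<forall>n k l \<rho> \<kappa> lam. jacobi_scaling n k l \<rho> \<kappa> lam \<and> \<kappa> / \<rho> = a \<and> lam / \<rho> = b \<longrightarrow>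
    (\<lambda>N. ln (enn2real (jacobi_Z (n N) (k N) (l N))) / (real N)\<^sup>2) \<longlonglongrightarrow> \<rho>\<^sup>2 * B"
  have c: "(\<lambda>N. c * real N / real N) \<longlonglongrightarrow> c" for c :: real
  proof (rule Lim_transform_eventually[OF tendsto_const])
    show "\<forall>\<^sub>F N in sequentially. c = c * real N / real N"
      using eventually_gt_at_top[of 0] by eventually_elim simp
  qed
  have sc: "jacobi_scaling (\<lambda>N. N) (\<lambda>N. a * real N) (\<lambda>N. b * real N) 1 a b"
    unfolding jacobi_scaling_def using ab c[of 1] c[of a] c[of b] by simp
  have "1\<^sup>2 * B = 1\<^sup>2 * - J0"
    by (rule LIMSEQ_unique[OF B[rule_format] jacobi_Z_lim[OF sc]]) (use sc in auto)
  then show "B = - J0" by simp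
qed

context
  fixes \<rho> \<kappa> lam :: real
  assumes \<rho>: "0 < \<rho>" "0 \<le> \<kappa>" "0 \<le> lam" and ab_eq: "\<kappa> / \<rho> = a" "lam / \<rho> = b"
begin

lemma jacobi_mu0_eq: "jacobi_mu0 \<rho> \<kappa> lam = \<mu>"
  unfolding jacobi_mu0_def
proof (rule the_equality)
  show "\<mu> \<in> prob_measures_01 \<and> (\<forall>\<nu>\<in>prob_measures_01. jacobi_rate \<rho> \<kappa> lam \<mu> \<le> jacobi_rate \<rho> \<kappa> lam \<nu>)"
  proof (intro conjI ballI)
    show "\<mu> \<in> prob_measures_01" using M by (simp only: prob01_iff)
    fix \<nu> assume "\<nu> \<in> prob_measures_01"
    then have N: "prob01 \<nu>" by (simp only: prob01_iff)
    show "jacobi_rate \<rho> \<kappa> lam \<mu> \<le> jacobi_rate \<rho> \<kappa> lam \<nu>"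
      unfolding jacobi_rate_eq[OF \<rho> M] jacobi_rate_eq[OF \<rho> N] ab_eq
      using minimal[OF N] by (intro add_right_mono ereal_mult_left_mono) (simp_all add: less_eq_ennreal.rep_eq)
  qed
next
  fix \<nu> assume *: "\<nu> \<in> prob_measures_01 \<and> (\<forall>\<nu>'\<in>prob_measures_01. jacobi_rate \<rho> \<kappa> lam \<nu> \<le> jacobi_rate \<rho> \<kappa> lam \<nu>')"
  then have N: "prob01 \<nu>" by (simp only: prob01_iff)
  have "jacobi_rate \<rho> \<kappa> lam \<nu> \<le> jacobi_rate \<rho> \<kappa> lam \<mu>" using * M by (simp only: prob01_iff)
  then have le: "ereal (\<rho>\<^sup>2) * enn2ereal (energy a b \<nu>) + ereal (\<rho>\<^sup>2 * jacobi_B a b) \<le> ereal (\<rho>\<^sup>2) * enn2ereal (energy a b \<mu>) + ereal (\<rho>\<^sup>2 * jacobi_B a b)"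
    unfolding jacobi_rate_eq[OF \<rho> M] jacobi_rate_eq[OF \<rho> N] ab_eq .
  have "energy a b \<nu> \<le> energy a b \<mu>"
  proof (cases "energy a b \<nu>")
    case (real r)
    then have "\<rho>\<^sup>2 * r \<le> \<rho>\<^sup>2 * J0" using le J0 by simp
    then have "r \<le> J0" using \<rho>(1) by simp
    then show ?thesis unfolding real J0(1) by (intro ennreal_leI)
  next
    case top
    then show ?thesis using le J0 \<rho>(1) by (simp add: top_ereal_def)
  qed
  then show "\<nu> = \<mu>" by (rule minimizer_unique[OF N])
qed

definition rate :: "real \<Rightarrow> ereal" where
  "rate x = ereal (2 * \<rho>) * V_eff \<rho> \<kappa> lam x"

text \<open>In \<open>V_eff\<close> everything is halved: it equals half of \<open>eff_pot\<close>
  minus D0, and the factor 2 \<rho> turns one half into \<rho>. The subtracted constant is finite,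
  so both sides are infinite at the same points.\<close>

lemma rate_eq:
  assumes x: "x \<in> {0..1}"
  shows "rate x = (if eff_pot a b \<mu> x = \<infinity> then \<infinity> else ereal (\<rho> * (enn2real (eff_pot a b \<mu> x) - D0)))"
proof -
  have half: "\<kappa> / (2 * \<rho>) = a / 2" "lam / (2 * \<rho>) = b / 2" using ab_eq by (auto simp: field_simps)
  have ab2: "0 \<le> a / 2" "0 \<le> b / 2" using ab by auto
  have lp: "limit_potential \<rho> \<kappa> lam y = enn2ereal (ext_pot (a / 2) (b / 2) y)" if "y \<in> {0..1}" for y
    unfolding limit_potential_def half by (rule elog_ext_pot(1)[OF ab2 that])
  have v2: "ennreal (1 / 2) * ext_pot a b y = ext_pot (a / 2) (b / 2) y" for y using ext_pot_scale[of "1/2" a b y] ab by simp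
  have "eintegral \<mu> (limit_potential \<rho> \<kappa> lam) = enn2ereal (\<integral>\<^sup>+y. ext_pot (a / 2) (b / 2) y \<partial>\<mu>)"
    by (rule eintegral_pos) (simp add: lp)
  also have "(\<integral>\<^sup>+y. ext_pot (a / 2) (b / 2) y \<partial>\<mu>) = ennreal (1 / 2) * ennreal v0"
    unfolding v2[symmetric] v0(1)[symmetric] by (intro nn_integral_cmult M.borel_measurable_mu ext_pot_measurable)
  also have "\<dots> = ennreal (1 / 2 * v0)" by (rule ennreal_mult[symmetric]) (use v0(2) in auto)
  finally have ei: "eintegral \<mu> (limit_potential \<rho> \<kappa> lam) = ereal (v0 / 2)" using v0(2) by simp
  \<comment> \<open>With B = - J0 this reads J0 - v0 / 2 = e0 + v0 / 2 = D0 / 2.\<close>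
  have D: "jacobi_D \<rho> \<kappa> lam = ereal (D0 / 2)"
    unfolding jacobi_D_def jacobi_mu0_eq ei ab_eq jacobi_B_eq by (simp add: J0_def D0_def field_simps)
  have el: "eintegral \<mu> (\<lambda>y. elog \<bar>x - y\<bar>) = - enn2ereal (log_pot \<mu> x)"
    unfolding log_pot_def using x by (intro eintegral_neg elog_eq_log_ker) auto
  have V: "V_eff \<rho> \<kappa> lam x = enn2ereal (ext_pot (a / 2) (b / 2) x) - - enn2ereal (log_pot \<mu> x) - ereal (D0 / 2)"
    unfolding V_eff_def jacobi_mu0_eq el D lp[OF x] ..
  have P: "eff_pot a b \<mu> x = 2 * (ext_pot (a / 2) (b / 2) x + log_pot \<mu> x)"
  proof -
    have "2 * ext_pot (a / 2) (b / 2) x = ext_pot a b x" using ext_pot_scale[of 2 "a/2" "b/2" x] ab by simp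
    then show ?thesis by (simp add: eff_pot_def distrib_left)
  qed
  show ?thesis
  proof (cases "ext_pot (a / 2) (b / 2) x = \<infinity> \<or> log_pot \<mu> x = \<infinity>")
    case True
    then show ?thesis unfolding rate_def V P using \<rho>(1) by (auto simp: ennreal_mult_top)
  next
    case False
    then obtain r s where rs: "ext_pot (a / 2) (b / 2) x = ennreal r" "0 \<le> r" "log_pot \<mu> x = ennreal s" "0 \<le> s"
      by (cases "ext_pot (a / 2) (b / 2) x"; cases "log_pot \<mu> x") auto
    have P': "eff_pot a b \<mu> x = ennreal (2 * (r + s))" unfolding P rs using rs by (simp add: ennreal_mult)
    have R: "enn2real (ennreal (2 * (r + s))) = 2 * (r + s)" using rs by (intro enn2real_ennreal) auto
    have "ereal (2 * \<rho>) * (enn2ereal (ennreal r) - - enn2ereal (ennreal s) - ereal (D0 / 2)) = ereal (\<rho> * (2 * (r + s) - D0))"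
      using rs(2,4) by (simp add: algebra_simps)
    then show ?thesis unfolding rate_def V P' R rs by simp
  qed
qed

lemma less_rate_iff:
  assumes x: "x \<in> {0..1}" and t: "0 \<le> t"
  shows "ereal t < rate x \<longleftrightarrow> ennreal (t / \<rho> + D0) < eff_pot a b \<mu> x"
proof (cases "eff_pot a b \<mu> x")
  case (real r)
  have "ereal t < rate x \<longleftrightarrow> t < \<rho> * (r - D0)" unfolding rate_eq[OF x] real using real(1) by simp
  also have "\<dots> \<longleftrightarrow> t / \<rho> + D0 < r" using \<rho>(1) by (simp add: field_simps)
  also have "\<dots> \<longleftrightarrow> ennreal (t / \<rho> + D0) < eff_pot a b \<mu> x"
    unfolding real using t \<rho>(1) D0_nonneg by (intro ennreal_less_iff[symmetric]) auto
  finally show ?thesis .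
next
  case top
  then show ?thesis unfolding rate_eq[OF x] by simp
qed

lemma rate_nonneg: "x \<in> {0..1} \<Longrightarrow> 0 \<le> rate x"
proof (cases "eff_pot a b \<mu> x")
  case (real r)
  assume x: "x \<in> {0..1}"
  have "D0 \<le> r" using D0_le_eff_pot[OF x] real by (simp add: ennreal_le_iff)
  then show ?thesis unfolding rate_eq[OF x] real using real(1) \<rho>(1) by simp
qed (simp add: rate_eq)

lemma rate_lsc: "lower_semicontinuous_on {0..1} rate"
  unfolding lower_semicontinuous_on_def
proof (intro ballI allI impI)
  fix x c assume x: "x \<in> {0..1}" and c: "c < rate x"
  have in01: "\<forall>\<^sub>F y in at x within {0..1}. y \<in> {0..1}" by (simp add: eventually_at_filter)
  show "\<forall>\<^sub>F y in at x within {0..1}. c < rate y"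
  proof (cases "c < 0")
    case True
    then show ?thesis using in01 by (auto elim!: eventually_mono intro: less_le_trans[OF _ rate_nonneg])
  next
    case False
    then obtain t where t: "c = ereal t" "0 \<le> t" using c by (cases c) auto
    have "ennreal (t / \<rho> + D0) < eff_pot a b \<mu> x" using c x t less_rate_iff by blast
    from eff_pot_lsc[OF ab M x this] in01 show ?thesis
      by eventually_elim (use t less_rate_iff in blast)
  qed
qed

end

end

lemma lsc_sublevel_compact:
  fixes f :: "'a::metric_space \<Rightarrow> ereal"
  assumes S: "compact S" and f: "lower_semicontinuous_on S f"
  shows "compact {x\<in>S. f x \<le> K}"
proof -
  have "closed {x\<in>S. f x \<le> K}"
    unfolding closed_sequential_limits
  proof (intro allI impI, elim conjE)
    fix X x assume X: "\<forall>n. X n \<in> {x\<in>S. f x \<le> K}" "X \<longlonglongrightarrow> x"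
    have x: "x \<in> S" using compact_imp_closed[OF S] X unfolding closed_sequential_limits by blast
    moreover have "f x \<le> K"
    proof (rule ccontr)
      assume "\<not> f x \<le> K"
      then have lt: "K < f x" by simp
      \<comment> \<open>The filter in \<open>lower_semicontinuous_on\<close> excludes the point x
        itself, so the sequence must be seen to avoid it.\<close>
      have "X n \<noteq> x" for n
      proof
        assume "X n = x"
        then show False using X(1) lt by (auto dest: spec[of _ n])
      qed
      then have "filterlim X (at x within S) sequentially"
        using X by (auto simp: filterlim_at)
      moreover have "\<forall>\<^sub>F y in at x within S. K < f y" using f x lt unfolding lower_semicontinuous_on_def by blast
      ultimately have "\<forall>\<^sub>F n in sequentially. K < f (X n)" by (rule eventually_compose_filterlim[rotated])
      then obtain n where "K < f (X n)" by (auto simp: eventually_sequentially)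
      then show False using X(1) by (auto dest: spec[of _ n])
    qed
    ultimately show "x \<in> {x\<in>S. f x \<le> K}" by simp
  qed
  then have "compact (S \<inter> {x\<in>S. f x \<le> K})" by (intro compact_Int_closed S)
  also have "S \<inter> {x\<in>S. f x \<le> K} = {x\<in>S. f x \<le> K}" by auto
  finally show ?thesis .
qed

lemma limsup_le_of_tendsto:
  assumes "\<forall>\<^sub>F N in sequentially. u N \<le> ereal (v N)" "v \<longlonglongrightarrow> L"
  shows "limsup u \<le> ereal L"
proof -
  have "limsup u \<le> limsup (\<lambda>N. ereal (v N))" by (rule Limsup_mono[OF assms(1)])
  also have "\<dots> = ereal L" using assms(2) by (intro lim_imp_Limsup) auto
  finally show ?thesis .
qed

lemma liminf_ge_of_tendsto:
  assumes "\<forall>\<^sub>F N in sequentially. ereal (v N) \<le> u N" "v \<longlonglongrightarrow> L"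
  shows "ereal L \<le> liminf u"
proof -
  have "ereal L = liminf (\<lambda>N. ereal (v N))" using assms(2) by (intro lim_imp_Liminf[symmetric]) auto
  also have "\<dots> \<le> liminf u" by (rule Liminf_mono[OF assms(1)])
  finally show ?thesis .
qed

section \<open>Exponential bounds for hitting probabilities and the two halves of the
  principle\<close>

context equilibrium begin

context
  fixes n :: "nat \<Rightarrow> nat" and k l :: "nat \<Rightarrow> real" and \<rho> \<kappa> lam :: real
  assumes sc: "jacobi_scaling n k l \<rho> \<kappa> lam" and ab_eq: "\<kappa> / \<rho> = a" "lam / \<rho> = b"
begin

lemmas sf = scaling_facts[OF sc]

lemma part_fun_removal:
  assumes "i \<in> {1..n N}"
  shows "part_fun (k N) (l N) {1..n N} = (\<integral>\<^sup>+y. insert_wt (k N) (l N) ({1..n N} - {i}) y \<partial>unif01)"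
proof -
  have "insert i ({1..n N} - {i}) = {1..n N}" using assms by auto
  then show ?thesis using part_fun_insert[of "{1..n N} - {i}" i "k N" "l N"] by simp
qed

lemma jacobi_regime_part_fun_pos: "\<forall>\<^sub>F p in jacobi_regime a b. part_fun (pleft p) (pright p) (fst p) \<noteq> 0"
  using part_fun_lower[OF zero_less_one] by eventually_elim (auto simp: ennreal_eq_0_iff)

text \<open>Each particle enters F with unnormalized weight at most exp(- c m) times the partition
  function of the others, while Z is at least exp(- c2 m) times the same number. The factor n of the
  union bound is harmless at exponential scale.\<close>

lemma hit_upper_eventually:
  assumes F: "closed F" "F \<subseteq> {0..1}" and c: "\<And>y. y \<in> F \<Longrightarrow> ennreal c < eff_pot a b \<mu> y" and c2: "D0 < c2"
  shows "\<forall>\<^sub>F N in sequentially. jacobi_hit (n N) (k N) (l N) F \<le> real (n N) * exp (- ((c - c2) * (real (n N) - 1)))"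
proof -
  have "\<forall>\<^sub>F p in jacobi_regime a b. (\<forall>y\<in>F. insert_wt (pleft p) (pright p) (fst p) y \<le> ennreal (exp (- (c * pnum p))) * part_fun (pleft p) (pright p) (fst p))
     \<and> ennreal (exp (- (c2 * pnum p))) * part_fun (pleft p) (pright p) (fst p) \<le> (\<integral>\<^sup>+y. insert_wt (pleft p) (pright p) (fst p) y \<partial>unif01)
     \<and> part_fun (pleft p) (pright p) (fst p) \<noteq> 0"
    by (intro eventually_conj insert_wt_upper[OF F c] part_fun_insert_lower[OF c2] jacobi_regime_part_fun_pos)
  from eventually_all_removals[OF sc this[folded ab_eq]] eventually_ge_at_top[of 1] show ?thesis
  proof eventually_elim
    case (elim N)
    let ?Z = "part_fun (k N) (l N) {1..n N}" and ?I = "\<lambda>i. {1..n N} - {i}"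
    define m where "m = real (n N) - 1"
    note f = sf(4,5,6)[OF elim(2)]
    have card: "real (card (?I i)) = m" if "i \<in> {1..n N}" for i using that f(1) by (simp add: m_def of_nat_diff)
    have Xb: "F \<in> sets borel" using F(1) by simp
    have one: "n N \<in> {1..n N}" using f(1) by simp
    obtain z where z: "?Z = ennreal z" "0 \<le> z" using part_fun_le_1[of "k N" "l N" "{1..n N}"] by (cases ?Z) (auto simp: top_unique)
    have Zi: "ennreal (exp (- (c2 * m))) * part_fun (k N) (l N) (?I i) \<le> ?Z" "part_fun (k N) (l N) (?I i) \<noteq> 0" if "i \<in> {1..n N}" for i
      using bspec[OF elim(1) that] unfolding part_fun_removal[OF that] by (simp_all only: simp_thms fst_conv snd_conv card[OF that])
    have NF: "\<forall>y\<in>F. insert_wt (k N) (l N) (?I i) y \<le> ennreal (exp (- (c * m))) * part_fun (k N) (l N) (?I i)" if "i \<in> {1..n N}" for i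
      using bspec[OF elim(1) that] unfolding fst_conv snd_conv card[OF that] by blast
    have Znz: "?Z \<noteq> 0"
    proof
      assume "?Z = 0"
      then show False using Zi[OF one] by (simp add: ennreal_eq_0_iff)
    qed
    have term_le: "(\<integral>\<^sup>+y. insert_wt (k N) (l N) (?I i) y * indicator F y \<partial>unif01) \<le> ennreal (exp (- ((c - c2) * m)) * z)"
      if i: "i \<in> {1..n N}" for i
    proof -
      have "(\<integral>\<^sup>+y. insert_wt (k N) (l N) (?I i) y * indicator F y \<partial>unif01) \<le> ennreal (exp (- (c * m))) * part_fun (k N) (l N) (?I i)"
      proof (rule nn_unif01_le_const)
        fix y
        show "insert_wt (k N) (l N) (?I i) y * indicator F y \<le> ennreal (exp (- (c * m))) * part_fun (k N) (l N) (?I i)"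
          using NF[OF i] by (cases "y \<in> F") simp_all
      qed
      also have "\<dots> = ennreal (exp (- ((c - c2) * m)) * exp (- (c2 * m))) * part_fun (k N) (l N) (?I i)"
        by (simp add: exp_add[symmetric] algebra_simps)
      also have "\<dots> = ennreal (exp (- ((c - c2) * m))) * (ennreal (exp (- (c2 * m))) * part_fun (k N) (l N) (?I i))"
        by (simp add: ennreal_mult mult.assoc)
      also have "\<dots> \<le> ennreal (exp (- ((c - c2) * m))) * ennreal z"
        using Zi(1)[OF i] z(1) by (intro mult_left_mono) auto
      also have "\<dots> = ennreal (exp (- ((c - c2) * m)) * z)" using z(2) by (simp add: ennreal_mult)
      finally show ?thesis .
    qed
    have "hit_wt (k N) (l N) {1..n N} F \<le> (\<Sum>i\<in>{1..n N}. ennreal (exp (- ((c - c2) * m)) * z))"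
      by (rule order_trans[OF hit_wt_le_sum sum_mono]) (use Xb term_le in auto)
    also have "\<dots> = ennreal (real (n N) * (exp (- ((c - c2) * m)) * z))"
      using z(2) by (simp add: ennreal_mult ennreal_of_nat_eq_real_of_nat)
    finally have H: "hit_wt (k N) (l N) {1..n N} F \<le> ennreal (real (n N) * exp (- ((c - c2) * m)) * z)" by (simp add: mult.assoc)
    have zp: "0 < z" using z Znz by (cases "z = 0") auto
    obtain h where h: "hit_wt (k N) (l N) {1..n N} F = ennreal h" "0 \<le> h"
      using H by (cases "hit_wt (k N) (l N) {1..n N} F") (auto simp: top_unique)
    have hle: "h \<le> real (n N) * exp (- ((c - c2) * m)) * z" using H h z(2) by (simp add: ennreal_le_iff)
    have "jacobi_hit (n N) (k N) (l N) F = enn2real (ennreal h / ennreal z)"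
      using jacobi_hit_eq[OF f Xb Znz] by (simp only: h(1) z(1))
    also have "\<dots> = h / z" using h(2) zp by (simp add: divide_ennreal)
    also have "\<dots> \<le> real (n N) * exp (- ((c - c2) * m))" using hle zp by (simp add: divide_le_eq)
    finally show ?case by (simp add: m_def)
  qed
qed

text \<open>It is enough that the particle labelled \<open>n N\<close> falls into U. The
  normalization must now be bounded from above, which is why c2 lies below D0.\<close>

lemma hit_lower_eventually:
  assumes x: "x \<in> {0..1}" "eff_pot a b \<mu> x < ennreal c" and U: "openin (top_of_set {0..1}) U" "x \<in> U" and c2: "c2 < D0"
  shows "\<forall>\<^sub>F N in sequentially. exp (- ((c - c2) * (real (n N) - 1))) \<le> jacobi_hit (n N) (k N) (l N) U"
proof -
  have Ub: "U \<in> sets borel"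
  proof -
    obtain T where T: "open T" "U = {0..1} \<inter> T" using U(1) unfolding openin_open by blast
    show ?thesis unfolding T(2) using T(1) by (intro sets.Int) simp_all
  qed
  have low: "\<forall>\<^sub>F p in jacobi_regime a b. ennreal (exp (- (c * pnum p))) * part_fun (pleft p) (pright p) (fst p)
     \<le> (\<integral>\<^sup>+y. insert_wt (pleft p) (pright p) (fst p) y * indicator U y \<partial>unif01)"
  proof (rule unif_seg_near[OF x U])
    fix r assume r: "x + r \<in> {0..1}" "r \<noteq> 0" "\<And>u. u \<in> {0..1} \<Longrightarrow> x + r * u \<in> U" "(\<integral>\<^sup>+y. eff_pot a b \<mu> y \<partial>unif_seg x r) < ennreal c"
    show ?thesis by (rule insert_wt_lower[OF x(1) r(1,2) Ub r(3,4)])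
  qed
  have "\<forall>\<^sub>F p in jacobi_regime a b. ennreal (exp (- (c * pnum p))) * part_fun (pleft p) (pright p) (fst p)
       \<le> (\<integral>\<^sup>+y. insert_wt (pleft p) (pright p) (fst p) y * indicator U y \<partial>unif01)
     \<and> (\<integral>\<^sup>+y. insert_wt (pleft p) (pright p) (fst p) y \<partial>unif01) \<le> ennreal (exp (- (c2 * pnum p))) * part_fun (pleft p) (pright p) (fst p)
     \<and> part_fun (pleft p) (pright p) (fst p) \<noteq> 0"
    by (intro eventually_conj low part_fun_insert_upper[OF c2] jacobi_regime_part_fun_pos)
  from eventually_all_removals[OF sc this[folded ab_eq]] eventually_ge_at_top[of 1] show ?thesis
  proof eventually_elim
    case (elim N)
    let ?Z = "part_fun (k N) (l N) {1..n N}" and ?I = "{1..n N} - {n N}"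
    define m where "m = real (n N) - 1"
    note f = sf(4,5,6)[OF elim(2)]
    have one: "n N \<in> {1..n N}" using f(1) by simp
    have card: "real (card ?I) = m" using f(1) by (simp add: m_def of_nat_diff)
    have e: "ennreal (exp (- (c * m))) * part_fun (k N) (l N) ?I \<le> (\<integral>\<^sup>+y. insert_wt (k N) (l N) ?I y * indicator U y \<partial>unif01)"
      "?Z \<le> ennreal (exp (- (c2 * m))) * part_fun (k N) (l N) ?I" "part_fun (k N) (l N) ?I \<noteq> 0"
      using bspec[OF elim(1) one] unfolding part_fun_removal[OF one] by (simp_all only: simp_thms fst_conv snd_conv card)
    obtain z where z: "?Z = ennreal z" "0 \<le> z" using part_fun_le_1[of "k N" "l N" "{1..n N}"] by (cases ?Z) (auto simp: top_unique)
    obtain w where w: "part_fun (k N) (l N) ?I = ennreal w" "0 \<le> w" using part_fun_le_1[of "k N" "l N" ?I] by (cases "part_fun (k N) (l N) ?I") (auto simp: top_unique)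
    have wp: "0 < w" using w e(3) by (cases "w = 0") auto
    obtain h where h: "hit_wt (k N) (l N) {1..n N} U = ennreal h" "0 \<le> h"
      using order_trans[OF hit_wt_le_part_fun part_fun_le_1, of "k N" "l N" "{1..n N}" U] by (cases "hit_wt (k N) (l N) {1..n N} U") (auto simp: top_unique)
    have "ennreal (exp (- (c * m))) * ennreal w \<le> ennreal h"
      using order_trans[OF e(1) hit_wt_ge[OF finite_atLeastAtMost one Ub]] unfolding w(1) h(1) .
    then have hw: "exp (- (c * m)) * w \<le> h" using w(2) h(2) by (simp add: ennreal_mult[symmetric] ennreal_le_iff)
    have "ennreal z \<le> ennreal (exp (- (c2 * m)) * w)" using e(2) w(2) unfolding w(1) z(1) by (simp add: ennreal_mult)
    then have zw: "z \<le> exp (- (c2 * m)) * w" using w(2) by (simp add: ennreal_le_iff)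
    have "0 < exp (- (c * m)) * w" using wp by simp
    then have "0 < h" using hw by linarith
    moreover have "h \<le> z" using hit_wt_le_part_fun[of "k N" "l N" "{1..n N}" U] z(2) unfolding h(1) z(1) by (simp add: ennreal_le_iff)
    ultimately have zp: "0 < z" by linarith
    then have Znz: "?Z \<noteq> 0" unfolding z(1) by (simp add: ennreal_eq_0_iff)
    have "exp (- ((c - c2) * m)) * z \<le> exp (- ((c - c2) * m)) * (exp (- (c2 * m)) * w)"
      using zw by (intro mult_left_mono) auto
    also have "\<dots> = exp (- (c * m)) * w" by (simp add: mult.assoc[symmetric] exp_add[symmetric] algebra_simps)
    also have "\<dots> \<le> h" by (rule hw)
    finally have "exp (- ((c - c2) * m)) \<le> h / z" using zp by (simp add: le_divide_eq)
    also have "\<dots> = enn2real (ennreal h / ennreal z)" using h(2) zp by (simp add: divide_ennreal)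
    also have "\<dots> = jacobi_hit (n N) (k N) (l N) U"
      using jacobi_hit_eq[OF f Ub Znz] by (simp only: h(1) z(1))
    finally show ?case by (simp add: m_def)
  qed
qed

lemma ln_n_div_N: "(\<lambda>N. ln (real (n N)) / real N) \<longlonglongrightarrow> 0"
proof (rule Lim_transform_eventually)
  have "((\<lambda>x::real. ln x / x) \<longlongrightarrow> 0) at_top" by real_asymp
  from filterlim_compose[OF this scaling_n_at_top[OF sc]]
  have "(\<lambda>N. ln (real (n N)) / real (n N) * (real (n N) / real N)) \<longlonglongrightarrow> 0 * \<rho>"
    by (intro tendsto_mult sf(7))
  then show "(\<lambda>N. ln (real (n N)) / real (n N) * (real (n N) / real N)) \<longlonglongrightarrow> 0" by simp
  show "\<forall>\<^sub>F N in sequentially. ln (real (n N)) / real (n N) * (real (n N) / real N) = ln (real (n N)) / real N"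
    using eventually_ge_at_top[of 1] by eventually_elim (use sf(4) in force)
qed

lemma limsup_hit_le:
  assumes F: "closed F" "F \<subseteq> {0..1}" and t: "0 \<le> t" and lt: "\<And>y. y \<in> F \<Longrightarrow> ereal t < rate \<rho> \<kappa> lam y"
  shows "limsup (\<lambda>N. ereal (1 / real N) * elog (jacobi_hit (n N) (k N) (l N) F)) \<le> ereal (- t)"
proof (rule ereal_le_epsilon2)
    fix e :: real assume e: "0 < e"
    \<comment> \<open>c is the level of \<open>eff_pot\<close> that corresponds to the rate t. With
      c2 above D0 by e / \<rho> one has \<open>(c - c2) * \<rho> = t - e\<close>.\<close>
    define c where "c = t / \<rho> + D0"
    define c2 where "c2 = D0 + e / \<rho>"
    have c: "ennreal c < eff_pot a b \<mu> y" if "y \<in> F" for y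
      using less_rate_iff[OF sf(1,2,3) ab_eq _ t, of y] lt[OF that] F(2) that by (auto simp: c_def)
    have c2: "D0 < c2" using e sf(1) by (simp add: c2_def)
    have ev: "\<forall>\<^sub>F N in sequentially. jacobi_hit (n N) (k N) (l N) F \<le> real (n N) * exp (- ((c - c2) * (real (n N) - 1)))"
      by (rule hit_upper_eventually[OF F c c2])
    have "limsup (\<lambda>N. ereal (1 / real N) * elog (jacobi_hit (n N) (k N) (l N) F)) \<le> ereal (0 - (c - c2) * \<rho>)"
    proof (rule limsup_le_of_tendsto)
      show "(\<lambda>N. ln (real (n N)) / real N - (c - c2) * ((real (n N) - 1) / real N)) \<longlonglongrightarrow> 0 - (c - c2) * \<rho>"
        by (intro tendsto_intros ln_n_div_N scaling_shift[OF sc])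
      show "\<forall>\<^sub>F N in sequentially. ereal (1 / real N) * elog (jacobi_hit (n N) (k N) (l N) F)
          \<le> ereal (ln (real (n N)) / real N - (c - c2) * ((real (n N) - 1) / real N))"
        using ev eventually_ge_at_top[of 1]
      proof eventually_elim
        case (elim N)
        have n: "0 < real (n N)" using sf(4)[OF elim(2)] by simp
        have "real (n N) * exp (- ((c - c2) * (real (n N) - 1))) = exp (ln (real (n N)) - (c - c2) * (real (n N) - 1))"
          using n by (simp add: exp_diff exp_minus divide_inverse)
        then have "elog (jacobi_hit (n N) (k N) (l N) F) \<le> ereal (ln (real (n N)) - (c - c2) * (real (n N) - 1))"
          using elim(1) by (intro elog_leI) simp
        then have "ereal (1 / real N) * elog (jacobi_hit (n N) (k N) (l N) F) \<le> ereal (1 / real N) * ereal (ln (real (n N)) - (c - c2) * (real (n N) - 1))"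
          by (intro ereal_mult_left_mono) auto
        also have "\<dots> = ereal (ln (real (n N)) / real N - (c - c2) * ((real (n N) - 1) / real N))"
        proof -
          have "1 / x * (A - B * C) = A / x - B * (C / x)" for A B C x :: real
            by (simp add: right_diff_distrib)
          then show ?thesis by (simp only: times_ereal.simps(1))
        qed
        finally show ?case .
      qed
    qed
    also have "0 - (c - c2) * \<rho> = - t + e" using sf(1) by (simp add: c_def c2_def field_simps)
    finally show "limsup (\<lambda>N. ereal (1 / real N) * elog (jacobi_hit (n N) (k N) (l N) F)) \<le> ereal (- t) + ereal e" by simp
qed

lemma liminf_hit_ge:
  assumes U: "openin (top_of_set {0..1}) U" "x \<in> U"
  shows "- rate \<rho> \<kappa> lam x \<le> liminf (\<lambda>N. ereal (1 / real N) * elog (jacobi_hit (n N) (k N) (l N) U))"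
proof (cases "eff_pot a b \<mu> x")
  case top
  have "x \<in> {0..1}" using openin_imp_subset[OF U(1)] U(2) by blast
  then show ?thesis using top by (simp add: rate_eq[OF sf(1,2,3) ab_eq])
next
  case (real h)
  have x: "x \<in> {0..1}" using openin_imp_subset[OF U(1)] U(2) by blast
  have R: "rate \<rho> \<kappa> lam x = ereal (\<rho> * (h - D0))" using real by (simp add: rate_eq[OF sf(1,2,3) ab_eq x])
  let ?L = "liminf (\<lambda>N. ereal (1 / real N) * elog (jacobi_hit (n N) (k N) (l N) U))"
  show ?thesis
  proof (rule ereal_le_epsilon2)
      fix e :: real assume e: "0 < e"
      \<comment> \<open>The error e is shared equally: c lies above the value at x, and c2 below D0,
        by e / (2 \<rho>) each.\<close>
      define c where "c = h + e / (2 * \<rho>)"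
      define c2 where "c2 = D0 - e / (2 * \<rho>)"
      have "0 < e / (2 * \<rho>)" using e sf(1) by simp
      then have c: "eff_pot a b \<mu> x < ennreal c" unfolding real(2) c_def using real(1) by (intro ennreal_lessI) linarith+
      have c2: "c2 < D0" using e sf(1) by (simp add: c2_def)
      have "ereal (- ((c - c2) * \<rho>)) \<le> ?L"
      proof (rule liminf_ge_of_tendsto)
        show "(\<lambda>N. - ((c - c2) * ((real (n N) - 1) / real N))) \<longlonglongrightarrow> - ((c - c2) * \<rho>)"
          by (intro tendsto_intros scaling_shift[OF sc])
        show "\<forall>\<^sub>F N in sequentially. ereal (- ((c - c2) * ((real (n N) - 1) / real N)))
            \<le> ereal (1 / real N) * elog (jacobi_hit (n N) (k N) (l N) U)"
          using hit_lower_eventually[OF x c U c2]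
        proof eventually_elim
          case (elim N)
          have "ereal (1 / real N) * ereal (- ((c - c2) * (real (n N) - 1))) \<le> ereal (1 / real N) * elog (jacobi_hit (n N) (k N) (l N) U)"
            using elim by (intro ereal_mult_left_mono elog_geI) auto
          then show ?case by simp
        qed
      qed
      then have "ereal (- ((c - c2) * \<rho>)) + ereal e \<le> ?L + ereal e" by (rule add_right_mono)
      moreover have "ereal (- ((c - c2) * \<rho>)) + ereal e = - rate \<rho> \<kappa> lam x"
        unfolding R using sf(1) by (simp add: c_def c2_def field_simps)
      ultimately show "- rate \<rho> \<kappa> lam x \<le> ?L + ereal e" by simp
  qed
qed

text \<open>Once Z is nonzero the ensemble is a probability measure, so hitting probabilities are at
  most 1. This makes the level t chosen in the upper bound nonnegative, as
  \<open>limsup_hit_le\<close> requires.\<close>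

lemma limsup_hit_le_0: "limsup (\<lambda>N. ereal (1 / real N) * elog (jacobi_hit (n N) (k N) (l N) F)) \<le> 0"
proof -
  have fl: "filterlim (\<lambda>N. ({1..n N}, k N, l N)) (jacobi_regime a b) sequentially"
    using scaling_jacobi_regime[OF sc, of "\<lambda>N. {1..n N}" 0] by (simp add: ab_eq)
  have "jacobi_hit (n N) (k N) (l N) F \<le> 1" if "part_fun (k N) (l N) {1..n N} \<noteq> 0" "1 \<le> N" for N
  proof -
    note f = sf(4,5,6)[OF that(2)]
    let ?P = "cube {1..n N}" and ?Z = "part_fun (k N) (l N) {1..n N}"
    have w: "jacobi_weight (n N) (k N) (l N) x = exp_neg (hamilt (k N) (l N) {1..n N} x)" if "x \<in> space ?P" for x
      using space_cubeD[OF that] by (rule jacobi_weight_eq[OF f])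
    have m: "(\<lambda>x. jacobi_weight (n N) (k N) (l N) x / jacobi_Z (n N) (k N) (l N)) \<in> borel_measurable ?P"
      by (subst measurable_cong[of _ _ "\<lambda>x. exp_neg (hamilt (k N) (l N) {1..n N} x) / ?Z"]) (simp_all add: w jacobi_Z_eq[OF f])
    have "emeasure (jacobi_ensemble (n N) (k N) (l N)) (space (jacobi_ensemble (n N) (k N) (l N)))
       = (\<integral>\<^sup>+x. jacobi_weight (n N) (k N) (l N) x / jacobi_Z (n N) (k N) (l N) \<partial>?P)"
      unfolding jacobi_ensemble_def by (subst emeasure_density[OF m]) (auto intro!: nn_integral_cong)
    also have "\<dots> = (\<integral>\<^sup>+x. exp_neg (hamilt (k N) (l N) {1..n N} x) / ?Z \<partial>?P)"
      by (intro nn_integral_cong) (simp add: w jacobi_Z_eq[OF f])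
    also have "\<dots> = ?Z / ?Z" unfolding part_fun_def by (rule nn_integral_divide) measurable
    also have "\<dots> = 1" using that(1) part_fun_le_1[of "k N" "l N" "{1..n N}"] by (intro ennreal_divide_self) (auto simp: less_top[symmetric] top_unique)
    finally have "prob_space (jacobi_ensemble (n N) (k N) (l N))" by (rule prob_spaceI)
    then show ?thesis unfolding jacobi_hit_def by (rule prob_space.prob_le_1)
  qed
  moreover have "\<forall>\<^sub>F N in sequentially. part_fun (k N) (l N) {1..n N} \<noteq> 0"
    using eventually_compose_filterlim[OF jacobi_regime_part_fun_pos fl] by simp
  ultimately have "\<forall>\<^sub>F N in sequentially. ereal (1 / real N) * elog (jacobi_hit (n N) (k N) (l N) F) \<le> ereal 0"
  proof -
    assume le: "\<And>N. part_fun (k N) (l N) {1..n N} \<noteq> 0 \<Longrightarrow> 1 \<le> N \<Longrightarrow> jacobi_hit (n N) (k N) (l N) F \<le> 1"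
      and ev: "\<forall>\<^sub>F N in sequentially. part_fun (k N) (l N) {1..n N} \<noteq> 0"
    show ?thesis using ev eventually_ge_at_top[of 1]
    proof eventually_elim
      case (elim N)
      have "elog (jacobi_hit (n N) (k N) (l N) F) \<le> ereal 0" using le[OF elim] by (intro elog_leI) simp
      then have "ereal (1 / real N) * elog (jacobi_hit (n N) (k N) (l N) F) \<le> ereal (1 / real N) * ereal 0"
        by (intro ereal_mult_left_mono) auto
      then show ?case by simp
    qed
  qed
  from limsup_le_of_tendsto[OF this tendsto_const] show ?thesis by (simp add: zero_ereal_def)
qed

lemma LDP: "satisfies_LDP {0..1} (\<lambda>N X. jacobi_hit (n N) (k N) (l N) X) (\<lambda>N. 1 / real N) (\<lambda>x. ereal (2 * \<rho>) * V_eff \<rho> \<kappa> lam x)"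
proof -
  have r: "(\<lambda>x. ereal (2 * \<rho>) * V_eff \<rho> \<kappa> lam x) = rate \<rho> \<kappa> lam" by (rule ext) (rule rate_def[OF sf(1,2,3) ab_eq, symmetric])
  note rl = rate_lsc[OF sf(1,2,3) ab_eq] and rn = rate_nonneg[OF sf(1,2,3) ab_eq]
  show ?thesis
    unfolding satisfies_LDP_def r
  proof (intro conjI allI impI)
    show "good_rate_function {0..1} (rate \<rho> \<kappa> lam)"
      unfolding good_rate_function_def by (intro conjI ballI allI rl rn lsc_sublevel_compact[OF compact_Icc rl])
    fix U assume U: "openin (top_of_set {0..1::real}) U"
    have "- liminf (\<lambda>N. ereal (1 / real N) * elog (jacobi_hit (n N) (k N) (l N) U)) \<le> (INF x\<in>U. rate \<rho> \<kappa> lam x)"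
      using liminf_hit_ge[OF U] by (intro INF_greatest) (simp add: ereal_uminus_le_reorder)
    then show "- (INF x\<in>U. rate \<rho> \<kappa> lam x) \<le> liminf (\<lambda>N. ereal (1 / real N) * elog (jacobi_hit (n N) (k N) (l N) U))"
      by (simp add: ereal_uminus_le_reorder)
  next
    fix F assume "closedin (top_of_set {0..1::real}) F"
    then have F: "closed F" "F \<subseteq> {0..1}" using closedin_closed_trans closedin_imp_subset by blast+
    let ?L = "limsup (\<lambda>N. ereal (1 / real N) * elog (jacobi_hit (n N) (k N) (l N) F))"
    show "?L \<le> - (INF x\<in>F. rate \<rho> \<kappa> lam x)"
    proof (rule ccontr)
      assume "\<not> ?thesis"
      then have "- ?L < (INF x\<in>F. rate \<rho> \<kappa> lam x)" by (simp add: not_le ereal_uminus_less_reorder)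
      \<comment> \<open>A real level strictly in between also covers an infinite infimum, in
        particular the empty set.\<close>
      then obtain t where t: "- ?L < ereal t" "ereal t < (INF x\<in>F. rate \<rho> \<kappa> lam x)"
        using ereal_dense2 by blast
      have "0 \<le> - ?L" using limsup_hit_le_0[of F] by (simp add: ereal_uminus_le_reorder)
      then have "0 \<le> ereal t" using less_imp_le[OF t(1)] by (rule order_trans)
      then have t0: "0 \<le> t" by simp
      have "ereal t < rate \<rho> \<kappa> lam y" if "y \<in> F" for y using t(2) INF_lower[OF that] by (rule less_le_trans)
      from limsup_hit_le[OF F t0 this] have "?L \<le> ereal (- t)" .
      then have "- ereal (- t) \<le> - ?L" by (simp only: ereal_minus_le_minus)
      then have "ereal t \<le> - ?L" by simp
      then show False using t(1) by simp
    qed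
  qed
qed

end

end

theorem theorem3p3:
  fixes n :: "nat \<Rightarrow> nat" and k l :: "nat \<Rightarrow> real" and \<rho> \<kappa> lam :: real
  assumes "\<And>N. N \<ge> 1 \<Longrightarrow> n N \<ge> 1"
    and "\<And>N. N \<ge> 1 \<Longrightarrow> k N \<ge> 0"
    and "\<And>N. N \<ge> 1 \<Longrightarrow> l N \<ge> 0"
    and "\<rho> > 0" and "\<kappa> \<ge> 0" and "lam \<ge> 0"
    and "(\<lambda>N. real (n N) / real N) \<longlonglongrightarrow> \<rho>"
    and "(\<lambda>N. k N / real N) \<longlonglongrightarrow> \<kappa>"
    and "(\<lambda>N. l N / real N) \<longlonglongrightarrow> lam"
  shows "satisfies_LDP {0..1}
           (\<lambda>N X. jacobi_hit (n N) (k N) (l N) X)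
           (\<lambda>N. 1 / real N)
           (\<lambda>x. ereal (2 * \<rho>) * V_eff \<rho> \<kappa> lam x)"
proof -
  have sc: "jacobi_scaling n k l \<rho> \<kappa> lam"
    unfolding jacobi_scaling_def using assms by blast
  have ab: "0 \<le> \<kappa> / \<rho>" "0 \<le> lam / \<rho>" using assms(4-6) by auto
  show ?thesis
  proof (rule energy_minimizer_exists[OF ab])
    fix \<mu> assume "prob01 \<mu>" "\<And>\<nu>. prob01 \<nu> \<Longrightarrow> energy (\<kappa> / \<rho>) (lam / \<rho>) \<mu> \<le> energy (\<kappa> / \<rho>) (lam / \<rho>) \<nu>"
      "energy (\<kappa> / \<rho>) (lam / \<rho>) \<mu> < \<infinity>"
    with ab have "equilibrium (\<kappa> / \<rho>) (lam / \<rho>) \<mu>" by (intro equilibrium.intro)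
    then show ?thesis by (rule equilibrium.LDP) (rule sc, rule refl, rule refl)
  qed
qed

end
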